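(* Let $Y=\{Y(t),t\geqslant 0\}$ be a spectrally negative Lévy process, i.e., a real-valued Lévy process without upward jumps, whose paths are not almost surely non-increasing. Let $\Phi(\alpha)=\log\mathbb{E}\,e^{\alpha Y(1)}$, $\alpha\geqslant 0$, and let $\Psi(q)=\sup\{\alpha\geqslant 0:\Phi(\alpha)=q\}$, $q\geqslant 0$, be its right-inverse. Let $\omega>0$ and $\beta\geqslant 0$; if $\beta=0$, assume in addition that $\mathbb{E}\,Y(1)<0$. Let $Y_{\beta,\omega}$ be the running maximum of $Y$ at Poisson($\omega$) inspection epochs until the exponential($\beta$) killing time (as defined in the context). Then $Y_{\beta,\omega}$ has an atom at zero, $$\mathbb{P}(Y_{\beta,\omega}=0)=\frac{\Psi(\beta)}{\Psi(\beta+\omega)},$$ and with the complementary probability $1-\mathbb{P}(Y_{\beta,\omega}=0)$ it is exponentially distributed with parameter $\Psi(\beta)$; that is, conditionally on $Y_{\beta,\omega}>0$, $Y_{\beta,\omega}$ is exponentially distributed with parameter $\Psi(\beta)$.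
   Context: $Y(0)=0$. The process $Y$ is inspected at the epochs $0=I_0<I_1<I_2<\dots$ of a Poisson process of intensity $\omega$, independent of $Y$, until an independent exponentially distributed killing time $T_\beta$ with parameter $\beta$. Let $N_{\beta,\omega}$ be the number of inspections before killing, so $\mathbb{P}(N_{\beta,\omega}=n)=\left(\frac{\omega}{\beta+\omega}\right)^n\frac{\beta}{\beta+\omega}$, $n=0,1,\dots$. Let $Z_1,Z_2,\dots$ be the increments of $Y$ between consecutive inspection epochs, conditioned on the process not having been killed; they are i.i.d., distributed as $Y(T_{\beta+\omega})$ with $T_{\beta+\omega}$ exponential with parameter $\beta+\omega$ and independent of $Y$, and they are independent of $N_{\beta,\omega}$. With $S_0=0$ and $S_n=\sum_{m=1}^n Z_m$, define $Y_{\beta,\omega}:=\max_{0\leqslant n\leqslant N_{\beta,\omega}}S_n$. (Equivalently, in law, $Y_{\beta,\omega}$ is the maximum of $Y(I_n)$ over all $n\geqslant 0$ with $I_n\leqslant T_\beta$.) For $\beta=0$ we use the convention $T_0=\infty$, $N_{0,\omega}=\infty$, so that $Y_{0,\omega}=\sup_{n\geqslant 0}S_n$. *)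

theory Defs
  imports "HOL-Probability.Probability"
begin

section \<open>Spectrally negative Levy processes\<close>

context prob_space
begin

text \<open>The \<open>\<sigma>\<close>-algebra generated by the family \<open>X i\<close>, \<open>i \<in> J\<close>, as a system of subsets of the
  sample space. (The library's \<open>indep_var\<close> would force both sides to have the same value type.)\<close>

definition generated_events :: "'b measure \<Rightarrow> 'i set \<Rightarrow> ('i \<Rightarrow> 'a \<Rightarrow> 'b) \<Rightarrow> 'a set set" where
  "generated_events N J X =
     sigma_sets (space M) {X i -` A \<inter> space M | i A. i \<in> J \<and> A \<in> sets N}"

end

text \<open>The time index is \<open>real\<close>; only \<open>Y t\<close> with \<open>t \<ge> 0\<close> is constrained or used.\<close>

locale levy_process = prob_space M for M :: "'a measure" +
  fixes Y :: "real \<Rightarrow> 'a \<Rightarrow> real"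
  assumes measurable_Y: "\<And>t. 0 \<le> t \<Longrightarrow> Y t \<in> borel_measurable M"
    and start_zero: "AE w in M. Y 0 w = 0"
    and independent_increments: "\<And>s t. 0 \<le> s \<Longrightarrow> s \<le> t \<Longrightarrow>
          indep_set (generated_events borel {0..s} Y)
                    (generated_events borel {t} (\<lambda>u w. Y u w - Y s w))"
    and stationary_increments: "\<And>s t. 0 \<le> s \<Longrightarrow> s \<le> t \<Longrightarrow>
          distr M borel (\<lambda>w. Y t w - Y s w) = distr M borel (Y (t - s))"
    and right_continuous_paths: "\<And>w t. w \<in> space M \<Longrightarrow> 0 \<le> t \<Longrightarrow>
          continuous (at_right t) (\<lambda>s. Y s w)"
    and left_limits: "\<And>w t. w \<in> space M \<Longrightarrow> 0 < t \<Longrightarrow>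
          \<exists>l. ((\<lambda>s. Y s w) \<longlongrightarrow> l) (at_left t)"

locale spectrally_negative_levy_process = levy_process +
  assumes no_upward_jumps: "AE w in M. \<forall>t>0. Y t w \<le> Lim (at_left t) (\<lambda>s. Y s w)"
    and not_nonincreasing: "\<not> (AE w in M. antimono_on {0..} (\<lambda>t. Y t w))"

definition laplace_exponent :: "'a measure \<Rightarrow> (real \<Rightarrow> 'a \<Rightarrow> real) \<Rightarrow> real \<Rightarrow> real" where
  "laplace_exponent M Y \<alpha> = ln (\<integral>w. exp (\<alpha> * Y 1 w) \<partial>M)"

definition right_inverse :: "'a measure \<Rightarrow> (real \<Rightarrow> 'a \<Rightarrow> real) \<Rightarrow> real \<Rightarrow> real" where
  "right_inverse M Y q = Sup {\<alpha>. 0 \<le> \<alpha> \<and> laplace_exponent M Y \<alpha> = q}"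

text \<open>The mean of a spectrally negative process may be \<open>-\<infinity>\<close>, whereas the Bochner integral of a
  non-integrable function is \<open>0\<close>; hence an extended-real expectation.\<close>

definition ext_expectation :: "'a measure \<Rightarrow> ('a \<Rightarrow> real) \<Rightarrow> ereal" where
  "ext_expectation M X =
     enn2ereal (\<integral>\<^sup>+w. ennreal (X w) \<partial>M) - enn2ereal (\<integral>\<^sup>+w. ennreal (- X w) \<partial>M)"


section \<open>The running maximum at Poisson inspection epochs\<close>

definition exponential_measure :: "real \<Rightarrow> real measure" where
  "exponential_measure q = density lborel (exponential_density q)"

text \<open>Law of the killing time, with the convention that it is infinite for rate \<open>0\<close>.\<close>

definition killing_law :: "real \<Rightarrow> ereal measure" where
  "killing_law \<beta> =
     (if \<beta> = 0 then return borel \<infinity> else distr (exponential_measure \<beta>) borel ereal)"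

text \<open>First, the running maximum defined through the geometrically killed random walk. Its steps
  \<open>Z 1, Z 2, \<dots>\<close> have the law of \<open>Y\<close> at an independent exponential time of rate \<open>\<beta> + \<omega>\<close>; this law
  is an image of a product measure, where \<open>max 0 t\<close> only discards the null set of negative times.
  The walk may live on a probability space \<open>P\<close> other than that of \<open>Y\<close>. For \<open>\<beta> = 0\<close> the stated
  law of \<open>N\<close> says that \<open>N = \<infinity>\<close> almost surely.\<close>

locale killed_inspection_walk = prob_space P for P :: "'b measure" +
  fixes M :: "'a measure" and Y :: "real \<Rightarrow> 'a \<Rightarrow> real" and \<beta> \<omega> :: real
    and Z :: "nat \<Rightarrow> 'b \<Rightarrow> real" and N :: "'b \<Rightarrow> enat"
  assumes independent_steps: "indep_vars (\<lambda>_. borel) Z {1..}"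
    and step_law: "\<And>m. 1 \<le> m \<Longrightarrow>
          distr P borel (Z m) =
          distr (M \<Otimes>\<^sub>M exponential_measure (\<beta> + \<omega>)) borel (\<lambda>(w, t). Y (max 0 t) w)"
    and measurable_N: "N \<in> P \<rightarrow>\<^sub>M count_space UNIV"
    and N_law: "\<And>n. prob {w \<in> space P. N w = enat n} =
          (\<omega> / (\<beta> + \<omega>)) ^ n * (\<beta> / (\<beta> + \<omega>))"
    and steps_independent_of_N: "indep_set (generated_events borel {1..} Z)
          (generated_events (count_space UNIV) {()} (\<lambda>_. N))"

definition walk_maximum :: "(nat \<Rightarrow> 'b \<Rightarrow> real) \<Rightarrow> ('b \<Rightarrow> enat) \<Rightarrow> 'b \<Rightarrow> ereal" where
  "walk_maximum Z N w = (SUP n\<in>{n. enat n \<le> N w}. ereal (\<Sum>m=1..n. Z m w))"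

text \<open>Second, the same quantity pathwise: \<open>Y\<close> observed at the points \<open>I 1 < I 2 < \<dots>\<close> of a Poisson
  process (independent exponential gaps) and at \<open>I 0 = 0\<close>, up to the killing time \<open>T\<close>.\<close>

locale poisson_inspection = prob_space M for M :: "'a measure" +
  fixes Y :: "real \<Rightarrow> 'a \<Rightarrow> real" and \<beta> \<omega> :: real
    and I :: "nat \<Rightarrow> 'a \<Rightarrow> real" and T :: "'a \<Rightarrow> ereal"
  assumes epoch_zero: "\<And>w. w \<in> space M \<Longrightarrow> I 0 w = 0"
    and epochs_increasing: "\<And>w n. w \<in> space M \<Longrightarrow> I n w < I (Suc n) w"
    and independent_gaps: "indep_vars (\<lambda>_. borel) (\<lambda>n w. I (Suc n) w - I n w) UNIV"
    and gap_law: "\<And>n. distributed M lborel (\<lambda>w. I (Suc n) w - I n w) (exponential_density \<omega>)"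
    and measurable_T: "T \<in> borel_measurable M"
    and killing_time_law: "distr M borel T = killing_law \<beta>"
    and independent_inspection: "indep_sets
          (\<lambda>i. [generated_events borel {0..} Y,
                generated_events borel UNIV I,
                generated_events borel {()} (\<lambda>_. T)] ! i) {..<3}"

definition inspected_maximum ::
    "(real \<Rightarrow> 'a \<Rightarrow> real) \<Rightarrow> (nat \<Rightarrow> 'a \<Rightarrow> real) \<Rightarrow> ('a \<Rightarrow> ereal) \<Rightarrow> 'a \<Rightarrow> ereal" where
  "inspected_maximum Y I T w = (SUP n\<in>{n. ereal (I n w) \<le> T w}. ereal (Y (I n w) w))"

text \<open>Both maxima are extended-real valued so that a supremum over infinitely many epochs is
  meaningful; the last conjunct below forces finiteness almost surely.\<close>

definition exponential_with_atom :: "'a measure \<Rightarrow> ('a \<Rightarrow> ereal) \<Rightarrow> real \<Rightarrow> real \<Rightarrow> bool" where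
  "exponential_with_atom M X p r \<longleftrightarrow>
     X \<in> borel_measurable M \<and>
     measure M {w \<in> space M. X w = 0} = p \<and>
     measure M {w \<in> space M. 0 < X w} = 1 - p \<and>
     distr (uniform_measure M {w \<in> space M. 0 < X w}) borel X =
       distr (exponential_measure r) borel ereal"

end

theory Submission
  imports Defs
begin

text \<open>
  Let \<open>\<tau>\<close> be the first passage time of \<open>Y\<close> above \<open>x \<ge> 0\<close>. As \<open>Y\<close> has no upward jumps, it is
  equal to \<open>x\<close> at \<open>\<tau>\<close>; restarting it there (by approximation along dyadic times, where independence
  of single increments suffices) gives, for \<open>Z = Y(T)\<close> with \<open>T\<close> exponential of rate \<open>q\<close> and
  \<open>y \<ge> 0\<close>, the identity \<open>P(Z > x + y) = E(exp(-q\<tau>); \<tau> < \<infinity>) P(Z \<ge> y)\<close>. Hence the positive part of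
  \<open>Z\<close> is exponential, with a rate \<open>\<rho>(q)\<close> that is unbounded in \<open>q\<close>. This yields all positive
  exponential moments of \<open>Y\<close>, and comparing where \<open>E exp(\<alpha>Z) = q / (q - \<Phi>(\<alpha>))\<close> is finite
  identifies \<open>\<rho>(q) = \<Psi>(q)\<close>.

  With \<open>q = \<beta> + \<omega>\<close>, \<open>r = \<Psi>(\<beta>)\<close> and \<open>\<kappa> = \<omega> / q\<close>, the inspected walk satisfies
  \<open>\<kappa> E exp(rZ) = 1\<close>, so \<open>\<kappa>^n exp(r S(n))\<close> is a martingale. Optional stopping at the first passage
  above \<open>x\<close>, where the overshoot is exponential of rate \<open>\<Psi>(q)\<close>, gives the tail
  \<open>exp(-rx) (1 - r / \<Psi>(q))\<close> of the maximum.
\<close>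

section \<open>Exponential laws\<close>

text \<open>Independence is given only between the past of a fixed time and one later increment, so
  every restart happens at a deterministic time: dyadic crossing times have countably many values,
  and the random passage time appears only in a limit. The exponential clock makes this work, since
  its lack of memory turns elapsed time into a factor \<open>exp(-q s)\<close>. No exponential
  moment is assumed. \<open>laplace_exponent\<close> is the logarithm of a Bochner integral, which
  is 0 for a non-integrable variable, so exponentiality of the positive part of \<open>Z\<close> has
  to come before any use of \<open>\<Phi>\<close>. For the walk, the martingale property alone is
  not enough: the mass that never crosses the level must vanish. This needs a second exponent
  \<open>\<theta> < \<Psi>(\<beta>)\<close> with \<open>\<Phi>(\<theta>) < \<beta>\<close>, at which
  the discounted walk contracts geometrically. For \<open>\<beta> > 0\<close> it comes from the rate
  of the positive part, for \<open>\<beta> = 0\<close> from the negative mean. The pathwise model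
  follows the same argument with \<open>exp(-\<beta> I(n))\<close> in place of
  \<open>\<kappa>^n\<close>.\<close>

lemma sets_exponential_measure [measurable_cong, simp]: "sets (exponential_measure q) = sets borel"
  by (simp add: exponential_measure_def)

lemma space_exponential_measure [simp]: "space (exponential_measure q) = UNIV"
  by (simp add: exponential_measure_def)

lemma prob_space_exponential_measure: "0 < q \<Longrightarrow> prob_space (exponential_measure q)"
  unfolding exponential_measure_def by (rule prob_space_exponential_density)

lemma nn_integral_exponential_measure:
  assumes [measurable]: "f \<in> borel_measurable borel"
  shows "(\<integral>\<^sup>+t. f t \<partial>exponential_measure q) =
    (\<integral>\<^sup>+t. ennreal (exponential_density q t) * f t \<partial>lborel)"
  unfolding exponential_measure_def by (subst nn_integral_density) auto

lemma AE_exponential_measure_nonneg: "AE t in exponential_measure q. 0 \<le> t"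
  unfolding exponential_measure_def
  by (subst AE_density) (auto simp: exponential_density_def)

text \<open>Multiplying the density of rate \<open>q\<close> by \<open>exp(a t)\<close> gives
  \<open>q / (q - a)\<close> times the density of rate \<open>q - a\<close>. With
  \<open>f = 1\<close> this yields exponential moments; with \<open>a = - \<beta>\<close> it absorbs
  killing into the gap between two inspections.\<close>

lemma exponential_tilt:
  assumes [measurable]: "f \<in> borel_measurable borel" and "a < q" "0 < q"
  shows "(\<integral>\<^sup>+t. ennreal (exp (a * t)) * f t \<partial>exponential_measure q) =
    ennreal (q / (q - a)) * (\<integral>\<^sup>+t. f t \<partial>exponential_measure (q - a))"
proof -
  have *: "ennreal (exponential_density q t) * (ennreal (exp (a * t)) * f t) =
      ennreal (q / (q - a)) * (ennreal (exponential_density (q - a) t) * f t)" for t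
  proof -
    have "exponential_density q t * exp (a * t) = q / (q - a) * exponential_density (q - a) t"
    proof (cases "t < 0")
      case False
      have "exp (- t * q) * exp (a * t) = exp (- t * (q - a))"
        by (simp add: mult_exp_exp algebra_simps)
      then show ?thesis
        using False assms by (simp add: exponential_density_def mult.assoc)
    qed (simp add: exponential_density_def)
    then have "ennreal (exponential_density q t) * ennreal (exp (a * t)) =
        ennreal (q / (q - a)) * ennreal (exponential_density (q - a) t)"
      using assms by (simp flip: ennreal_mult'' add: exponential_density_nonneg)
    then show ?thesis by (metis mult.assoc)
  qed
  show ?thesis
    by (simp add: nn_integral_exponential_measure * nn_integral_cmult)
qed

text \<open>The infinite case is as important as the finite one: finiteness of such a moment later
  locates the rate. For \<open>a \<ge> q\<close> the integrand is at least \<open>q\<close> on a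
  half-line of infinite length.\<close>

lemma nn_integral_exp_exponential:
  assumes "0 < q"
  shows "(\<integral>\<^sup>+t. ennreal (exp (a * t)) \<partial>exponential_measure q) =
    (if a < q then ennreal (q / (q - a)) else \<infinity>)"
proof (cases "a < q")
  case True
  interpret E: prob_space "exponential_measure (q - a)"
    using True by (intro prob_space_exponential_measure) simp
  show ?thesis
    using exponential_tilt[of "\<lambda>_. 1" a q] True assms E.emeasure_space_1 by simp
next
  case False
  have "(\<integral>\<^sup>+t. ennreal q * indicator {0::real..} t \<partial>lborel) \<le>
      (\<integral>\<^sup>+t. ennreal (exponential_density q t) * ennreal (exp (a * t)) \<partial>lborel)"
  proof (intro nn_integral_mono)
    fix t :: real
    have "q \<le> exponential_density q t * exp (a * t)" if "0 \<le> t"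
    proof -
      have "1 \<le> exp ((a - q) * t)" using that False by simp
      then have "q * 1 \<le> q * exp ((a - q) * t)" using assms by (intro mult_left_mono) auto
      also have "\<dots> = exponential_density q t * exp (a * t)"
        using that by (simp add: exponential_density_def mult_exp_exp algebra_simps)
      finally show ?thesis by simp
    qed
    then show "ennreal q * indicator {0..} t \<le>
        ennreal (exponential_density q t) * ennreal (exp (a * t))"
      using assms by (auto simp flip: ennreal_mult'' split: split_indicator intro: ennreal_leI)
  qed
  moreover have "(\<integral>\<^sup>+t. ennreal q * indicator {0::real..} t \<partial>lborel) = \<infinity>"
  proof -
    have "emeasure lborel {0::real..} = \<infinity>"
    proof (rule ccontr)
      assume "emeasure lborel {0::real..} \<noteq> \<infinity>"
      then obtain c where c: "emeasure lborel {0::real..} = ennreal c" "0 \<le> c"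
        by (metis ennreal_cases infinity_ennreal_def)
      have "emeasure lborel {0..c + 1} \<le> emeasure lborel {0::real..}"
        by (intro emeasure_mono) auto
      then show False using c by simp
    qed
    then show ?thesis using assms by (simp add: nn_integral_cmult_indicator ennreal_mult_top)
  qed
  ultimately show ?thesis
    using False by (simp add: nn_integral_exponential_measure top_unique)
qed

lemma exponential_memoryless:
  assumes [measurable]: "f \<in> borel_measurable borel" and "0 \<le> s" "0 < q"
  shows "(\<integral>\<^sup>+t. f t * indicator {s..} t \<partial>exponential_measure q) =
    ennreal (exp (- q * s)) * (\<integral>\<^sup>+t. f (s + t) \<partial>exponential_measure q)"
proof -
  have "(\<integral>\<^sup>+t. f t * indicator {s..} t \<partial>exponential_measure q) =
      (\<integral>\<^sup>+t. ennreal (exponential_density q t) * (f t * indicator {s..} t) \<partial>lborel)"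
    by (simp add: nn_integral_exponential_measure)
  also have "\<dots> = (\<integral>\<^sup>+t. ennreal (exponential_density q (s + 1 * t)) *
      (f (s + 1 * t) * indicator {s..} (s + 1 * t)) \<partial>lborel)"
    by (subst nn_integral_real_affine[where c = 1 and t = s]) auto
  also have "\<dots> = (\<integral>\<^sup>+t. ennreal (exp (- q * s)) *
      (ennreal (exponential_density q t) * f (s + t)) \<partial>lborel)"
  proof (rule nn_integral_cong)
    fix t :: real
    have "ennreal (exponential_density q (s + t)) =
        ennreal (exp (- q * s)) * ennreal (exponential_density q t)" if "0 \<le> t"
      using that assms
      by (simp flip: ennreal_mult'' add: exponential_density_def mult_exp_exp algebra_simps)
    then show "ennreal (exponential_density q (s + 1 * t)) *
        (f (s + 1 * t) * indicator {s..} (s + 1 * t)) =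
        ennreal (exp (- q * s)) * (ennreal (exponential_density q t) * f (s + t))"
      by (cases "0 \<le> t") (auto simp: mult.assoc exponential_density_def split: split_indicator)
  qed
  also have "\<dots> = ennreal (exp (- q * s)) * (\<integral>\<^sup>+t. f (s + t) \<partial>exponential_measure q)"
    by (simp add: nn_integral_exponential_measure nn_integral_cmult)
  finally show ?thesis .
qed

lemma emeasure_exponential_atLeast:
  assumes "0 \<le> s" "0 < q"
  shows "emeasure (exponential_measure q) {s..} = ennreal (exp (- q * s))"
proof -
  interpret E: prob_space "exponential_measure q"
    using assms by (intro prob_space_exponential_measure)
  show ?thesis
    using exponential_memoryless[of "\<lambda>_. 1" s q] assms E.emeasure_space_1 by simp
qed

lemma exponential_measureI:
  fixes X :: "'a \<Rightarrow> real"
  assumes "prob_space M" and [measurable]: "X \<in> borel_measurable M" and "0 < r"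
    and tail: "\<And>x. 0 \<le> x \<Longrightarrow> measure M {w \<in> space M. x < X w} = exp (- r * x)"
  shows "distr M borel X = exponential_measure r"
proof -
  interpret prob_space M by fact
  have "distributed M lborel X (exponential_density r)"
  proof (subst exponential_distributed_iff[OF \<open>0 < r\<close>], intro conjI allI impI)
    fix a :: real assume "0 \<le> a"
    have "{w \<in> space M. X w \<le> a} = space M - {w \<in> space M. a < X w}" by auto
    then show "\<P>(x in M. X x \<le> a) = 1 - exp (- a * r)"
      using tail[OF \<open>0 \<le> a\<close>] by (simp add: prob_compl mult.commute)
  qed fact
  then have "distr M lborel X = exponential_measure r"
    by (simp add: distributed_def exponential_measure_def)
  then show ?thesis by (metis distr_cong sets_lborel)
qed

lemma AE_exponential_measure_neq: "AE t in exponential_measure q. t \<noteq> y"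
  unfolding exponential_measure_def using AE_lborel_singleton[of y]
  by (subst AE_density) (auto elim: eventually_mono)

text \<open>The exponential law charges every interval in the half-line. Together with
  right-continuity this upgrades a statement about almost every time to one about a given
  time.\<close>

lemma AE_exponential_measure_open_interval:
  assumes "0 < q" "0 \<le> s" "s < b" "AE t in exponential_measure q. P t"
  obtains t where "s < t" "t < b" "P t"
proof (rule ccontr)
  assume "\<not> thesis"
  then have none: "\<not> P t" if "s < t" "t < b" for t using that \<open>\<not> thesis\<close> \<open>\<And>t. s < t \<Longrightarrow> t < b \<Longrightarrow> P t \<Longrightarrow> thesis\<close> by blast
  \<comment> \<open>If \<open>P\<close> failed throughout the interval, almost every
    \<open>t \<ge> s\<close> would satisfy \<open>t \<ge> b\<close>, and comparing tails would give
    \<open>exp(-q s) \<le> exp(-q b)\<close>.\<close>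
  have "AE t in exponential_measure q. t \<in> {s..} \<longrightarrow> t \<in> {b..}"
    using assms(4) AE_exponential_measure_neq[where q = q and y = s]
    by eventually_elim (use none in \<open>force simp: not_le\<close>)
  then have "emeasure (exponential_measure q) {s..} \<le> emeasure (exponential_measure q) {b..}"
    by (rule emeasure_mono_AE) simp
  then show False
    using assms by (simp add: emeasure_exponential_atLeast)
qed

text \<open>For \<open>\<beta> = 0\<close> the formula reads 1, the mass of the infinite killing
  time, so both kinds of killing share one tail.\<close>

lemma emeasure_killing_law_atLeast:
  assumes "0 \<le> \<beta>" "0 \<le> a"
  shows "emeasure (killing_law \<beta>) {ereal a..} = ennreal (exp (- \<beta> * a))"
proof (cases "\<beta> = 0")
  case True
  then show ?thesis by (simp add: killing_law_def)
next
  case False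
  have "ereal -` {ereal a..} = {a..}" by auto
  then show ?thesis
    using False assms emeasure_exponential_atLeast[of a \<beta>]
    by (simp add: killing_law_def emeasure_distr)
qed

section \<open>Independent \<open>\<sigma>\<close>-algebras\<close>

context prob_space
begin

text \<open>The events packaged as a measure space, of which only the measurable sets matter:
  measurability with respect to the past becomes an ordinary measurability goal.\<close>

definition generated_algebra :: "'b measure \<Rightarrow> 'i set \<Rightarrow> ('i \<Rightarrow> 'a \<Rightarrow> 'b) \<Rightarrow> 'a measure" where
  "generated_algebra N J X = sigma (space M) {X i -` A \<inter> space M | i A. i \<in> J \<and> A \<in> sets N}"

lemma space_generated_algebra [simp]: "space (generated_algebra N J X) = space M"
  unfolding generated_algebra_def by (rule space_measure_of) auto

lemma sets_generated_algebra: "sets (generated_algebra N J X) = generated_events N J X"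
  unfolding generated_algebra_def generated_events_def by (rule sets_measure_of) auto

lemma measurable_generated_algebra [intro]:
  "i \<in> J \<Longrightarrow> X i \<in> space M \<rightarrow> space N \<Longrightarrow> X i \<in> measurable (generated_algebra N J X) N"
  unfolding measurable_def
  by (auto simp: sets_generated_algebra generated_events_def Pi_iff intro!: sigma_sets.Basic)

lemma measurable_generated_algebra_real [intro]:
  fixes X :: "'i \<Rightarrow> 'a \<Rightarrow> 'b :: topological_space"
  shows "i \<in> J \<Longrightarrow> X i \<in> borel_measurable (generated_algebra borel J X)"
  by auto

lemma generated_events_subset:
  assumes "space A = space M" "\<And>i. i \<in> J \<Longrightarrow> X i \<in> measurable A N"
  shows "generated_events N J X \<subseteq> sets A"
  unfolding generated_events_def assms(1)[symmetric]
  using assms by (intro sets.sigma_sets_subset) (auto intro: measurable_sets simp flip: assms(1))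

text \<open>The identity map, read once with target \<open>A\<close> and once with target
  \<open>B\<close>, is a pair of independent variables; hence the diagonal carries \<open>M\<close>
  to a product measure and Fubini applies. This takes the place of conditioning throughout: the
  second occurrence of the sample point is replaced by an independent copy.\<close>

lemma decoupling:
  fixes A B :: "'a measure"
  assumes indep: "indep_set (sets A) (sets B)" and sp: "space A = space M" "space B = space M"
    and F: "(\<lambda>(w, v). F w v) \<in> borel_measurable (A \<Otimes>\<^sub>M B)"
  shows "(\<integral>\<^sup>+w. F w w \<partial>M) = (\<integral>\<^sup>+w. (\<integral>\<^sup>+v. F w v \<partial>M) \<partial>M)"
proof -
  have sub: "sets A \<subseteq> sets M" "sets B \<subseteq> sets M"
    using indep_setD_ev1[OF indep] indep_setD_ev2[OF indep] by auto
  have idA: "(\<lambda>w. w) \<in> measurable M A" and idB: "(\<lambda>w. w) \<in> measurable M B"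
    using sub sp by (auto simp: measurable_def Int_absorb2 dest: sets.sets_into_space)
  have "{(\<lambda>w. w) -` a \<inter> space M | a. a \<in> sets A} = sets A"
    "{(\<lambda>w. w) -` a \<inter> space M | a. a \<in> sets B} = sets B"
    using sets.sets_into_space[of _ A] sets.sets_into_space[of _ B] sp
    by (auto simp: Int_absorb2)
  then have "indep_var A (\<lambda>w. w) B (\<lambda>w. w)"
    unfolding indep_var_eq using idA idB indep sp
    by (simp add: sets.sigma_sets_eq[of A, unfolded sp] sets.sigma_sets_eq[of B, unfolded sp])
  then have eq: "distr M A (\<lambda>w. w) \<Otimes>\<^sub>M distr M B (\<lambda>w. w) = distr M (A \<Otimes>\<^sub>M B) (\<lambda>w. (w, w))"
    using indep_var_distribution_eq by blast
  interpret B: prob_space "distr M B (\<lambda>w. w)" by (rule prob_space_distr[OF idB])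
  have "(\<integral>\<^sup>+w. F w w \<partial>M) = (\<integral>\<^sup>+z. (\<lambda>(w, v). F w v) z \<partial>distr M (A \<Otimes>\<^sub>M B) (\<lambda>w. (w, w)))"
    using F idA idB by (subst nn_integral_distr) auto
  also have "\<dots> = (\<integral>\<^sup>+w. (\<integral>\<^sup>+v. F w v \<partial>distr M B (\<lambda>w. w)) \<partial>distr M A (\<lambda>w. w))"
    unfolding eq[symmetric] using F by (subst B.nn_integral_fst[symmetric]) auto
  also have "\<dots> = (\<integral>\<^sup>+w. (\<integral>\<^sup>+v. F w v \<partial>distr M B (\<lambda>w. w)) \<partial>M)"
  proof -
    have "case_prod F \<in> borel_measurable (A \<Otimes>\<^sub>M distr M B (\<lambda>w. w))"
      using F by (simp cong: measurable_cong_sets)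
    then have "(\<lambda>w. \<integral>\<^sup>+v. F w v \<partial>distr M B (\<lambda>w. w)) \<in> borel_measurable A"
      by (rule B.borel_measurable_nn_integral)
    then show ?thesis
      using idA by (simp add: nn_integral_distr)
  qed
  also have "\<dots> = (\<integral>\<^sup>+w. (\<integral>\<^sup>+v. F w v \<partial>M) \<partial>M)"
  proof (rule nn_integral_cong)
    fix w assume "w \<in> space M"
    then have "F w \<in> borel_measurable B"
      using measurable_compose[OF measurable_Pair1'[of w A B] F] sp by simp
    then show "(\<integral>\<^sup>+v. F w v \<partial>distr M B (\<lambda>w. w)) = (\<integral>\<^sup>+v. F w v \<partial>M)"
      using idB by (subst nn_integral_distr) auto
  qed
  finally show ?thesis .
qed

end

text \<open>The intended use has the past in \<open>J\<close> and the single next index in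
  \<open>K\<close>. Intersection stability of each generator lets independence pass to the grouped
  \<open>\<sigma>\<close>-algebras.\<close>

lemma (in prob_space) indep_set_generated_events:
  assumes "indep_vars (\<lambda>_. N) X I" "J \<subseteq> I" "K \<subseteq> I" "J \<inter> K = {}"
  shows "indep_set (generated_events N J X) (generated_events N K X)"
proof -
  let ?E = "\<lambda>i. {X i -` A \<inter> space M | A. A \<in> sets N}"
  let ?J = "\<lambda>b. if b then J else K"
  have "indep_sets (\<lambda>b. sigma_sets (space M) (\<Union>i\<in>?J b. ?E i)) UNIV"
  proof (rule indep_sets_collect_sigma)
    have "indep_sets ?E I" using assms(1) by (simp add: indep_vars_def2)
    then show "indep_sets ?E (\<Union>b\<in>UNIV. ?J b)"
      using assms by (rule_tac indep_sets_mono_index[rotated]) (auto simp: UNIV_bool)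
    show "Int_stable (?E i)" for i
      unfolding Int_stable_def
    proof safe
      fix A B assume "A \<in> sets N" "B \<in> sets N"
      then show "\<exists>C. X i -` A \<inter> space M \<inter> (X i -` B \<inter> space M) = X i -` C \<inter> space M \<and> C \<in> sets N"
        by (intro exI[of _ "A \<inter> B"]) auto
    qed
    show "disjoint_family_on ?J UNIV"
      using assms(4) by (auto simp: disjoint_family_on_def)
  qed
  moreover have "sigma_sets (space M) (\<Union>i\<in>L. ?E i) = generated_events N L X" for L
    unfolding generated_events_def by (rule arg_cong[where f = "sigma_sets (space M)"]) blast
  ultimately have "indep_sets (\<lambda>b. generated_events N (if b then J else K) X) UNIV" by simp
  then show ?thesis
    unfolding indep_set_def by (rule indep_sets_mono_sets) (auto split: bool.split)
qed

lemma (in prob_space) Int_stable_generated_events: "Int_stable (generated_events N J X)"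
  unfolding sets_generated_algebra[symmetric] Int_stable_def by auto

section \<open>First passage of a path without upward jumps along dyadic times\<close>

definition dyadic :: "nat \<Rightarrow> nat \<Rightarrow> real" where
  "dyadic n k = real k / 2 ^ n"

definition level_crossed :: "(real \<Rightarrow> real) \<Rightarrow> real \<Rightarrow> nat \<Rightarrow> bool" where
  "level_crossed y x n \<longleftrightarrow> (\<exists>k. x < y (dyadic n k))"

text \<open>Crossing means being strictly above \<open>x\<close>. The value is arbitrary when no
  grid point of level \<open>n\<close> lies above \<open>x\<close>, so statements about it carry
  \<open>level_crossed\<close>.\<close>

definition crossing_index :: "(real \<Rightarrow> real) \<Rightarrow> real \<Rightarrow> nat \<Rightarrow> nat" where
  "crossing_index y x n = (LEAST k. x < y (dyadic n k))"

abbreviation crossing_time :: "(real \<Rightarrow> real) \<Rightarrow> real \<Rightarrow> nat \<Rightarrow> real" where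
  "crossing_time y x n \<equiv> dyadic n (crossing_index y x n)"

lemma dyadic_nonneg [simp]: "0 \<le> dyadic n k"
  by (simp add: dyadic_def)

lemma dyadic_refine: "m \<le> n \<Longrightarrow> dyadic m k = dyadic n (k * 2 ^ (n - m))"
  by (simp add: dyadic_def field_simps flip: power_add)

lemma dyadic_mono_iff [simp]: "dyadic n j \<le> dyadic n k \<longleftrightarrow> j \<le> k" "dyadic n j < dyadic n k \<longleftrightarrow> j < k"
  by (simp_all add: dyadic_def divide_right_mono divide_le_cancel divide_less_cancel)

lemma dyadic_between:
  assumes "0 \<le> s" "s < t"
  obtains n k where "s < dyadic n k" "dyadic n k < t"
proof -
  obtain n where n: "inverse (2 ^ n) < t - s"
    using reals_power_lt_ex[of "t - s" 2] assms by (auto simp: power_one_over inverse_eq_divide)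
  define k where "k = Suc (nat \<lfloor>s * 2 ^ n\<rfloor>)"
  have k: "s * 2 ^ n < real k" "real k \<le> s * 2 ^ n + 1"
    using assms unfolding k_def by (auto simp: of_nat_nat) linarith+
  have "s < dyadic n k"
    using k(1) by (simp add: dyadic_def pos_less_divide_eq)
  moreover have "dyadic n k \<le> s + inverse (2 ^ n)"
    using k(2) by (simp add: dyadic_def field_simps)
  ultimately show ?thesis
    using n by (intro that[of n k]) auto
qed

lemma crossing_index_props:
  assumes "level_crossed y x n"
  shows "x < y (crossing_time y x n)"
    and "x < y (dyadic n k) \<Longrightarrow> crossing_index y x n \<le> k"
  using assms LeastI_ex[of "\<lambda>k. x < y (dyadic n k)"] Least_le[of "\<lambda>k. x < y (dyadic n k)"]
  unfolding level_crossed_def crossing_index_def by auto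

text \<open>The right-hand side looks only at grid times up to \<open>dyadic n k\<close>. This
  places the event that the crossing happens at index \<open>k\<close> in the past of that
  time.\<close>

lemma crossing_index_eq_iff:
  "level_crossed y x n \<and> crossing_index y x n = k \<longleftrightarrow>
    x < y (dyadic n k) \<and> (\<forall>j<k. y (dyadic n j) \<le> x)"
proof
  assume "level_crossed y x n \<and> crossing_index y x n = k"
  then show "x < y (dyadic n k) \<and> (\<forall>j<k. y (dyadic n j) \<le> x)"
    using crossing_index_props[of y x n] by (metis leD leI)
next
  assume k: "x < y (dyadic n k) \<and> (\<forall>j<k. y (dyadic n j) \<le> x)"
  then have "level_crossed y x n" by (auto simp: level_crossed_def)
  moreover have "crossing_index y x n = k"
    using crossing_index_props[OF \<open>level_crossed y x n\<close>] k
    by (metis le_antisym leD leI)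
  ultimately show "level_crossed y x n \<and> crossing_index y x n = k" by simp
qed

lemma level_crossed_mono:
  "level_crossed y x m \<Longrightarrow> m \<le> n \<Longrightarrow> level_crossed y x n"
  unfolding level_crossed_def using dyadic_refine by metis

lemma crossing_time_le:
  assumes "x < y (dyadic m k)" "m \<le> n"
  shows "level_crossed y x n" "crossing_time y x n \<le> dyadic m k"
proof -
  show "level_crossed y x n"
    using assms level_crossed_mono[of y x m n] unfolding level_crossed_def by blast
  from crossing_index_props(2)[OF this, of "k * 2 ^ (n - m)"]
  show "crossing_time y x n \<le> dyadic m k"
    using assms by (simp add: dyadic_refine)
qed

text \<open>The properties shared by almost all paths, so that the analysis of first passage is
  deterministic. To creep over a level is to pass it without overshoot.\<close>

locale creeping_path =
  fixes y :: "real \<Rightarrow> real"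
  assumes zero: "y 0 = 0"
    and right_cont: "\<And>t. 0 \<le> t \<Longrightarrow> continuous (at_right t) y"
    and left_lim: "\<And>t. 0 < t \<Longrightarrow> \<exists>l. (y \<longlongrightarrow> l) (at_left t)"
    and no_up: "\<And>t. 0 < t \<Longrightarrow> y t \<le> Lim (at_left t) y"
begin

text \<open>Without an upward jump at \<open>t\<close> the left limit is already above
  \<open>x\<close>, hence so is the path at some earlier \<open>s\<close>; right-continuity at
  \<open>s\<close> then reaches a dyadic time still before \<open>t\<close>. The strictness is what
  rules out an overshoot below.\<close>

lemma crossed_before:
  assumes "0 \<le> x" "0 \<le> t" "x < y t"
  obtains m k where "dyadic m k < t" "x < y (dyadic m k)"
proof -
  have "0 < t" using assms zero by (metis less_eq_real_def not_le)
  then obtain l where l: "(y \<longlongrightarrow> l) (at_left t)" using left_lim by blast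
  then have "Lim (at_left t) y = l" by (intro tendsto_Lim) auto
  then have "x < l" using no_up[OF \<open>0 < t\<close>] assms by simp
  then have "\<forall>\<^sub>F s in at_left t. x < y s" using order_tendstoD(1)[OF l] by blast
  moreover have "\<forall>\<^sub>F s in at_left t. s \<in> {0<..<t}"
    by (rule eventually_at_leftI[OF _ \<open>0 < t\<close>])
  ultimately have "\<forall>\<^sub>F s in at_left t. x < y s \<and> s \<in> {0<..<t}"
    by eventually_elim simp
  then obtain s where s: "x < y s" "0 < s" "s < t"
    using eventually_happens'[of "at_left t"] by (auto simp: trivial_limit_at_left_real)
  have "(y \<longlongrightarrow> y s) (at_right s)"
    using right_cont[of s] s by (simp add: continuous_within)
  then have "\<forall>\<^sub>F u in at_right s. x < y u" using order_tendstoD(1) s(1) by blast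
  then obtain b where b: "s < b" "\<And>u. s < u \<Longrightarrow> u < b \<Longrightarrow> x < y u"
    unfolding eventually_at_right_field by blast
  obtain m k where "s < dyadic m k" "dyadic m k < min b t"
    using dyadic_between[of s "min b t"] s b by auto
  then show ?thesis using b by (intro that[of m k]) auto
qed

lemma eventually_crossed:
  assumes "0 \<le> x" "0 \<le> t" "x < y t"
  shows "\<forall>\<^sub>F n in sequentially. level_crossed y x n \<and> crossing_time y x n < t"
proof -
  obtain m k where "dyadic m k < t" "x < y (dyadic m k)"
    using crossed_before[OF assms] .
  then show ?thesis
    using crossing_time_le[of x y m k] unfolding eventually_sequentially by force
qed

text \<open>Refining the grid only lowers the crossing time, so a limit \<open>\<tau>\<close> exists
  and right-continuity gives \<open>y \<tau> \<ge> x\<close>. A value above \<open>x\<close> at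
  \<open>\<tau>\<close> would produce crossings before \<open>\<tau>\<close>, although all crossing
  times stay at or above it. Hence \<open>y \<tau> = x\<close>, and \<open>\<tau> > 0\<close> if
  \<open>x > 0\<close> because the path starts at 0.\<close>

lemma crossing_time_limit:
  assumes "0 \<le> x" "level_crossed y x m"
  shows "convergent (crossing_time y x)"
    and "0 \<le> lim (crossing_time y x)"
    and "(\<lambda>n. y (crossing_time y x n)) \<longlonglongrightarrow> x"
    and "0 < x \<Longrightarrow> 0 < lim (crossing_time y x)"
proof -
  let ?t = "\<lambda>n. crossing_time y x (n + m)"
  have lc: "level_crossed y x (n + m)" for n
    using level_crossed_mono[OF assms(2)] by simp
  have "decseq ?t"
    unfolding decseq_Suc_iff
    by (metis add_Suc crossing_index_props(1) crossing_time_le(2) lc lessI less_imp_le)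
  then obtain \<tau> where \<tau>: "?t \<longlonglongrightarrow> \<tau>" "\<And>n. \<tau> \<le> ?t n"
    using decseq_convergent[of ?t 0] by auto
  have conv: "crossing_time y x \<longlonglongrightarrow> \<tau>"
    using \<tau>(1) by (rule LIMSEQ_offset)
  then show "convergent (crossing_time y x)" by (auto simp: convergent_def)
  have lim: "lim (crossing_time y x) = \<tau>" using conv by (rule limI)
  have "0 \<le> \<tau>" by (rule LIMSEQ_le_const[OF conv]) simp
  then show "0 \<le> lim (crossing_time y x)" by (simp add: lim)
  have yc: "continuous (at \<tau> within {\<tau>..}) y"
    using right_cont[OF \<open>0 \<le> \<tau>\<close>] by (simp add: continuous_within at_within_Ici_at_right)
  have "(\<lambda>n. y (?t n)) \<longlonglongrightarrow> y \<tau>"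
    using yc \<tau> unfolding continuous_within_sequentially by (auto simp: comp_def)
  moreover have "x < y (?t n)" for n
    using crossing_index_props(1)[OF lc] .
  ultimately have "x \<le> y \<tau>"
    by (intro LIMSEQ_le_const) (auto intro: less_imp_le)
  moreover have "\<not> x < y \<tau>"
  proof
    assume "x < y \<tau>"
    then have "\<forall>\<^sub>F n in sequentially. crossing_time y x n < \<tau>"
      using eventually_crossed[OF \<open>0 \<le> x\<close> \<open>0 \<le> \<tau>\<close>] by (auto elim: eventually_mono)
    then obtain n where "\<And>k. n \<le> k \<Longrightarrow> crossing_time y x k < \<tau>"
      by (auto simp: eventually_sequentially)
    then show False using \<tau>(2)[of n] by (metis le_add1 not_le)
  qed
  ultimately have y\<tau>: "y \<tau> = x" by simp
  then show "(\<lambda>n. y (crossing_time y x n)) \<longlonglongrightarrow> x"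
    using \<open>(\<lambda>n. y (?t n)) \<longlonglongrightarrow> y \<tau>\<close> LIMSEQ_offset by fastforce
  show "0 < lim (crossing_time y x)" if "0 < x"
    using y\<tau> zero that \<open>0 \<le> \<tau>\<close> unfolding lim by (cases "\<tau> = 0") auto
qed

end

section \<open>A Levy process at an independent exponential time\<close>

context levy_process
begin

abbreviation path_algebra :: "'a measure" where
  "path_algebra \<equiv> generated_algebra borel {0..} Y"

lemma path_in_path_algebra: "0 \<le> t \<Longrightarrow> Y t \<in> borel_measurable path_algebra"
  by auto

lemma path_algebra_subalgebra: "sets path_algebra \<subseteq> sets M"
  unfolding sets_generated_algebra by (rule generated_events_subset) (auto intro: measurable_Y)

text \<open>Right-continuity makes the process jointly measurable: it is the limit of the processes
  sampled at the next point of the grid of mesh \<open>1 / Suc n\<close>.\<close>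

lemma measurable_process_path_algebra:
  "(\<lambda>(w, t). Y (max 0 t) w) \<in> borel_measurable (path_algebra \<Otimes>\<^sub>M borel)"
proof -
  define grid where "grid n t = (real (nat \<lfloor>max 0 t * real (Suc n)\<rfloor>) + 1) / real (Suc n)" for n and t :: real
  have meas: "(\<lambda>(w, t). Y (grid n t) w) \<in> borel_measurable (path_algebra \<Otimes>\<^sub>M borel)" for n
  proof -
    have "(\<lambda>p. Y ((real (nat \<lfloor>max 0 (snd p) * real (Suc n)\<rfloor>) + 1) / real (Suc n)) (fst p))
        \<in> borel_measurable (path_algebra \<Otimes>\<^sub>M (borel :: real measure))"
    proof (rule measurable_compose_countable[where f = "\<lambda>i p. Y ((real i + 1) / real (Suc n)) (fst p)"])
      show "(\<lambda>p. Y ((real i + 1) / real (Suc n)) (fst p)) \<in>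
          borel_measurable (path_algebra \<Otimes>\<^sub>M (borel :: real measure))"
        for i
        by (rule measurable_compose[OF measurable_fst path_in_path_algebra]) simp
    qed measurable
    then show ?thesis by (simp add: grid_def case_prod_unfold)
  qed
  have conv: "(\<lambda>n. case p of (w, t) \<Rightarrow> Y (grid n t) w) \<longlonglongrightarrow> (case p of (w, t) \<Rightarrow> Y (max 0 t) w)"
    if "p \<in> space (path_algebra \<Otimes>\<^sub>M borel)" for p
  proof -
    from that obtain w t where p: "p = (w, t)" "w \<in> space M"
      by (auto simp: space_pair_measure)
    have lim: "(\<lambda>n. grid n t) \<longlonglongrightarrow> max 0 t" and gt: "max 0 t < grid n t" for n
    proof -
      have b: "max 0 t * real (Suc n) < real (nat \<lfloor>max 0 t * real (Suc n)\<rfloor>) + 1"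
        "real (nat \<lfloor>max 0 t * real (Suc n)\<rfloor>) \<le> max 0 t * real (Suc n)" for n
      proof -
        have "0 \<le> max 0 t * real (Suc n)" by simp
        then show "max 0 t * real (Suc n) < real (nat \<lfloor>max 0 t * real (Suc n)\<rfloor>) + 1"
          "real (nat \<lfloor>max 0 t * real (Suc n)\<rfloor>) \<le> max 0 t * real (Suc n)"
          by (simp_all only: of_nat_nat zero_le_floor of_int_floor_le real_of_int_floor_add_one_gt)
      qed
      have lo: "max 0 t < grid n t" for n
        using b(1)[of n] unfolding grid_def by (subst pos_less_divide_eq) auto
      have hi: "grid n t \<le> max 0 t + 1 / real (Suc n)" for n
        using b(2)[of n] unfolding grid_def by (simp only: add_divide_distrib) (simp add: pos_divide_le_eq)
      show "max 0 t < grid n t" by (rule lo)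
      have up: "(\<lambda>n. max 0 t + 1 / real (Suc n)) \<longlonglongrightarrow> max 0 t + 0"
        using LIMSEQ_inverse_real_of_nat by (intro tendsto_add tendsto_const) (simp add: inverse_eq_divide)
      show "(\<lambda>n. grid n t) \<longlonglongrightarrow> max 0 t"
        by (rule tendsto_sandwich[OF _ _ tendsto_const up[simplified add_0_right]])
          (use lo hi in \<open>auto intro!: always_eventually less_imp_le\<close>)
    qed
    have "((\<lambda>s. Y s w) \<longlongrightarrow> Y (max 0 t) w) (at_right (max 0 t))"
      using right_continuous_paths[OF p(2), of "max 0 t"] by (simp add: continuous_within)
    moreover have "filterlim (\<lambda>n. grid n t) (at_right (max 0 t)) sequentially"
      unfolding filterlim_at
      using gt less_imp_neq[OF gt, THEN not_sym] by (intro conjI lim always_eventually allI) auto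
    ultimately show "(\<lambda>n. case p of (w, t) \<Rightarrow> Y (grid n t) w) \<longlonglongrightarrow> (case p of (w, t) \<Rightarrow> Y (max 0 t) w)"
      unfolding p by (auto intro: filterlim_compose)
  qed
  show ?thesis
    using conv meas by (rule borel_measurable_LIMSEQ_real)
qed

text \<open>The target \<open>path_algebra\<close>, rather than \<open>M\<close>, is what decoupling
  the path from the inspection epochs requires.\<close>

lemma measurable_process':
  assumes "f \<in> measurable N path_algebra" "g \<in> borel_measurable N"
  shows "(\<lambda>x. Y (max 0 (g x)) (f x)) \<in> borel_measurable N"
proof -
  have "(\<lambda>x. (f x, g x)) \<in> measurable N (path_algebra \<Otimes>\<^sub>M borel)"
    using assms by measurable
  from measurable_compose[OF this measurable_process_path_algebra] show ?thesis by simp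
qed

lemma measurable_process [measurable (raw)]:
  assumes [measurable]: "f \<in> measurable N M" "g \<in> borel_measurable N"
  shows "(\<lambda>x. Y (max 0 (g x)) (f x)) \<in> borel_measurable N"
proof -
  have "(\<lambda>w. w) \<in> measurable M path_algebra"
    using path_algebra_subalgebra by (auto simp: measurable_def Int_absorb2 dest: sets.sets_into_space)
  then have "f \<in> measurable N path_algebra" using assms(1) measurable_comp[of f N M "\<lambda>w. w"] by (simp add: comp_def)
  then have "(\<lambda>x. (f x, g x)) \<in> measurable N (path_algebra \<Otimes>\<^sub>M borel)"
    using assms by measurable
  from measurable_compose[OF this measurable_process_path_algebra] show ?thesis by simp
qed

text \<open>The Markov property at a fixed time: independence turns the increment into that of a
  copy, and stationarity replaces the copy by \<open>Y t\<close>.\<close>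

lemma decouple_increment:
  assumes st: "0 \<le> s" "0 \<le> t"
    and F: "(\<lambda>(w, v). F w v) \<in> borel_measurable (generated_algebra borel {0..s} Y \<Otimes>\<^sub>M borel)"
  shows "(\<integral>\<^sup>+w. F w (Y (s + t) w - Y s w) \<partial>M) = (\<integral>\<^sup>+w. (\<integral>\<^sup>+v. F w (Y t v) \<partial>M) \<partial>M)"
proof -
  let ?A = "generated_algebra borel {0..s} Y"
  let ?B = "generated_algebra borel {s + t} (\<lambda>u w. Y u w - Y s w)"
  have [measurable]: "(\<lambda>w. Y (s + t) w - Y s w) \<in> borel_measurable ?B"
    by (rule measurable_generated_algebra_real[where X = "\<lambda>u w. Y u w - Y s w"]) simp
  have [measurable]: "(\<lambda>w. Y (s + t) w - Y s w) \<in> borel_measurable M" "Y t \<in> borel_measurable M"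
    using measurable_Y st by auto
  have "(\<integral>\<^sup>+w. F w (Y (s + t) w - Y s w) \<partial>M) =
      (\<integral>\<^sup>+w. (\<integral>\<^sup>+v. F w (Y (s + t) v - Y s v) \<partial>M) \<partial>M)"
  proof (rule decoupling[where A = ?A and B = ?B])
    show "indep_set (sets ?A) (sets ?B)"
      using independent_increments[of s "s + t"] st by (simp add: sets_generated_algebra)
    have "(\<lambda>(w, v). (w, Y (s + t) v - Y s v)) \<in> measurable (?A \<Otimes>\<^sub>M ?B) (?A \<Otimes>\<^sub>M borel)"
      by measurable
    from measurable_compose[OF this F]
    show "(\<lambda>(w, v). F w (Y (s + t) v - Y s v)) \<in> borel_measurable (?A \<Otimes>\<^sub>M ?B)"
      by (simp add: case_prod_unfold)
  qed simp_all
  also have "\<dots> = (\<integral>\<^sup>+w. (\<integral>\<^sup>+v. F w (Y t v) \<partial>M) \<partial>M)"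
  proof (rule nn_integral_cong)
    fix w assume w: "w \<in> space M"
    have [measurable]: "F w \<in> borel_measurable borel"
      using measurable_compose[OF measurable_Pair1'[of w ?A borel] F] w by simp
    have "(\<integral>\<^sup>+v. F w (Y (s + t) v - Y s v) \<partial>M) = (\<integral>\<^sup>+z. F w z \<partial>distr M borel (\<lambda>v. Y (s + t) v - Y s v))"
      by (simp add: nn_integral_distr)
    also have "\<dots> = (\<integral>\<^sup>+v. F w (Y t v) \<partial>M)"
      using stationary_increments[of s "s + t"] st by (simp add: nn_integral_distr)
    finally show "(\<integral>\<^sup>+v. F w (Y (s + t) v - Y s v) \<partial>M) = (\<integral>\<^sup>+v. F w (Y t v) \<partial>M)" .
  qed
  finally show ?thesis .
qed

text \<open>Written exactly as the law in \<open>step_law\<close>, so that a step of the inspected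
  walk has it by unfolding.\<close>

definition step_distribution :: "real \<Rightarrow> real measure" where
  "step_distribution q = distr (M \<Otimes>\<^sub>M exponential_measure q) borel (\<lambda>(w, t). Y (max 0 t) w)"

lemma sets_step_distribution [measurable_cong, simp]: "sets (step_distribution q) = sets borel"
  by (simp add: step_distribution_def)

lemma space_step_distribution [simp]: "space (step_distribution q) = UNIV"
  by (simp add: step_distribution_def)

lemma prob_space_step_distribution:
  assumes "0 < q"
  shows "prob_space (step_distribution q)"
proof -
  interpret E: prob_space "exponential_measure q" by (rule prob_space_exponential_measure[OF assms])
  interpret P: pair_prob_space M "exponential_measure q" ..
  show ?thesis unfolding step_distribution_def by (rule P.prob_space_distr) measurable
qed

lemma nn_integral_step_distribution:
  assumes "0 < q" and [measurable]: "f \<in> borel_measurable borel"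
  shows "(\<integral>\<^sup>+z. f z \<partial>step_distribution q) =
      (\<integral>\<^sup>+w. (\<integral>\<^sup>+t. f (Y (max 0 t) w) \<partial>exponential_measure q) \<partial>M)" (is ?A)
    and "(\<integral>\<^sup>+z. f z \<partial>step_distribution q) =
      (\<integral>\<^sup>+t. (\<integral>\<^sup>+w. f (Y (max 0 t) w) \<partial>M) \<partial>exponential_measure q)" (is ?B)
proof -
  interpret E: prob_space "exponential_measure q" by (rule prob_space_exponential_measure[OF assms(1)])
  interpret P: pair_prob_space M "exponential_measure q" ..
  show ?A unfolding step_distribution_def
    by (subst nn_integral_distr) (auto simp: E.nn_integral_fst[symmetric])
  then show ?B
    by (subst P.Fubini') auto
qed

end

section \<open>The law of a step decomposed at first passage\<close>

lemma measurable_emeasure_greaterThan: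
  fixes \<mu> :: "real measure"
  assumes "prob_space \<mu>" and [measurable_cong]: "sets \<mu> = sets borel"
  shows "(\<lambda>y. emeasure \<mu> {z - y<..}) \<in> borel_measurable borel"
proof -
  interpret prob_space \<mu> by fact
  have "(\<lambda>y. measure \<mu> {z - y<..}) \<in> borel_measurable borel"
    by (rule borel_measurable_mono) (auto intro!: finite_measure_mono simp: mono_def)
  then show ?thesis by (simp add: emeasure_eq_measure)
qed

text \<open>End points approaching strictly from below turn open half-lines into the closed one.
  This is the origin of the closed half-line on the right of
  \<open>first_passage_identity\<close>.\<close>

lemma emeasure_greaterThan_tendsto:
  fixes \<mu> :: "real measure"
  assumes "prob_space \<mu>" and [measurable_cong]: "sets \<mu> = sets borel"
    and y: "y \<longlonglongrightarrow> a" "\<And>n. y n < a"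
  shows "(\<lambda>n. emeasure \<mu> {y n<..}) \<longlonglongrightarrow> emeasure \<mu> {a..}"
proof -
  interpret prob_space \<mu> by fact
  have "(\<lambda>n. \<integral>\<^sup>+u. indicator {y n<..} u \<partial>\<mu>) \<longlonglongrightarrow> (\<integral>\<^sup>+u. indicator {a..} u \<partial>\<mu>)"
  proof (rule nn_integral_dominated_convergence[where w = "\<lambda>_. 1"])
    have "(\<lambda>n. indicator {y n<..} u) \<longlonglongrightarrow> (indicator {a..} u :: ennreal)" for u
    proof (cases "a \<le> u")
      case True
      then have "indicator {y n<..} u = (1 :: ennreal)" for n
        using y(2)[of n] by simp
      then show ?thesis using True by simp
    next
      case False
      then have "\<forall>\<^sub>F n in sequentially. u < y n"
        using order_tendstoD(1)[OF y(1)] by simp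
      then have "\<forall>\<^sub>F n in sequentially. indicator {y n<..} u = (0 :: ennreal)"
        by eventually_elim simp
      then show ?thesis using False by (simp add: tendsto_eventually)
    qed
    then show "AE u in \<mu>. (\<lambda>n. indicator {y n<..} u) \<longlonglongrightarrow> (indicator {a..} u :: ennreal)" by simp
  qed (auto simp: emeasure_space_1 split: split_indicator)
  then show ?thesis by simp
qed

lemma (in spectrally_negative_levy_process) AE_creeping_path: "AE w in M. creeping_path (\<lambda>t. Y t w)"
  using start_zero no_upward_jumps AE_space
  by eventually_elim (auto intro!: creeping_path.intro right_continuous_paths left_limits)

context levy_process
begin

text \<open>The exponential time passes \<open>s\<close> at the cost of a factor
  \<open>exp(-q s)\<close> and then starts afresh; the increment over the remaining time decouples
  from the past event \<open>A\<close>. The two integrals are swapped so that the remaining time is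
  fixed when independence is applied, and swapped back afterwards.\<close>

lemma restart:
  assumes "0 \<le> s" "0 < q" and A: "A \<in> sets (generated_algebra borel {0..s} Y)"
    and [measurable]: "f \<in> borel_measurable borel"
  shows "(\<integral>\<^sup>+w. (\<integral>\<^sup>+t. indicator A w * (f (Y (max 0 t) w) * indicator {s..} t) \<partial>exponential_measure q) \<partial>M) =
    (\<integral>\<^sup>+w. indicator A w * (ennreal (exp (- q * s)) * (\<integral>\<^sup>+u. f (Y s w + u) \<partial>step_distribution q)) \<partial>M)"
proof -
  interpret E: prob_space "exponential_measure q" by (rule prob_space_exponential_measure[OF assms(2)])
  interpret P: pair_prob_space M "exponential_measure q" ..
  have sub: "sets (generated_algebra borel {0..s} Y) \<subseteq> sets M"
    unfolding sets_generated_algebra by (rule generated_events_subset) (auto intro: measurable_Y)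
  have [measurable]: "A \<in> sets M" "Y s \<in> borel_measurable M"
    "Y s \<in> borel_measurable (generated_algebra borel {0..s} Y)"
    using sub A measurable_Y \<open>0 \<le> s\<close> by auto
  have [measurable]: "(\<lambda>x. Y (s + max 0 (g x)) (h x)) \<in> borel_measurable N"
    if [measurable]: "g \<in> borel_measurable N" "h \<in> measurable N M"
    for g h and N :: "'c measure"
  proof -
    have "s + max 0 r = max 0 (s + max 0 r)" for r using \<open>0 \<le> s\<close> by simp
    then show ?thesis by (subst \<open>\<And>r. s + max 0 r = max 0 (s + max 0 r)\<close>) measurable
  qed
  let ?c = "ennreal (exp (- q * s))"
  have "(\<integral>\<^sup>+w. (\<integral>\<^sup>+t. indicator A w * (f (Y (max 0 t) w) * indicator {s..} t) \<partial>exponential_measure q) \<partial>M) =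
      (\<integral>\<^sup>+w. (\<integral>\<^sup>+t. ?c * (indicator A w * f (Y (s + max 0 t) w)) \<partial>exponential_measure q) \<partial>M)"
  proof (rule nn_integral_cong)
    fix w assume [measurable]: "w \<in> space M"
    have "(\<integral>\<^sup>+t. indicator A w * (f (Y (max 0 t) w) * indicator {s..} t) \<partial>exponential_measure q) =
        indicator A w * (?c * (\<integral>\<^sup>+t. f (Y (max 0 (s + t)) w) \<partial>exponential_measure q))"
      using assms by (simp add: nn_integral_cmult exponential_memoryless)
    also have "(\<integral>\<^sup>+t. f (Y (max 0 (s + t)) w) \<partial>exponential_measure q) =
        (\<integral>\<^sup>+t. f (Y (s + max 0 t) w) \<partial>exponential_measure q)"
    proof (rule nn_integral_cong_AE)
      show "AE t in exponential_measure q. f (Y (max 0 (s + t)) w) = f (Y (s + max 0 t) w)"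
        using AE_exponential_measure_nonneg[of q] by eventually_elim (use \<open>0 \<le> s\<close> in simp)
    qed
    finally show "(\<integral>\<^sup>+t. indicator A w * (f (Y (max 0 t) w) * indicator {s..} t) \<partial>exponential_measure q) =
        (\<integral>\<^sup>+t. ?c * (indicator A w * f (Y (s + max 0 t) w)) \<partial>exponential_measure q)"
      by (simp add: nn_integral_cmult mult_ac)
  qed
  also have "\<dots> = (\<integral>\<^sup>+t. (\<integral>\<^sup>+w. ?c * (indicator A w * f (Y (s + max 0 t) w)) \<partial>M) \<partial>exponential_measure q)"
    by (subst P.Fubini') auto
  also have "\<dots> = (\<integral>\<^sup>+t. (\<integral>\<^sup>+w. ?c * (indicator A w * (\<integral>\<^sup>+v. f (Y s w + Y (max 0 t) v) \<partial>M)) \<partial>M) \<partial>exponential_measure q)"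
  proof (rule nn_integral_cong)
    fix t
    define F where "F w v = ?c * (indicator A w * f (Y s w + v))" for w v
    have "(\<lambda>(w, v). F w v) \<in> borel_measurable (generated_algebra borel {0..s} Y \<Otimes>\<^sub>M borel)"
      unfolding F_def using A by measurable
    from decouple_increment[OF \<open>0 \<le> s\<close> _ this, of "max 0 t"]
    show "(\<integral>\<^sup>+w. ?c * (indicator A w * f (Y (s + max 0 t) w)) \<partial>M) =
        (\<integral>\<^sup>+w. ?c * (indicator A w * (\<integral>\<^sup>+v. f (Y s w + Y (max 0 t) v) \<partial>M)) \<partial>M)"
      by (simp add: F_def nn_integral_cmult)
  qed
  also have "\<dots> = (\<integral>\<^sup>+w. (\<integral>\<^sup>+t. ?c * (indicator A w * (\<integral>\<^sup>+v. f (Y s w + Y (max 0 t) v) \<partial>M)) \<partial>exponential_measure q) \<partial>M)"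
    by (subst P.Fubini') auto
  also have "\<dots> = (\<integral>\<^sup>+w. indicator A w * (?c * (\<integral>\<^sup>+u. f (Y s w + u) \<partial>step_distribution q)) \<partial>M)"
  proof (rule nn_integral_cong)
    fix w assume [measurable]: "w \<in> space M"
    show "(\<integral>\<^sup>+t. ?c * (indicator A w * (\<integral>\<^sup>+v. f (Y s w + Y (max 0 t) v) \<partial>M)) \<partial>exponential_measure q) =
        indicator A w * (?c * (\<integral>\<^sup>+u. f (Y s w + u) \<partial>step_distribution q))"
      using assms by (simp add: nn_integral_cmult nn_integral_step_distribution(2) mult_ac)
  qed
  finally show ?thesis .
qed

abbreviation crossed :: "real \<Rightarrow> nat \<Rightarrow> 'a \<Rightarrow> bool" where
  "crossed x n w \<equiv> level_crossed (\<lambda>t. Y t w) x n"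

abbreviation crossing :: "real \<Rightarrow> nat \<Rightarrow> 'a \<Rightarrow> real" where
  "crossing x n w \<equiv> crossing_time (\<lambda>t. Y t w) x n"

lemma measurable_dyadic [measurable]: "Y (dyadic n k) \<in> borel_measurable M"
  by (rule measurable_Y) simp

lemma measurable_crossed [measurable]: "Measurable.pred M (crossed x n)"
  unfolding level_crossed_def by measurable

lemma measurable_crossing_index [measurable]:
  "(\<lambda>w. crossing_index (\<lambda>t. Y t w) x n) \<in> measurable M (count_space UNIV)"
  unfolding crossing_index_def by measurable

lemma measurable_crossing [measurable]: "crossing x n \<in> borel_measurable M"
  unfolding dyadic_def by measurable

lemma measurable_at_crossing [measurable]: "(\<lambda>w. Y (crossing x n w) w) \<in> borel_measurable M"
  using measurable_process[of "\<lambda>w. w" M "crossing x n"] by (simp add: max_absorb2)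

lemma crossing_event:
  "{w \<in> space M. crossed x n w \<and> crossing_index (\<lambda>t. Y t w) x n = k} \<in>
    sets (generated_algebra borel {0..dyadic n k} Y)"
proof -
  have [measurable]: "Y (dyadic n j) \<in> borel_measurable (generated_algebra borel {0..dyadic n k} Y)"
    if "j \<le> k" for j
    using that by auto
  have meas: "{w \<in> space (generated_algebra borel {0..dyadic n k} Y).
      x < Y (dyadic n k) w \<and> (\<forall>j\<in>{..<k}. Y (dyadic n j) w \<le> x)} \<in> sets (generated_algebra borel {0..dyadic n k} Y)"
    by measurable
  have "{w \<in> space (generated_algebra borel {0..dyadic n k} Y).
      x < Y (dyadic n k) w \<and> (\<forall>j\<in>{..<k}. Y (dyadic n j) w \<le> x)} =
      {w \<in> space M. crossed x n w \<and> crossing_index (\<lambda>t. Y t w) x n = k}"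
    unfolding crossing_index_eq_iff space_generated_algebra by blast
  with meas show ?thesis by simp
qed

text \<open>The event is split according to whether the grid crossing of \<open>x\<close> occurs no
  later than the exponential time. If it does, \<open>restart\<close> applies separately on each of
  the countably many events fixing the crossing index; the last integral is what the grid
  misses.\<close>

lemma first_passage_decomposition:
  assumes "0 < q"
  shows "emeasure (step_distribution q) {z<..} =
    (\<integral>\<^sup>+w. (if crossed x n w then ennreal (exp (- q * crossing x n w)) *
        emeasure (step_distribution q) {z - Y (crossing x n w) w<..} else 0) \<partial>M) +
    (\<integral>\<^sup>+w. (\<integral>\<^sup>+t. (if z < Y (max 0 t) w \<and> \<not> (crossed x n w \<and> crossing x n w \<le> t) then 1 else 0)
        \<partial>exponential_measure q) \<partial>M)" (is "_ = ?H + ?R")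
proof -
  interpret E: prob_space "exponential_measure q" by (rule prob_space_exponential_measure[OF assms])
  interpret S: prob_space "step_distribution q" by (rule prob_space_step_distribution[OF assms])
  define A where "A k = {w \<in> space M. crossed x n w \<and> crossing_index (\<lambda>t. Y t w) x n = k}" for k
  have [measurable]: "A k \<in> sets M" for k unfolding A_def by measurable
  \<comment> \<open>The events \<open>A k\<close> are disjoint, so at most one summand survives,
    namely that of the actual crossing index.\<close>
  have single: "(\<Sum>k. indicator (A k) w * c k) =
      (if crossed x n w then c (crossing_index (\<lambda>t. Y t w) x n) else 0)"
    if "w \<in> space M" for w and c :: "nat \<Rightarrow> ennreal"
  proof (cases "crossed x n w")
    case True
    then have "(\<lambda>k. indicator (A k) w * c k) =
        (\<lambda>k. if k = crossing_index (\<lambda>t. Y t w) x n then c k else 0)"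
      using that by (auto simp: A_def)
    then show ?thesis
      using True sums_single[of "crossing_index (\<lambda>t. Y t w) x n" c] by (simp add: sums_unique[symmetric])
  qed (simp add: A_def)
  have "emeasure (step_distribution q) {z<..} = (\<integral>\<^sup>+u. indicator {z<..} u \<partial>step_distribution q)"
    by simp
  also have "\<dots> = (\<integral>\<^sup>+w. (\<integral>\<^sup>+t. indicator {z<..} (Y (max 0 t) w) \<partial>exponential_measure q) \<partial>M)"
    using assms by (subst nn_integral_step_distribution(1)) auto
  also have "\<dots> = (\<integral>\<^sup>+w. (\<integral>\<^sup>+t. (\<Sum>k. indicator (A k) w * (indicator {z<..} (Y (max 0 t) w) * indicator {dyadic n k..} t)) +
      (if z < Y (max 0 t) w \<and> \<not> (crossed x n w \<and> crossing x n w \<le> t) then 1 else 0)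
        \<partial>exponential_measure q) \<partial>M)"
    by (intro nn_integral_cong) (auto simp: single)
  also have "\<dots> = (\<Sum>k. \<integral>\<^sup>+w. (\<integral>\<^sup>+t. indicator (A k) w * (indicator {z<..} (Y (max 0 t) w) * indicator {dyadic n k..} t)
      \<partial>exponential_measure q) \<partial>M) + ?R"
  proof -
    have "(\<integral>\<^sup>+t. (\<Sum>k. indicator (A k) w * (indicator {z<..} (Y (max 0 t) w) * indicator {dyadic n k..} t)) +
      (if z < Y (max 0 t) w \<and> \<not> (crossed x n w \<and> crossing x n w \<le> t) then 1 else 0)
        \<partial>exponential_measure q) =
       (\<Sum>k. \<integral>\<^sup>+t. indicator (A k) w * (indicator {z<..} (Y (max 0 t) w) * indicator {dyadic n k..} t)
      \<partial>exponential_measure q) + (\<integral>\<^sup>+t. (if z < Y (max 0 t) w \<and> \<not> (crossed x n w \<and> crossing x n w \<le> t) then 1 else 0)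
        \<partial>exponential_measure q)" if [measurable]: "w \<in> space M" for w
      by (subst nn_integral_add) (auto simp: nn_integral_suminf)
    then show ?thesis
      by (subst nn_integral_suminf[symmetric], measurable)
         (subst nn_integral_add[symmetric], measurable, auto intro!: nn_integral_cong)
  qed
  also have "(\<Sum>k. \<integral>\<^sup>+w. (\<integral>\<^sup>+t. indicator (A k) w * (indicator {z<..} (Y (max 0 t) w) * indicator {dyadic n k..} t)
      \<partial>exponential_measure q) \<partial>M) =
      (\<Sum>k. \<integral>\<^sup>+w. indicator (A k) w * (ennreal (exp (- q * dyadic n k)) *
        emeasure (step_distribution q) {z - Y (dyadic n k) w<..}) \<partial>M)"
  proof (intro suminf_cong)
    fix k
    have "(\<integral>\<^sup>+u. indicator {z<..} (y + u) \<partial>step_distribution q) = emeasure (step_distribution q) {z - y<..}" for y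
    proof -
      have "(\<lambda>u. indicator {z<..} (y + u) :: ennreal) = indicator {z - y<..}"
        by (auto simp: fun_eq_iff split: split_indicator)
      then show ?thesis by simp
    qed
    then show "(\<integral>\<^sup>+w. (\<integral>\<^sup>+t. indicator (A k) w * (indicator {z<..} (Y (max 0 t) w) * indicator {dyadic n k..} t)
        \<partial>exponential_measure q) \<partial>M) =
      (\<integral>\<^sup>+w. indicator (A k) w * (ennreal (exp (- q * dyadic n k)) *
        emeasure (step_distribution q) {z - Y (dyadic n k) w<..}) \<partial>M)"
      using restart[of "dyadic n k" q "A k" "indicator {z<..}"] assms crossing_event[of x n k]
      by (simp add: A_def)
  qed
  also have "\<dots> = ?H"
  proof -
    have [measurable]: "(\<lambda>y. emeasure (step_distribution q) {z - y<..}) \<in> borel_measurable borel"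
      using S.prob_space_axioms by (rule measurable_emeasure_greaterThan) simp
    show ?thesis
      by (subst nn_integral_suminf[symmetric]) (auto simp: single intro!: nn_integral_cong)
  qed
  finally show ?thesis .
qed

text \<open>The Laplace transform \<open>E(exp(-q\<tau>); \<tau> < \<infinity>)\<close>, with
  \<open>\<tau>\<close> realised as the limit of the grid crossing times; crossing at some
  resolution stands for \<open>\<tau> < \<infinity>\<close>.\<close>

definition passage_transform :: "real \<Rightarrow> real \<Rightarrow> ennreal" where
  "passage_transform q x = (\<integral>\<^sup>+w. (if \<exists>n. crossed x n w
     then ennreal (exp (- q * lim (\<lambda>n. crossing x n w))) else 0) \<partial>M)"

end

context spectrally_negative_levy_process
begin

text \<open>Both terms of the grid decomposition are bounded by 1 and converge pointwise along
  almost every path, which carries the restart from deterministic times to the passage time.\<close>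

lemma first_passage_identity:
  assumes "0 < q" "0 \<le> x" "x \<le> z"
  shows "emeasure (step_distribution q) {z<..} =
    passage_transform q x * emeasure (step_distribution q) {z - x..}"
proof -
  interpret E: prob_space "exponential_measure q" by (rule prob_space_exponential_measure[OF assms(1)])
  interpret S: prob_space "step_distribution q" by (rule prob_space_step_distribution[OF assms(1)])
  define H where "H n w = (if crossed x n w then ennreal (exp (- q * crossing x n w)) *
      emeasure (step_distribution q) {z - Y (crossing x n w) w<..} else 0)" for n w
  define R :: "nat \<Rightarrow> 'a \<Rightarrow> real \<Rightarrow> ennreal" where
    "R n w t = (if z < Y (max 0 t) w \<and> \<not> (crossed x n w \<and> crossing x n w \<le> t) then 1 else 0)" for n w t
  define H' where "H' w = (if \<exists>n. crossed x n w
     then ennreal (exp (- q * lim (\<lambda>n. crossing x n w))) else 0) * emeasure (step_distribution q) {z - x..}" for w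
  have [measurable]: "(\<lambda>y. emeasure (step_distribution q) {z - y<..}) \<in> borel_measurable borel"
    using S.prob_space_axioms by (rule measurable_emeasure_greaterThan) simp
  have [measurable]: "H n \<in> borel_measurable M" for n
    unfolding H_def by measurable
  have [measurable]: "(\<lambda>w. lim (\<lambda>n. crossing x n w)) \<in> borel_measurable M"
    by (rule borel_measurable_lim_metric) measurable
  have [measurable]: "H' \<in> borel_measurable M"
    unfolding H'_def by measurable
  have [measurable]: "(\<lambda>p. R n (fst p) (snd p)) \<in> borel_measurable (M \<Otimes>\<^sub>M exponential_measure q)" for n
    unfolding R_def by measurable
  \<comment> \<open>At the crossing times \<open>Y\<close> is strictly above \<open>x\<close> and
    tends to \<open>x\<close>, so \<open>z - Y\<close> tends to \<open>z - x\<close> strictly from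
    below.\<close>
  have "(\<lambda>n. \<integral>\<^sup>+w. H n w \<partial>M) \<longlonglongrightarrow> (\<integral>\<^sup>+w. H' w \<partial>M)"
  proof (rule nn_integral_dominated_convergence[where w = "\<lambda>_. 1"])
    have "H n w \<le> 1" if "w \<in> space M" for n w
    proof -
      have "ennreal (exp (- q * crossing x n w)) \<le> 1"
        using assms by (simp add: ennreal_le_1)
      then show ?thesis
        using mult_mono[of "ennreal (exp (- q * crossing x n w))" 1
          "emeasure (step_distribution q) {z - Y (crossing x n w) w<..}" 1] S.emeasure_le_1
        by (simp add: H_def)
    qed
    then show "AE w in M. H n w \<le> 1" for n by (auto intro: AE_I2)
    show "AE w in M. (\<lambda>n. H n w) \<longlonglongrightarrow> H' w"
      using AE_creeping_path
    proof eventually_elim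
      case (elim w)
      interpret creeping_path "\<lambda>t. Y t w" by (rule elim)
      show ?case
      proof (cases "\<exists>n. crossed x n w")
        case True
        then obtain m where m: "crossed x m w" by blast
        have lc: "crossed x (n + m) w" for n using level_crossed_mono[OF m] by simp
        note lim = crossing_time_limit[OF \<open>0 \<le> x\<close> m]
        have 1: "(\<lambda>n. crossing x (n + m) w) \<longlonglongrightarrow> lim (\<lambda>n. crossing x n w)"
          using lim(1) by (intro LIMSEQ_ignore_initial_segment) (simp add: convergent_LIMSEQ_iff)
        have "(\<lambda>n. emeasure (step_distribution q) {z - Y (crossing x (n + m) w) w<..}) \<longlonglongrightarrow>
            emeasure (step_distribution q) {z - x..}"
        proof (rule emeasure_greaterThan_tendsto)
          show "(\<lambda>n. z - Y (crossing x (n + m) w) w) \<longlonglongrightarrow> z - x"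
            using lim(3) by (intro tendsto_intros LIMSEQ_ignore_initial_segment[where f = "\<lambda>n. Y (crossing x n w) w"])
          show "z - Y (crossing x (n + m) w) w < z - x" for n
            using crossing_index_props(1)[OF lc[of n]] by simp
        qed (use S.prob_space_axioms in auto)
        then have "(\<lambda>n. ennreal (exp (- q * crossing x (n + m) w)) * emeasure (step_distribution q) {z - Y (crossing x (n + m) w) w<..}) \<longlonglongrightarrow>
            ennreal (exp (- q * lim (\<lambda>n. crossing x n w))) * emeasure (step_distribution q) {z - x..}"
          using 1 S.emeasure_finite by (intro tendsto_mult_ennreal tendsto_ennrealI tendsto_intros) auto
        then have "(\<lambda>n. H (n + m) w) \<longlonglongrightarrow> H' w"
          using True lc by (simp add: H_def H'_def)
        then show ?thesis by (rule LIMSEQ_offset)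
      qed (simp add: H_def H'_def)
    qed
  qed (auto simp: emeasure_space_1)
  \<comment> \<open>Being above \<open>z \<ge> x\<close> at time \<open>t\<close> forces a grid
    crossing before \<open>t\<close> at every sufficiently fine resolution, so the missed part
    vanishes.\<close>
  moreover have "(\<lambda>n. \<integral>\<^sup>+w. (\<integral>\<^sup>+t. R n w t \<partial>exponential_measure q) \<partial>M) \<longlonglongrightarrow> (\<integral>\<^sup>+w. 0 \<partial>M)"
  proof (rule nn_integral_dominated_convergence[where w = "\<lambda>_. 1"])
    have R1: "R n w t \<le> 1" for n w t by (simp add: R_def)
    have "(\<integral>\<^sup>+t. R n w t \<partial>exponential_measure q) \<le> (\<integral>\<^sup>+t. 1 \<partial>exponential_measure q)" for n w
      by (intro nn_integral_mono R1)
    then show "AE w in M. (\<integral>\<^sup>+t. R n w t \<partial>exponential_measure q) \<le> 1" for n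
      using E.emeasure_space_1 by simp
    show "AE w in M. (\<lambda>n. \<integral>\<^sup>+t. R n w t \<partial>exponential_measure q) \<longlonglongrightarrow> 0"
      using AE_creeping_path AE_space
    proof eventually_elim
      case (elim w)
      interpret creeping_path "\<lambda>t. Y t w" by (rule elim)
      have [measurable]: "w \<in> space M" by (rule elim)
      have [measurable]: "R n w \<in> borel_measurable (exponential_measure q)" for n
        unfolding R_def by measurable
      have "(\<lambda>n. \<integral>\<^sup>+t. R n w t \<partial>exponential_measure q) \<longlonglongrightarrow> (\<integral>\<^sup>+t. 0 \<partial>exponential_measure q)"
      proof (rule nn_integral_dominated_convergence[where w = "\<lambda>_. 1"])
        have "(\<lambda>n. R n w t) \<longlonglongrightarrow> 0" for t
        proof (cases "z < Y (max 0 t) w")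
          case True
          then have "0 < t" using zero assms by (cases "0 < t") (auto simp: max_absorb1)
          then have "\<forall>\<^sub>F n in sequentially. crossed x n w \<and> crossing x n w < t"
            using True assms by (intro eventually_crossed) auto
          then have "\<forall>\<^sub>F n in sequentially. R n w t = 0"
            by eventually_elim (simp add: R_def)
          then show ?thesis by (rule tendsto_eventually)
        qed (simp add: R_def)
        then show "AE t in exponential_measure q. (\<lambda>n. R n w t) \<longlonglongrightarrow> 0" by simp
        show "(\<integral>\<^sup>+t. 1 \<partial>exponential_measure q) < \<infinity>"
          using E.emeasure_space_1 by simp
      qed (auto simp: R1)
      then show ?case by simp
    qed
  qed (auto simp: emeasure_space_1)
  ultimately have "(\<lambda>n. (\<integral>\<^sup>+w. H n w \<partial>M) + (\<integral>\<^sup>+w. (\<integral>\<^sup>+t. R n w t \<partial>exponential_measure q) \<partial>M))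
      \<longlonglongrightarrow> (\<integral>\<^sup>+w. H' w \<partial>M) + (\<integral>\<^sup>+w. 0 \<partial>M)"
    by (rule tendsto_add)
  moreover have "(\<integral>\<^sup>+w. H n w \<partial>M) + (\<integral>\<^sup>+w. (\<integral>\<^sup>+t. R n w t \<partial>exponential_measure q) \<partial>M) =
      emeasure (step_distribution q) {z<..}" for n
    using first_passage_decomposition[OF \<open>0 < q\<close>, of z x n] by (simp add: H_def R_def)
  ultimately have "emeasure (step_distribution q) {z<..} = (\<integral>\<^sup>+w. H' w \<partial>M)"
    by (simp add: LIMSEQ_const_iff)
  also have "\<dots> = passage_transform q x * emeasure (step_distribution q) {z - x..}"
    unfolding passage_transform_def H'_def by (subst nn_integral_multc) measurable
  finally show ?thesis .
qed

text \<open>Reaching a positive level takes positive time, so \<open>exp(-n\<tau>)\<close> tends to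
  0. This makes the rate of the positive part unbounded in \<open>q\<close>, and with it every
  positive exponential moment accessible.\<close>

lemma passage_transform_tendsto_0:
  assumes "0 < x"
  shows "(\<lambda>n. passage_transform (real n) x) \<longlonglongrightarrow> 0"
proof -
  have [measurable]: "(\<lambda>w. lim (\<lambda>n. crossing x n w)) \<in> borel_measurable M"
    by (rule borel_measurable_lim_metric) measurable
  have "(\<lambda>n. passage_transform (real n) x) \<longlonglongrightarrow> (\<integral>\<^sup>+w. 0 \<partial>M)"
    unfolding passage_transform_def
  proof (rule nn_integral_dominated_convergence[where w = "\<lambda>_. 1"])
    fix n
    show "AE w in M. (if \<exists>m. crossed x m w
        then ennreal (exp (- real n * lim (\<lambda>m. crossing x m w))) else 0) \<le> 1"
      using AE_creeping_path
    proof eventually_elim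
      case (elim w)
      interpret creeping_path "\<lambda>t. Y t w" by (rule elim)
      show ?case
        using crossing_time_limit(2)[of x] assms by (auto simp: ennreal_le_1)
    qed
  next
    show "AE w in M. (\<lambda>n. if \<exists>m. crossed x m w
        then ennreal (exp (- real n * lim (\<lambda>m. crossing x m w))) else 0) \<longlonglongrightarrow> 0"
      using AE_creeping_path
    proof eventually_elim
      case (elim w)
      interpret creeping_path "\<lambda>t. Y t w" by (rule elim)
      show ?case
      proof (cases "\<exists>m. crossed x m w")
        case True
        then have "0 < lim (\<lambda>m. crossing x m w)"
          using crossing_time_limit(4)[of x] assms by auto
        then have "exp (- lim (\<lambda>m. crossing x m w)) < 1" by simp
        then have "(\<lambda>n. exp (- lim (\<lambda>m. crossing x m w)) ^ n) \<longlonglongrightarrow> 0"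
          by (intro LIMSEQ_realpow_zero) auto
        then have "(\<lambda>n. ennreal (exp (- real n * lim (\<lambda>m. crossing x m w)))) \<longlonglongrightarrow> ennreal 0"
          by (intro tendsto_ennrealI) (simp add: exp_of_nat_mult[symmetric])
        then show ?thesis using True by simp
      qed simp
    qed
  qed (auto simp: emeasure_space_1)
  then show ?thesis by simp
qed

end

text \<open>Additivity settles dyadic arguments, and approximation by them from the right gives
  \<open>a s \<le> s * a 1\<close>. Semicontinuity from one side suffices, which matters because
  Fatou's lemma offers no more for exponential moments.\<close>

lemma additive_lsc_linear:
  fixes a :: "real \<Rightarrow> real"
  assumes add: "\<And>s t. 0 \<le> s \<Longrightarrow> 0 \<le> t \<Longrightarrow> a (s + t) = a s + a t"
    and lsc: "\<And>t s l. 0 \<le> t \<Longrightarrow> (\<And>n. t < s n) \<Longrightarrow> s \<longlonglongrightarrow> t \<Longrightarrow> (\<lambda>n. a (s n)) \<longlonglongrightarrow> l \<Longrightarrow> a t \<le> l"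
    and "0 \<le> t"
  shows "a t = t * a 1"
proof -
  have mult: "a (real k * s) = real k * a s" if "0 \<le> s" for k s
  proof (induction k)
    case 0
    show ?case using add[of 0 0] by simp
  next
    case (Suc k)
    then show ?case using add[of s "real k * s"] that by (simp add: algebra_simps)
  qed
  have dy: "a (dyadic n k) = dyadic n k * a 1" for n k
  proof -
    have "2 ^ n * a (dyadic n k) = real k * a 1"
      using mult[of "dyadic n k" "2 ^ n"] mult[of 1 k] by (simp add: dyadic_def)
    then show ?thesis by (simp add: dyadic_def field_simps)
  qed
  have le: "a s \<le> s * a 1" if "0 \<le> s" for s
  proof -
    have "\<exists>u. s < u \<and> u < s + inverse (real (Suc n)) \<and> a u = u * a 1" for n
      using dyadic_between[of s "s + inverse (real (Suc n))"] that dy by (metis inverse_positive_iff_positive less_add_same_cancel1 of_nat_0_less_iff zero_less_Suc)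
    then obtain u where u: "\<And>n. s < u n" "\<And>n. u n < s + inverse (real (Suc n))" "\<And>n. a (u n) = u n * a 1"
      by metis
    have up: "(\<lambda>n. s + inverse (real (Suc n))) \<longlonglongrightarrow> s + 0"
      by (intro tendsto_add tendsto_const LIMSEQ_inverse_real_of_nat)
    have us: "u \<longlonglongrightarrow> s"
      by (rule tendsto_sandwich[OF _ _ tendsto_const up[simplified add_0_right]])
        (use u in \<open>auto intro!: always_eventually less_imp_le\<close>)
    show ?thesis
      by (rule lsc[OF that u(1) us]) (unfold u(3), intro tendsto_mult us tendsto_const)
  qed
  obtain k where k: "t \<le> real k" using real_arch_simple by blast
  \<comment> \<open>The upper bounds at \<open>t\<close> and at \<open>k - t\<close> add up to the
    exact value at \<open>k\<close>, so neither leaves any slack.\<close>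
  have "a t + a (real k - t) = real k * a 1"
    using add[of t "real k - t"] k \<open>0 \<le> t\<close> mult[of 1 k] by simp
  then show ?thesis
    using le[OF \<open>0 \<le> t\<close>] le[of "real k - t"] k by (simp add: algebra_simps)
qed

section \<open>The positive part of a step is exponential\<close>

context spectrally_negative_levy_process
begin

text \<open>This is where \<open>not_nonincreasing\<close> enters. If a step were never positive,
  then almost surely \<open>Y t \<le> 0\<close> for almost every and, by right-continuity, every
  \<open>t\<close>. Stationarity extends this to all dyadic increments, and right-continuity once
  more makes the paths nonincreasing.\<close>

lemma step_distribution_positive:
  assumes "0 < q"
  shows "0 < measure (step_distribution q) {0<..}"
proof (rule ccontr)
  interpret E: prob_space "exponential_measure q" by (rule prob_space_exponential_measure[OF assms])
  interpret S: prob_space "step_distribution q" by (rule prob_space_step_distribution[OF assms])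
  assume "\<not> 0 < measure (step_distribution q) {0<..}"
  then have "(\<integral>\<^sup>+u. indicator {0<..} u \<partial>step_distribution q) = 0"
    by (simp add: S.emeasure_eq_measure zero_less_measure_iff)
  then have "(\<integral>\<^sup>+w. (\<integral>\<^sup>+t. indicator {0<..} (Y (max 0 t) w) \<partial>exponential_measure q) \<partial>M) = 0"
    using assms by (subst (asm) nn_integral_step_distribution(1)) auto
  then have "AE w in M. (\<integral>\<^sup>+t. indicator {0<..} (Y (max 0 t) w) \<partial>exponential_measure q) = 0"
    by (subst (asm) nn_integral_0_iff_AE) auto
  then have nonpos: "AE w in M. \<forall>t\<ge>0. Y t w \<le> 0"
    using AE_space AE_creeping_path
  proof eventually_elim
    case (elim w)
    interpret creeping_path "\<lambda>t. Y t w" by (rule elim)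
    have [measurable]: "w \<in> space M" by (rule elim)
    have ae: "AE t in exponential_measure q. Y (max 0 t) w \<le> 0"
      using elim(1) by (subst (asm) nn_integral_0_iff_AE) (auto simp: indicator_eq_0_iff not_less elim!: eventually_mono)
    show "\<forall>t\<ge>0. Y t w \<le> 0"
    proof (intro allI impI, rule ccontr)
      fix t :: real assume t: "0 \<le> t" "\<not> Y t w \<le> 0"
      have "((\<lambda>s. Y s w) \<longlongrightarrow> Y t w) (at_right t)"
        using right_cont[OF t(1)] by (simp add: continuous_within)
      then have "\<forall>\<^sub>F u in at_right t. 0 < Y u w" using order_tendstoD(1) t(2) by force
      then obtain b where b: "t < b" "\<And>u. t < u \<Longrightarrow> u < b \<Longrightarrow> 0 < Y u w"
        unfolding eventually_at_right_field by blast
      obtain u where "t < u" "u < b" "Y (max 0 u) w \<le> 0"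
        using AE_exponential_measure_open_interval[OF assms t(1) b(1) ae] .
      then show False using b(2)[of u] t(1) by (simp add: max_absorb2)
    qed
  qed
  have "AE w in M. Y (dyadic m j) w \<le> Y (dyadic n k) w" if "dyadic n k < dyadic m j" for n k m j
  proof -
    have "AE w in M. Y (dyadic m j - dyadic n k) w \<le> 0"
      using nonpos that by (auto elim!: eventually_mono)
    then have "AE z in distr M borel (Y (dyadic m j - dyadic n k)). z \<le> 0"
      using that measurable_Y by (subst AE_distr_iff) auto
    then have "AE z in distr M borel (\<lambda>w. Y (dyadic m j) w - Y (dyadic n k) w). z \<le> 0"
      using that by (subst stationary_increments) auto
    then show ?thesis by (subst (asm) AE_distr_iff) auto
  qed
  then have "AE w in M. \<forall>n k m j. dyadic n k < dyadic m j \<longrightarrow> Y (dyadic m j) w \<le> Y (dyadic n k) w"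
    unfolding AE_all_countable by (auto intro: AE_I2)
  then have "AE w in M. antimono_on {0..} (\<lambda>t. Y t w)"
    using AE_creeping_path
  proof eventually_elim
    case (elim w)
    interpret creeping_path "\<lambda>t. Y t w" by (rule elim)
    show ?case
    proof (rule monotone_onI, rule ccontr)
      fix s t :: real assume st: "s \<in> {0..}" "t \<in> {0..}" "s \<le> t" and neg: "\<not> Y s w \<ge> Y t w"
      then have "s < t" by (cases "s = t") auto
      obtain c where c: "Y s w < c" "c < Y t w" using neg dense by (metis not_le)
      have "((\<lambda>u. Y u w) \<longlongrightarrow> Y s w) (at_right s)" "((\<lambda>u. Y u w) \<longlongrightarrow> Y t w) (at_right t)"
        using right_cont[of s] right_cont[of t] st by (auto simp: continuous_within)
      then have "\<forall>\<^sub>F u in at_right s. Y u w < c" "\<forall>\<^sub>F u in at_right t. c < Y u w"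
        using order_tendstoD c by blast+
      then obtain b d where b: "s < b" "\<And>u. s < u \<Longrightarrow> u < b \<Longrightarrow> Y u w < c"
        and d: "t < d" "\<And>u. t < u \<Longrightarrow> u < d \<Longrightarrow> c < Y u w"
        unfolding eventually_at_right_field by blast
      obtain n k where nk: "s < dyadic n k" "dyadic n k < min b t"
        using dyadic_between[of s "min b t"] b st \<open>s < t\<close> by auto
      obtain m j where mj: "t < dyadic m j" "dyadic m j < d"
        using dyadic_between[of t d] d st by auto
      have "Y (dyadic m j) w \<le> Y (dyadic n k) w" using elim(1) nk mj by auto
      then show False using b(2)[of "dyadic n k"] d(2)[of "dyadic m j"] nk mj by auto
    qed
  qed
  then show False using not_nonincreasing by simp
qed

text \<open>The \<open>\<rho>(q)\<close> of the overview. The passage transform turns out to be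
  multiplicative in the level, so its logarithm at level 1 determines it.\<close>

definition passage_rate :: "real \<Rightarrow> real" where
  "passage_rate q = - ln (enn2real (passage_transform q 1))"

text \<open>The identity \<open>g (x + y) = L x * gb y\<close> mixes an open and a closed tail. Once
  these are shown to agree on the half-line, \<open>L\<close> is multiplicative and
  right-continuous, hence exponential.\<close>

lemma step_distribution_tail:
  assumes "0 < q"
  shows "0 < passage_rate q"
    and "passage_transform q 1 = ennreal (exp (- passage_rate q))"
    and "\<And>x. 0 \<le> x \<Longrightarrow> measure (step_distribution q) {x<..} =
      measure (step_distribution q) {0<..} * exp (- passage_rate q * x)"
proof -
  interpret S: prob_space "step_distribution q" by (rule prob_space_step_distribution[OF assms])
  interpret RD: real_distribution "step_distribution q" by unfold_locales auto
  define g where "g x = measure (step_distribution q) {x<..}" for x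
  define gb where "gb x = measure (step_distribution q) {x..}" for x
  define L where "L x = enn2real (passage_transform q x)" for x
  have g0: "0 < g 0" using step_distribution_positive[OF assms] by (simp add: g_def)
  have g_nonneg: "0 \<le> g x" for x by (simp add: g_def)
  have g_mono: "y \<le> x \<Longrightarrow> g x \<le> g y" for x y by (auto simp: g_def intro!: S.finite_measure_mono)
  have g_gb: "g x \<le> gb x" for x by (auto simp: g_def gb_def intro!: S.finite_measure_mono)
  have gb_g: "y < x \<Longrightarrow> gb x \<le> g y" for x y by (auto simp: g_def gb_def intro!: S.finite_measure_mono)
  have fp: "ennreal (g (x + y)) = passage_transform q x * ennreal (gb y)" if "0 \<le> x" "0 \<le> y" for x y
    using first_passage_identity[OF assms that(1), of "x + y"] that
    by (simp add: g_def gb_def S.emeasure_eq_measure)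
  have Lfin: "passage_transform q x = ennreal (L x)" if "0 \<le> x" for x
  proof -
    have "passage_transform q x * ennreal (gb 0) \<noteq> \<infinity>"
      using fp[OF that, of 0] by (metis ennreal_neq_top infinity_ennreal_def order_refl)
    moreover have "ennreal (gb 0) \<noteq> 0" using g0 g_gb[of 0] by simp
    ultimately have "passage_transform q x \<noteq> \<infinity>" by (auto simp: ennreal_top_mult)
    then show ?thesis by (simp add: L_def less_top)
  qed
  have L_nonneg: "0 \<le> L x" for x by (simp add: L_def)
  have id: "g (x + y) = L x * gb y" if "0 \<le> x" "0 \<le> y" for x y
    using fp[OF that] Lfin[OF that(1)] L_nonneg[of x] g_nonneg[of "x + y"]
    by (simp add: gb_def flip: ennreal_mult)
  have g_cdf: "g x = 1 - cdf (step_distribution q) x" for x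
  proof -
    have "{x<..} = space (step_distribution q) - {..x}" by auto
    then show ?thesis unfolding g_def cdf_def using S.prob_compl[of "{..x}"] by simp
  qed
  have g_right: "(\<lambda>n. g (s n)) \<longlonglongrightarrow> g y" if "\<And>n. y < s n" "s \<longlonglongrightarrow> y" for s y
  proof -
    have "filterlim s (at_right y) sequentially"
      using that less_imp_neq[OF that(1), THEN not_sym] unfolding filterlim_at
      by (intro conjI always_eventually allI) auto
    then have "(\<lambda>n. cdf (step_distribution q) (s n)) \<longlonglongrightarrow> cdf (step_distribution q) y"
      using RD.cdf_is_right_cont[of y] filterlim_compose by (auto simp: continuous_within)
    then show ?thesis unfolding g_cdf by (intro tendsto_intros)
  qed
  have inv: "(\<lambda>n. y + inverse (real (Suc n))) \<longlonglongrightarrow> y" for y :: real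
    using tendsto_add[OF tendsto_const[of y] LIMSEQ_inverse_real_of_nat] by simp
  have gb_right: "(\<lambda>n. gb (y + inverse (real (Suc n)))) \<longlonglongrightarrow> g y" for y
    by (rule tendsto_sandwich[OF _ _ g_right[OF _ inv] tendsto_const])
      (auto intro!: always_eventually g_gb gb_g)
  \<comment> \<open>At level 0, approaching \<open>y\<close> from the right gives both tails the
    same limit. The resulting \<open>L 0 = 1\<close> says that the process enters the positive
    half-line at once, and it excludes atoms on the nonnegative half-line.\<close>
  have "L 0 * g y = g y" if "0 \<le> y" for y
  proof (rule LIMSEQ_unique)
    show "(\<lambda>n. g (y + inverse (real (Suc n)))) \<longlonglongrightarrow> g y"
      by (rule g_right[OF _ inv]) simp
    have "g (y + inverse (real (Suc n))) = L 0 * gb (y + inverse (real (Suc n)))" for n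
      using id[of 0 "y + inverse (real (Suc n))"] that by simp
    then show "(\<lambda>n. g (y + inverse (real (Suc n)))) \<longlonglongrightarrow> L 0 * g y"
      using tendsto_mult[OF tendsto_const gb_right] by simp
  qed
  then have L0: "L 0 = 1" using g0 by (metis mult_cancel_right1 order_refl less_irrefl mult.commute)
  have gbg: "gb y = g y" if "0 \<le> y" for y using id[of 0 y] L0 that by simp
  have gL: "g x = L x * g 0" if "0 \<le> x" for x using id[of x 0] gbg[of 0] that by simp
  have Lmult: "L (x + y) = L x * L y" if "0 \<le> x" "0 \<le> y" for x y
    using id[OF that] gbg[OF that(2)] gL[of "x + y"] gL[OF that(2)] that g0 by simp
  have L_right: "(\<lambda>n. L (s n)) \<longlonglongrightarrow> L y" if "0 \<le> y" "\<And>n. y < s n" "s \<longlonglongrightarrow> y" for s y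
  proof -
    have *: "L x = g x / g 0" if "0 \<le> x" for x using gL[OF that] g0 by simp
    have "0 \<le> s n" for n using that(1) that(2)[of n] by simp
    then show ?thesis
      using * tendsto_divide[OF g_right[OF that(2,3)] tendsto_const[of "g 0"]] g0 that(1) by simp
  qed
  have Lpow: "L (real k * x) = L x ^ k" if "0 \<le> x" for k x
  proof (induction k)
    case (Suc k)
    then show ?case using Lmult[of x "real k * x"] that by (simp add: algebra_simps)
  qed (simp add: L0)
  \<comment> \<open>A zero of \<open>L\<close> at \<open>x\<close> would be inherited by
    \<open>x / (n + 1)\<close> for every \<open>n\<close>, against \<open>L 0 = 1\<close> and
    right-continuity.\<close>
  have Lpos: "0 < L x" if "0 \<le> x" for x
  proof (rule ccontr)
    assume "\<not> 0 < L x"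
    then have "L x = 0" using L_nonneg[of x] by simp
    then have "0 < x" using L0 that by (cases "x = 0") auto
    have "L (x * inverse (real (Suc n))) = 0" for n
    proof -
      have "real (Suc n) * (x * inverse (real (Suc n))) = x" by (simp del: of_nat_Suc)
      then show ?thesis
        using Lpow[of "x * inverse (real (Suc n))" "Suc n"] \<open>L x = 0\<close> that
        by (metis mult_nonneg_nonneg inverse_nonnegative_iff_nonnegative of_nat_0_le_iff power_eq_0_iff)
    qed
    moreover have "(\<lambda>n. L (x * inverse (real (Suc n)))) \<longlonglongrightarrow> L 0"
      using \<open>0 < x\<close> tendsto_mult[OF tendsto_const[of x] LIMSEQ_inverse_real_of_nat]
      by (intro L_right) auto
    ultimately show False using L0 LIMSEQ_unique[OF tendsto_const] by force
  qed
  have "ln (L x) = x * ln (L 1)" if "0 \<le> x" for x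
  proof (rule additive_lsc_linear[OF _ _ that])
    show "ln (L (s + t)) = ln (L s) + ln (L t)" if "0 \<le> s" "0 \<le> t" for s t
      using Lmult[OF that] Lpos[OF that(1)] Lpos[OF that(2)] by (simp add: ln_mult)
    show "ln (L t) \<le> l" if "0 \<le> t" "\<And>n. t < s n" "s \<longlonglongrightarrow> t" "(\<lambda>n. ln (L (s n))) \<longlonglongrightarrow> l" for t s l
    proof -
      have "(\<lambda>n. ln (L (s n))) \<longlonglongrightarrow> ln (L t)"
        using L_right[OF that(1-3)] Lpos[OF that(1)] by (intro tendsto_ln) auto
      then show ?thesis using LIMSEQ_unique[OF that(4)] by auto
    qed
  qed
  then have Lexp: "L x = exp (- passage_rate q * x)" if "0 \<le> x" for x
    using that Lpos[OF that] by (metis L_def exp_ln minus_minus mult.commute passage_rate_def)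
  then show "passage_transform q 1 = ennreal (exp (- passage_rate q))"
    using Lfin[of 1] by simp
  show tail: "measure (step_distribution q) {x<..} =
      measure (step_distribution q) {0<..} * exp (- passage_rate q * x)" if "0 \<le> x" for x
    using gL[OF that] Lexp[OF that] by (simp add: g_def)
  show "0 < passage_rate q"
  proof (rule ccontr)
    assume neg: "\<not> 0 < passage_rate q"
    \<comment> \<open>With a nonpositive rate the tail would never fall below its positive value at
      0, yet the tail of a probability law vanishes at infinity.\<close>
    have "g 0 \<le> g x" if "0 \<le> x" for x
    proof -
      have "1 \<le> L x" using neg that by (simp add: Lexp mult_nonpos_nonneg)
      then show ?thesis using gL[OF that] g0 by simp
    qed
    moreover have "((\<lambda>x. g x) \<longlongrightarrow> 1 - 1) at_top"
      unfolding g_cdf using RD.cdf_lim_at_top_prob by (intro tendsto_intros)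
    then have "\<forall>\<^sub>F x in at_top. g x < g 0" using g0 order_tendstoD(2) by force
    then have "\<forall>\<^sub>F x in at_top. g x < g 0 \<and> 0 \<le> x"
      using eventually_ge_at_top[of 0] by eventually_elim simp
    ultimately show False
      using eventually_happens'[OF trivial_limit_at_top_linorder] by force
  qed
qed

lemma passage_rate_unbounded: "\<exists>q>0. \<alpha> < passage_rate q"
proof -
  have "\<forall>\<^sub>F n in sequentially. passage_transform (real n) 1 < ennreal (exp (- \<alpha>))"
    using order_tendstoD(2)[OF passage_transform_tendsto_0[of 1]] by simp
  then have "\<forall>\<^sub>F n in sequentially. passage_transform (real n) 1 < ennreal (exp (- \<alpha>)) \<and> 0 < n"
    using eventually_gt_at_top[of 0] by eventually_elim simp
  then obtain n where "passage_transform (real n) 1 < ennreal (exp (- \<alpha>))" "0 < n"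
    by (auto dest: eventually_happens)
  then show ?thesis
    using step_distribution_tail(2)[of "real n"] by (intro exI[of _ "real n"]) (simp add: ennreal_less_iff)
qed

end

section \<open>Exponential moments of a step and of the process\<close>

lemma ennreal_divide_mult_cancel:
  fixes a :: ennreal
  assumes "0 < c"
  shows "a = ennreal c * (a / ennreal c)"
proof -
  have "ennreal c * (a / ennreal c) = (ennreal c / ennreal c) * a"
    by (simp add: ennreal_times_divide mult.commute)
  then show ?thesis using assms by (simp add: ennreal_divide_self)
qed

context spectrally_negative_levy_process
begin

lemma step_distribution_positive_part:
  assumes "0 < q" "0 \<le> y" and [measurable]: "f \<in> borel_measurable borel"
  shows "(\<integral>\<^sup>+z. f z * indicator {y<..} z \<partial>step_distribution q) =
    ennreal (measure (step_distribution q) {0<..}) *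
    (\<integral>\<^sup>+z. f z * indicator {y<..} z \<partial>exponential_measure (passage_rate q))"
proof -
  interpret S: prob_space "step_distribution q" by (rule prob_space_step_distribution[OF assms(1)])
  let ?U = "uniform_measure (step_distribution q) {0<..}"
  note pos = step_distribution_positive[OF assms(1)]
  have nz: "emeasure (step_distribution q) {0<..} \<noteq> 0" "emeasure (step_distribution q) {0<..} \<noteq> \<infinity>"
    using pos by (auto simp: S.emeasure_eq_measure)
  have "distr ?U borel (\<lambda>x. x) = exponential_measure (passage_rate q)"
  proof (rule exponential_measureI)
    show "prob_space ?U" using nz by (rule prob_space_uniform_measure)
    show "0 < passage_rate q" using assms by (intro step_distribution_tail)
    fix x :: real assume "0 \<le> x"
    then have "{0<..} \<inter> {x<..} = {x<..}" by auto
    then show "measure ?U {w \<in> space ?U. x < w} = exp (- passage_rate q * x)"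
      using step_distribution_tail(3)[OF assms(1) \<open>0 \<le> x\<close>] pos nz
      by (simp add: greaterThan_def[symmetric])
  qed simp
  then have "(\<integral>\<^sup>+z. f z * indicator {y<..} z \<partial>exponential_measure (passage_rate q)) =
      (\<integral>\<^sup>+z. f z * indicator {y<..} z \<partial>?U)"
    by (subst \<open>distr ?U borel (\<lambda>x. x) = _\<close>[symmetric], subst nn_integral_distr) auto
  also have "\<dots> = (\<integral>\<^sup>+z. f z * indicator {y<..} z * indicator {0<..} z \<partial>step_distribution q) /
      emeasure (step_distribution q) {0<..}"
    by (rule nn_integral_uniform_measure) auto
  also have "(\<lambda>z. f z * indicator {y<..} z * indicator {0<..} z) = (\<lambda>z. f z * indicator {y<..} z)"
    using assms by (auto simp: fun_eq_iff split: split_indicator)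
  finally show ?thesis
    using ennreal_divide_mult_cancel[OF pos] by (simp add: S.emeasure_eq_measure)
qed

text \<open>A step above \<open>y\<close> exceeds \<open>y\<close> by an exponential amount whose
  rate does not depend on \<open>y\<close>; the quotient is the moment of that excess at
  \<open>r\<close>. It becomes the constant \<open>D\<close> of the optional stopping
  argument.\<close>

lemma step_distribution_overshoot:
  assumes "0 < q" "0 \<le> y" "r < passage_rate q"
  shows "(\<integral>\<^sup>+z. ennreal (exp (r * z)) * indicator {y<..} z \<partial>step_distribution q) =
    ennreal (exp (r * y) * (passage_rate q / (passage_rate q - r))) *
    emeasure (step_distribution q) {y<..}"
proof -
  interpret S: prob_space "step_distribution q" by (rule prob_space_step_distribution[OF assms(1)])
  let ?\<rho> = "passage_rate q" and ?c = "measure (step_distribution q) {0<..}"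
  have \<rho>: "0 < ?\<rho>" using assms by (intro step_distribution_tail)
  have "(\<integral>\<^sup>+z. ennreal (exp (r * z)) * indicator {y<..} z \<partial>exponential_measure ?\<rho>) =
      (\<integral>\<^sup>+z. ennreal (exp (r * z)) * indicator {y..} z \<partial>exponential_measure ?\<rho>)"
    using AE_exponential_measure_neq[of y ?\<rho>]
    by (intro nn_integral_cong_AE) (auto elim!: eventually_mono split: split_indicator)
  also have "\<dots> = ennreal (exp (- ?\<rho> * y)) * (\<integral>\<^sup>+z. ennreal (exp (r * (y + z))) \<partial>exponential_measure ?\<rho>)"
    using assms \<rho> by (intro exponential_memoryless) auto
  also have "(\<lambda>z. ennreal (exp (r * (y + z)))) = (\<lambda>z. ennreal (exp (r * y)) * ennreal (exp (r * z)))"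
    by (simp add: fun_eq_iff ring_distribs exp_add ennreal_mult)
  also have "(\<integral>\<^sup>+z. ennreal (exp (r * y)) * ennreal (exp (r * z)) \<partial>exponential_measure ?\<rho>) =
      ennreal (exp (r * y)) * ennreal (?\<rho> / (?\<rho> - r))"
    using assms \<rho> by (subst nn_integral_cmult) (auto simp: nn_integral_exp_exponential)
  finally have "(\<integral>\<^sup>+z. ennreal (exp (r * z)) * indicator {y<..} z \<partial>step_distribution q) =
      ennreal ?c * (ennreal (exp (- ?\<rho> * y)) * (ennreal (exp (r * y)) * ennreal (?\<rho> / (?\<rho> - r))))"
    using assms by (subst step_distribution_positive_part) auto
  also have "\<dots> = ennreal (exp (r * y) * (?\<rho> / (?\<rho> - r))) * ennreal (?c * exp (- ?\<rho> * y))"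
    using assms \<rho> by (simp add: mult_ac flip: ennreal_mult)
  also have "ennreal (?c * exp (- ?\<rho> * y)) = emeasure (step_distribution q) {y<..}"
    using step_distribution_tail(3)[OF assms(1,2)] by (simp add: S.emeasure_eq_measure)
  finally show ?thesis .
qed

text \<open>For \<open>\<alpha> \<ge> 0\<close> the nonpositive part of a step contributes at most
  1, so finiteness is decided by the exponential positive part.\<close>

lemma step_distribution_exp_moment_finite_iff:
  assumes "0 < q" "0 \<le> \<alpha>"
  shows "(\<integral>\<^sup>+z. ennreal (exp (\<alpha> * z)) \<partial>step_distribution q) < \<infinity> \<longleftrightarrow> \<alpha> < passage_rate q"
proof -
  interpret S: prob_space "step_distribution q" by (rule prob_space_step_distribution[OF assms(1)])
  let ?\<rho> = "passage_rate q" and ?c = "measure (step_distribution q) {0<..}"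
  have \<rho>: "0 < ?\<rho>" using assms by (intro step_distribution_tail)
  have "(\<integral>\<^sup>+z. ennreal (exp (\<alpha> * z)) \<partial>step_distribution q) =
      (\<integral>\<^sup>+z. ennreal (exp (\<alpha> * z)) * indicator {0<..} z + ennreal (exp (\<alpha> * z)) * indicator {..0} z \<partial>step_distribution q)"
    by (intro nn_integral_cong) (auto split: split_indicator)
  also have "\<dots> = (\<integral>\<^sup>+z. ennreal (exp (\<alpha> * z)) * indicator {0<..} z \<partial>step_distribution q) +
      (\<integral>\<^sup>+z. ennreal (exp (\<alpha> * z)) * indicator {..0} z \<partial>step_distribution q)"
    by (rule nn_integral_add) auto
  finally have split: "(\<integral>\<^sup>+z. ennreal (exp (\<alpha> * z)) \<partial>step_distribution q) = \<dots>" .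
  have "(\<integral>\<^sup>+z. ennreal (exp (\<alpha> * z)) * indicator {..0} z \<partial>step_distribution q) \<le> (\<integral>\<^sup>+z. 1 \<partial>step_distribution q)"
    using assms by (intro nn_integral_mono) (auto simp: ennreal_le_1 mult_nonneg_nonpos split: split_indicator)
  then have small: "(\<integral>\<^sup>+z. ennreal (exp (\<alpha> * z)) * indicator {..0} z \<partial>step_distribution q) < \<infinity>"
    using S.emeasure_space_1 by (auto intro: le_less_trans)
  have "(\<integral>\<^sup>+z. ennreal (exp (\<alpha> * z)) * indicator {0<..} z \<partial>exponential_measure ?\<rho>) =
      (\<integral>\<^sup>+z. ennreal (exp (\<alpha> * z)) \<partial>exponential_measure ?\<rho>)"
    using AE_exponential_measure_neq[of 0 ?\<rho>] AE_exponential_measure_nonneg[of ?\<rho>]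
  proof (intro nn_integral_cong_AE, eventually_elim)
    case (elim z)
    then show ?case by (auto split: split_indicator)
  qed
  then have "(\<integral>\<^sup>+z. ennreal (exp (\<alpha> * z)) * indicator {0<..} z \<partial>step_distribution q) =
      ennreal ?c * (if \<alpha> < ?\<rho> then ennreal (?\<rho> / (?\<rho> - \<alpha>)) else \<infinity>)"
    using assms \<rho> by (simp add: step_distribution_positive_part nn_integral_exp_exponential)
  then show ?thesis
    using small step_distribution_positive[OF assms(1)] unfolding split
    by (auto simp: ennreal_mult_top ennreal_mult_less_top)
qed

text \<open>Valued in \<open>ennreal\<close>, because multiplicativity in time is needed before
  finiteness is known.\<close>

definition exp_moment :: "real \<Rightarrow> real \<Rightarrow> ennreal" where
  "exp_moment \<alpha> t = (\<integral>\<^sup>+w. ennreal (exp (\<alpha> * Y t w)) \<partial>M)"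

lemma exp_moment_pos: "0 \<le> t \<Longrightarrow> 0 < exp_moment \<alpha> t"
  unfolding exp_moment_def using measurable_Y[of t]
  by (subst zero_less_iff_neq_zero, subst nn_integral_0_iff_AE) auto

lemma exp_moment_add:
  assumes "0 \<le> s" "0 \<le> t"
  shows "exp_moment \<alpha> (s + t) = exp_moment \<alpha> s * exp_moment \<alpha> t"
proof -
  have [measurable]: "Y s \<in> borel_measurable M" "Y t \<in> borel_measurable M"
    "Y s \<in> borel_measurable (generated_algebra borel {0..s} Y)"
    using measurable_Y assms by auto
  have "exp_moment \<alpha> (s + t) = (\<integral>\<^sup>+w. ennreal (exp (\<alpha> * (Y s w + (Y (s + t) w - Y s w)))) \<partial>M)"
    by (simp add: exp_moment_def)
  also have "\<dots> = (\<integral>\<^sup>+w. (\<integral>\<^sup>+v. ennreal (exp (\<alpha> * (Y s w + Y t v))) \<partial>M) \<partial>M)"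
    by (rule decouple_increment[OF assms, where F = "\<lambda>w v. ennreal (exp (\<alpha> * (Y s w + v)))"]) measurable
  also have "\<dots> = (\<integral>\<^sup>+w. (\<integral>\<^sup>+v. ennreal (exp (\<alpha> * Y s w)) * ennreal (exp (\<alpha> * Y t v)) \<partial>M) \<partial>M)"
    by (simp add: ring_distribs exp_add ennreal_mult)
  also have "\<dots> = exp_moment \<alpha> s * exp_moment \<alpha> t"
    by (simp add: nn_integral_cmult nn_integral_multc exp_moment_def)
  finally show ?thesis .
qed

text \<open>For \<open>q\<close> with \<open>\<alpha>\<close> below its rate, the moment at the
  exponential time is finite, hence so is the moment at almost every fixed time, in particular at
  some \<open>u > t\<close>. It factors through \<open>t\<close>, and the other factor is
  nonzero.\<close>

lemma exp_moment_finite: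
  assumes "0 \<le> \<alpha>" "0 \<le> t"
  shows "exp_moment \<alpha> t < \<infinity>"
proof -
  obtain q where q: "0 < q" "\<alpha> < passage_rate q" using passage_rate_unbounded by blast
  interpret E: prob_space "exponential_measure q" by (rule prob_space_exponential_measure[OF q(1)])
  interpret P: pair_prob_space "exponential_measure q" M ..
  have "(\<integral>\<^sup>+z. ennreal (exp (\<alpha> * z)) \<partial>step_distribution q) \<noteq> \<infinity>"
    using step_distribution_exp_moment_finite_iff[OF q(1) assms(1)] q by (simp add: less_top)
  then have "(\<integral>\<^sup>+t. exp_moment \<alpha> (max 0 t) \<partial>exponential_measure q) \<noteq> \<infinity>"
    using q by (subst (asm) nn_integral_step_distribution(2)) (auto simp: exp_moment_def)
  moreover have "(\<lambda>t. exp_moment \<alpha> (max 0 t)) \<in> borel_measurable (exponential_measure q)"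
    unfolding exp_moment_def by measurable
  ultimately have "AE t in exponential_measure q. exp_moment \<alpha> (max 0 t) \<noteq> \<infinity>"
    by (intro nn_integral_PInf_AE)
  then obtain u where u: "t < u" "exp_moment \<alpha> (max 0 u) \<noteq> \<infinity>"
    using AE_exponential_measure_open_interval[OF q(1) assms(2), of "t + 1"] by auto
  then have "exp_moment \<alpha> t * exp_moment \<alpha> (u - t) \<noteq> \<infinity>"
    using exp_moment_add[of t "u - t" \<alpha>] assms by (simp add: max_absorb2)
  moreover have "exp_moment \<alpha> (u - t) \<noteq> 0" using exp_moment_pos[of "u - t" \<alpha>] u by simp
  ultimately show ?thesis by (auto simp: less_top ennreal_mult_less_top)
qed

section \<open>The Laplace exponent and its right-inverse\<close>

abbreviation \<Phi> :: "real \<Rightarrow> real" where "\<Phi> \<equiv> laplace_exponent M Y"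

text \<open>The logarithm of the moment is additive in time. Paths are right-continuous, but nothing
  dominates them near a given time, so Fatou's lemma supplies lower semicontinuity in place of
  continuity.\<close>

lemma exp_moment_eq:
  assumes "0 \<le> \<alpha>" "0 \<le> t"
  shows "exp_moment \<alpha> t = ennreal (exp (t * \<Phi> \<alpha>))"
proof -
  define a where "a s = ln (enn2real (exp_moment \<alpha> s))" for s
  have ea: "exp_moment \<alpha> s = ennreal (exp (a s))" if "0 \<le> s" for s
    using exp_moment_pos[OF that, of \<alpha>] exp_moment_finite[OF assms(1) that]
    by (cases "exp_moment \<alpha> s") (auto simp: a_def)
  have "a t = t * a 1"
  proof (rule additive_lsc_linear[OF _ _ assms(2)])
    show "a (s + u) = a s + a u" if "0 \<le> s" "0 \<le> u" for s u
    proof -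
      have "ennreal (exp (a (s + u))) = ennreal (exp (a s + a u))"
        using exp_moment_add[OF that, of \<alpha>] ea that by (simp add: exp_add ennreal_mult)
      then show ?thesis by simp
    qed
    show "a u \<le> l" if u: "0 \<le> u" "\<And>n. u < s n" "s \<longlonglongrightarrow> u" "(\<lambda>n. a (s n)) \<longlonglongrightarrow> l" for u s l
    proof -
      have s: "0 \<le> s n" for n using u(1) u(2)[of n] by simp
      have [measurable]: "Y (s n) \<in> borel_measurable M" for n using measurable_Y s by auto
      have "exp_moment \<alpha> u = (\<integral>\<^sup>+w. liminf (\<lambda>n. ennreal (exp (\<alpha> * Y (s n) w))) \<partial>M)"
        unfolding exp_moment_def
      proof (rule nn_integral_cong)
        fix w assume "w \<in> space M"
        have "filterlim s (at_right u) sequentially"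
          using u(3) u(2) less_imp_neq[OF u(2), THEN not_sym] unfolding filterlim_at
          by (intro conjI always_eventually allI) auto
        then have "(\<lambda>n. Y (s n) w) \<longlonglongrightarrow> Y u w"
          using right_continuous_paths[OF \<open>w \<in> space M\<close> u(1)] filterlim_compose
          by (auto simp: continuous_within)
        then have "(\<lambda>n. ennreal (exp (\<alpha> * Y (s n) w))) \<longlonglongrightarrow> ennreal (exp (\<alpha> * Y u w))"
          by (intro tendsto_ennrealI tendsto_intros)
        then show "ennreal (exp (\<alpha> * Y u w)) = liminf (\<lambda>n. ennreal (exp (\<alpha> * Y (s n) w)))"
          by (intro lim_imp_Liminf[symmetric]) simp_all
      qed
      also have "\<dots> \<le> liminf (\<lambda>n. exp_moment \<alpha> (s n))"
        unfolding exp_moment_def by (rule nn_integral_liminf) measurable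
      also have "\<dots> = ennreal (exp l)"
        using u(4) s by (intro lim_imp_Liminf) (auto simp: ea intro!: tendsto_ennrealI tendsto_intros)
      finally show "a u \<le> l" using ea[OF u(1)] by simp
    qed
  qed
  moreover have "a 1 = \<Phi> \<alpha>"
    using measurable_Y[of 1]
    by (simp add: a_def laplace_exponent_def exp_moment_def integral_eq_nn_integral)
  ultimately show ?thesis using ea[OF assms(2)] by simp
qed

lemma step_distribution_exp_moment:
  assumes "0 < q" "0 \<le> \<alpha>"
  shows "(\<integral>\<^sup>+z. ennreal (exp (\<alpha> * z)) \<partial>step_distribution q) =
    (if \<Phi> \<alpha> < q then ennreal (q / (q - \<Phi> \<alpha>)) else \<infinity>)"
proof -
  have "(\<integral>\<^sup>+z. ennreal (exp (\<alpha> * z)) \<partial>step_distribution q) =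
      (\<integral>\<^sup>+t. exp_moment \<alpha> (max 0 t) \<partial>exponential_measure q)"
    using assms by (subst nn_integral_step_distribution(2)) (auto simp: exp_moment_def)
  also have "\<dots> = (\<integral>\<^sup>+t. ennreal (exp (\<Phi> \<alpha> * t)) \<partial>exponential_measure q)"
  proof (rule nn_integral_cong_AE)
    show "AE t in exponential_measure q. exp_moment \<alpha> (max 0 t) = ennreal (exp (\<Phi> \<alpha> * t))"
      using AE_exponential_measure_nonneg[of q]
      by eventually_elim (use assms in \<open>simp add: exp_moment_eq mult.commute\<close>)
  qed
  finally show ?thesis using assms by (simp add: nn_integral_exp_exponential)
qed

text \<open>Finiteness of \<open>E exp(\<alpha>Z)\<close>, read once off the exponential time and
  once off the exponential positive part.\<close>

lemma laplace_exponent_less_iff: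
  assumes "0 < q" "0 \<le> \<alpha>"
  shows "\<Phi> \<alpha> < q \<longleftrightarrow> \<alpha> < passage_rate q"
  using step_distribution_exp_moment_finite_iff[OF assms] step_distribution_exp_moment[OF assms]
  by (auto split: if_splits)

lemma exp_laplace_exponent:
  assumes "0 \<le> \<alpha>"
  shows "integrable M (\<lambda>w. exp (\<alpha> * Y 1 w))" "exp (\<Phi> \<alpha>) = (\<integral>w. exp (\<alpha> * Y 1 w) \<partial>M)"
proof -
  have [measurable]: "Y 1 \<in> borel_measurable M" by (rule measurable_Y) simp
  have eq: "(\<integral>\<^sup>+w. ennreal (exp (\<alpha> * Y 1 w)) \<partial>M) = ennreal (exp (\<Phi> \<alpha>))"
    using exp_moment_eq[OF assms, of 1] by (simp add: exp_moment_def)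
  then show "integrable M (\<lambda>w. exp (\<alpha> * Y 1 w))"
    by (intro integrableI_nonneg) auto
  show "exp (\<Phi> \<alpha>) = (\<integral>w. exp (\<alpha> * Y 1 w) \<partial>M)"
    by (simp add: integral_eq_nn_integral eq)
qed

text \<open>Convexity of \<open>exp\<close> under the integral is enough here. Since
  \<open>exp\<close> is increasing, comparing values of \<open>exp (\<Phi> \<alpha>)\<close> serves
  as well as comparing values of \<open>\<Phi>\<close>.\<close>

lemma convex_exp_laplace_exponent: "convex_on {0..} (\<lambda>\<alpha>. exp (\<Phi> \<alpha>))"
proof (rule convex_onI)
  fix t x y :: real assume t: "0 < t" "t < 1" and xy: "x \<in> {0..}" "y \<in> {0..}"
  have nn: "0 \<le> (1 - t) * x + t * y" using t xy by simp
  have "(\<integral>w. exp (((1 - t) * x + t * y) * Y 1 w) \<partial>M) \<le>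
      (\<integral>w. (1 - t) * exp (x * Y 1 w) + t * exp (y * Y 1 w) \<partial>M)"
  proof (intro integral_mono)
    fix w
    show "exp (((1 - t) * x + t * y) * Y 1 w) \<le> (1 - t) * exp (x * Y 1 w) + t * exp (y * Y 1 w)"
      using convex_onD[OF exp_convex, of t "x * Y 1 w" "y * Y 1 w"] t by (simp add: algebra_simps)
  qed (use exp_laplace_exponent(1) nn xy in auto)
  also have "\<dots> = (1 - t) * exp (\<Phi> x) + t * exp (\<Phi> y)"
    using exp_laplace_exponent xy by (subst Bochner_Integration.integral_add) auto
  finally show "exp (\<Phi> ((1 - t) *\<^sub>R x + t *\<^sub>R y)) \<le> (1 - t) * exp (\<Phi> x) + t * exp (\<Phi> y)"
    using exp_laplace_exponent(2)[OF nn] by simp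
qed simp

text \<open>The consequence of convexity that is needed: to the right of a point where
  \<open>\<Phi> < q\<close>, the value \<open>q\<close> is attained at most once.\<close>

lemma exp_laplace_exponent_strict:
  assumes "0 \<le> a" "a < b" "b < c" "\<Phi> a < q" "\<Phi> c \<le> q"
  shows "\<Phi> b < q"
proof -
  define t where "t = (b - a) / (c - a)"
  have t: "0 < t" "t < 1" and b: "b = (1 - t) * a + t * c"
  proof -
    have "t * (c - a) = b - a" using assms by (simp add: t_def)
    then show "b = (1 - t) * a + t * c" by (simp add: algebra_simps)
  qed (use assms in \<open>auto simp: t_def field_simps\<close>)
  have "exp (\<Phi> b) \<le> (1 - t) * exp (\<Phi> a) + t * exp (\<Phi> c)"
    using convex_onD[OF convex_exp_laplace_exponent, of t a c] t assms by (simp add: b)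
  also have "\<dots> < (1 - t) * exp q + t * exp q"
    using t assms by (intro add_less_le_mono mult_strict_left_mono mult_left_mono) auto
  finally show ?thesis by (simp add: algebra_simps)
qed

text \<open>Continuity gives a root to the right of \<open>\<theta>\<close> and convexity makes it
  the largest, so the supremum is attained. The witness \<open>\<theta>\<close> lets the lemma cover
  \<open>q = 0\<close>, where 0 is a root as well and has to be told apart from the one
  sought.\<close>

lemma right_inverse_root:
  assumes "0 \<le> q" "0 < \<theta>" "\<Phi> \<theta> < q"
  shows "\<theta> < right_inverse M Y q" "\<Phi> (right_inverse M Y q) = q"
proof -
  \<comment> \<open>As \<open>q + 1\<close> is positive even for \<open>q = 0\<close>, its rate is
    available; \<open>\<Phi>\<close> is at least \<open>q + 1\<close> there, since a rate is not
    below itself.\<close>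
  define b where "b = passage_rate (q + 1)"
  have b: "\<theta> < b" "q + 1 \<le> \<Phi> b"
    using laplace_exponent_less_iff[of "q + 1" \<theta>] laplace_exponent_less_iff[of "q + 1" b] assms
    by (auto simp: b_def)
  have "continuous_on {\<theta>..b} (\<lambda>\<alpha>. exp (\<Phi> \<alpha>))"
  proof (rule continuous_on_subset)
    show "continuous_on {0<..} (\<lambda>\<alpha>. exp (\<Phi> \<alpha>))"
      by (intro convex_on_continuous convex_on_subset[OF convex_exp_laplace_exponent]) auto
  qed (use assms in auto)
  then obtain r where r: "\<theta> \<le> r" "r \<le> b" "exp (\<Phi> r) = exp q"
    using IVT'[of "\<lambda>\<alpha>. exp (\<Phi> \<alpha>)" \<theta> "exp q" b] assms b by auto
  have "\<theta> < r" using r assms by (cases "\<theta> = r") auto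
  have "right_inverse M Y q = r"
    unfolding right_inverse_def
  proof (rule cSup_eq_maximum)
    show "r \<in> {\<alpha>. 0 \<le> \<alpha> \<and> \<Phi> \<alpha> = q}" using r assms by simp
    fix \<alpha> assume "\<alpha> \<in> {\<alpha>. 0 \<le> \<alpha> \<and> \<Phi> \<alpha> = q}"
    then show "\<alpha> \<le> r"
      using exp_laplace_exponent_strict[of \<theta> r \<alpha> q] \<open>\<theta> < r\<close> assms r by (cases "\<alpha> \<le> r") auto
  qed
  then show "\<theta> < right_inverse M Y q" "\<Phi> (right_inverse M Y q) = q"
    using \<open>\<theta> < r\<close> r by auto
qed

text \<open>The root is not below the rate, because \<open>\<Phi>\<close> equals \<open>q\<close>
  there. Were it above, convexity would give \<open>\<Phi> (passage_rate q) < q\<close>, which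
  \<open>laplace_exponent_less_iff\<close> forbids.\<close>

lemma right_inverse_eq_passage_rate:
  assumes "0 < q"
  shows "right_inverse M Y q = passage_rate q"
proof -
  define \<theta> where "\<theta> = passage_rate q / 2"
  have \<theta>: "0 < \<theta>" "\<theta> < passage_rate q"
    using step_distribution_tail(1)[OF assms] by (auto simp: \<theta>_def)
  then have "\<Phi> \<theta> < q" using laplace_exponent_less_iff[OF assms] by auto
  then have R: "\<theta> < right_inverse M Y q" "\<Phi> (right_inverse M Y q) = q"
    using right_inverse_root[of q \<theta>] \<theta> assms by simp_all
  have "passage_rate q \<le> right_inverse M Y q"
    using laplace_exponent_less_iff[OF assms, of "right_inverse M Y q"] R \<theta> by simp
  moreover have "\<not> passage_rate q < right_inverse M Y q"
  proof
    assume "passage_rate q < right_inverse M Y q"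
    then have "\<Phi> (passage_rate q) < q"
      using R \<theta> \<open>\<Phi> \<theta> < q\<close>
      by (intro exp_laplace_exponent_strict[of \<theta> "passage_rate q" "right_inverse M Y q" q]) simp_all
    then show False
      using laplace_exponent_less_iff[OF assms, of "passage_rate q"] \<theta> by auto
  qed
  ultimately show ?thesis by simp
qed

text \<open>The quotients \<open>(exp(\<theta>Y) - 1) / \<theta>\<close> tend to \<open>Y\<close> as
  \<open>\<theta>\<close> decreases to 0, so their mean is eventually negative. Since the mean of
  \<open>Y 1\<close> may be \<open>-\<infinity>\<close>, positive and negative parts are treated
  separately: the first by domination, the second by Fatou's lemma.\<close>

lemma laplace_exponent_negative:
  assumes "ext_expectation M (Y 1) < 0"
  shows "\<exists>\<theta>>0. \<Phi> \<theta> < 0"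
proof -
  have [measurable]: "Y 1 \<in> borel_measurable M" by (rule measurable_Y) simp
  define A where "A = (\<integral>\<^sup>+w. ennreal (Y 1 w) \<partial>M)"
  define B where "B = (\<integral>\<^sup>+w. ennreal (- Y 1 w) \<partial>M)"
  have "A < B"
  proof -
    have "enn2ereal A - enn2ereal B < 0"
      using assms by (simp add: ext_expectation_def A_def B_def)
    moreover have "0 \<le> enn2ereal A" "0 \<le> enn2ereal B" by simp_all
    ultimately have "enn2ereal A < enn2ereal B"
      by (cases "enn2ereal A"; cases "enn2ereal B") auto
    then show ?thesis by (simp add: less_ennreal.rep_eq)
  qed
  \<comment> \<open>A value strictly between the two parts of the mean separates their
    approximations, whether or not \<open>B\<close> is finite.\<close>
  then obtain C where C: "A < C" "C < B" using dense by blast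
  define \<theta> where "\<theta> n = inverse (real (Suc n))" for n
  have \<theta>: "0 < \<theta> n" "\<theta> n \<le> 1" for n by (auto simp: \<theta>_def field_simps)
  define f where "f n w = (exp (\<theta> n * Y 1 w) - 1) / \<theta> n" for n w
  have [measurable]: "f n \<in> borel_measurable M" for n unfolding f_def by measurable
  have f_le: "f n w \<le> exp (1 * Y 1 w)" for n w
  proof -
    have "exp (\<theta> n * Y 1 w) \<le> (1 - \<theta> n) * exp 0 + \<theta> n * exp (Y 1 w)"
      using convex_onD[OF exp_convex, of "\<theta> n" 0 "Y 1 w"] \<theta>[of n] by simp
    then have "f n w \<le> exp (Y 1 w) - 1"
      using \<theta>[of n] by (simp add: f_def field_simps)
    then show ?thesis by simp
  qed
  have f_lim: "(\<lambda>n. f n w) \<longlonglongrightarrow> Y 1 w" for w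
  proof -
    have "((\<lambda>h. exp (h * Y 1 w)) has_real_derivative Y 1 w) (at 0)"
      by (auto intro!: derivative_eq_intros)
    then have "((\<lambda>h. (exp (h * Y 1 w) - 1) / h) \<longlongrightarrow> Y 1 w) (at 0)"
      by (simp add: DERIV_def)
    moreover have "filterlim \<theta> (at 0) sequentially"
      unfolding filterlim_at \<theta>_def using LIMSEQ_inverse_real_of_nat by auto
    ultimately show ?thesis unfolding f_def by (rule filterlim_compose)
  qed
  have "(\<lambda>n. \<integral>\<^sup>+w. ennreal (f n w) \<partial>M) \<longlonglongrightarrow> A"
    unfolding A_def
  proof (rule nn_integral_dominated_convergence[where w = "\<lambda>w. ennreal (exp (1 * Y 1 w))"])
    show "(\<integral>\<^sup>+w. ennreal (exp (1 * Y 1 w)) \<partial>M) < \<infinity>"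
      using exp_moment_finite[of 1 1] by (simp add: exp_moment_def)
  qed (use f_le f_lim in \<open>auto intro!: AE_I2 ennreal_leI tendsto_ennrealI simp del: mult_1\<close>)
  then have "\<forall>\<^sub>F n in sequentially. (\<integral>\<^sup>+w. ennreal (f n w) \<partial>M) < C"
    using C(1) by (rule order_tendstoD)
  moreover have "B \<le> liminf (\<lambda>n. \<integral>\<^sup>+w. ennreal (- f n w) \<partial>M)"
  proof -
    have "B = (\<integral>\<^sup>+w. liminf (\<lambda>n. ennreal (- f n w)) \<partial>M)"
      unfolding B_def
      by (intro nn_integral_cong lim_imp_Liminf[symmetric] tendsto_ennrealI tendsto_minus f_lim) simp
    also have "\<dots> \<le> liminf (\<lambda>n. \<integral>\<^sup>+w. ennreal (- f n w) \<partial>M)"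
      by (rule nn_integral_liminf) measurable
    finally show ?thesis .
  qed
  then have "\<forall>\<^sub>F n in sequentially. C < (\<integral>\<^sup>+w. ennreal (- f n w) \<partial>M)"
    using C(2) by (intro less_LiminfD) (rule less_le_trans)
  ultimately have "\<forall>\<^sub>F n in sequentially. (\<integral>\<^sup>+w. ennreal (f n w) \<partial>M) < C \<and> C < (\<integral>\<^sup>+w. ennreal (- f n w) \<partial>M)"
    by (rule eventually_conj)
  then obtain n where "(\<integral>\<^sup>+w. ennreal (f n w) \<partial>M) < C" "C < (\<integral>\<^sup>+w. ennreal (- f n w) \<partial>M)"
    by (auto dest: eventually_happens)
  then have less: "(\<integral>\<^sup>+w. ennreal (f n w) \<partial>M) < (\<integral>\<^sup>+w. ennreal (- f n w) \<partial>M)" by (rule less_trans)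
  have int: "integrable M (\<lambda>w. exp (\<theta> n * Y 1 w))"
    using \<theta>[of n] by (intro exp_laplace_exponent) simp
  then have intf: "integrable M (f n)" unfolding f_def by simp
  then have "(\<integral>\<^sup>+w. ennreal (- f n w) \<partial>M) < \<infinity>"
    using integrable_minus[OF intf] by (simp add: real_integrable_def less_top)
  then have "enn2real (\<integral>\<^sup>+w. ennreal (f n w) \<partial>M) < enn2real (\<integral>\<^sup>+w. ennreal (- f n w) \<partial>M)"
    using less by (cases "\<integral>\<^sup>+w. ennreal (f n w) \<partial>M"; cases "\<integral>\<^sup>+w. ennreal (- f n w) \<partial>M") (auto simp: ennreal_less_iff)
  then have "(\<integral>w. f n w \<partial>M) < 0"
    by (simp add: real_lebesgue_integral_def[OF intf])
  also have "(\<integral>w. f n w \<partial>M) = (exp (\<Phi> (\<theta> n)) - 1) / \<theta> n"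
    using int \<theta>[of n] prob_space by (simp add: f_def exp_laplace_exponent(2))
  finally have "exp (\<Phi> (\<theta> n)) < 1" using \<theta>[of n] by (simp add: divide_less_0_iff)
  then show ?thesis using \<theta>[of n] by auto
qed

end

text \<open>The tail at real levels alone forces \<open>X\<close> to be finite almost surely, since
  it tends to 0. The conditional law can therefore be computed for a real variable and carried back;
  the tail at 0 together with nonnegativity gives the atom.\<close>

lemma (in prob_space) exponential_with_atomI:
  fixes X :: "'a \<Rightarrow> ereal"
  assumes [measurable]: "X \<in> borel_measurable M" and nonneg: "AE w in M. 0 \<le> X w"
    and "0 < r" "p < 1"
    and tail: "\<And>x. 0 \<le> x \<Longrightarrow> prob {w \<in> space M. ereal x < X w} = (1 - p) * exp (- r * x)"
  shows "exponential_with_atom M X p r"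
proof -
  have pos: "prob {w \<in> space M. 0 < X w} = 1 - p"
    using tail[of 0] by (simp add: zero_ereal_def)
  have "prob {w \<in> space M. X w = 0} = prob (space M - {w \<in> space M. 0 < X w})"
    using nonneg by (intro finite_measure_eq_AE) (auto elim!: eventually_mono)
  then have zero: "prob {w \<in> space M. X w = 0} = p"
    using pos by (simp add: prob_compl)
  let ?A = "{w \<in> space M. 0 < X w}"
  let ?U = "uniform_measure M ?A"
  have nz: "emeasure M ?A \<noteq> 0" "emeasure M ?A \<noteq> \<infinity>"
    using pos \<open>p < 1\<close> by (auto simp: emeasure_eq_measure)
  have fin: "AE w in M. X w \<noteq> \<infinity>"
  proof -
    have le: "prob {w \<in> space M. X w = \<infinity>} \<le> (1 - p) * exp (- r * real n)" for n
    proof -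
      have "prob {w \<in> space M. X w = \<infinity>} \<le> prob {w \<in> space M. ereal (real n) < X w}"
        by (intro finite_measure_mono) auto
      then show ?thesis by (simp add: tail)
    qed
    have "(\<lambda>n. exp (- r) ^ n) \<longlonglongrightarrow> 0" using \<open>0 < r\<close> by (intro LIMSEQ_realpow_zero) auto
    then have "(\<lambda>n. (1 - p) * exp (- r * real n)) \<longlonglongrightarrow> (1 - p) * 0"
      by (intro tendsto_intros) (simp add: mult.commute flip: exp_of_nat_mult)
    then have "prob {w \<in> space M. X w = \<infinity>} \<le> (1 - p) * 0"
      by (rule LIMSEQ_le_const) (use le in auto)
    then have "emeasure M {w \<in> space M. X w = \<infinity>} = 0"
      using measure_nonneg[of M "{w \<in> space M. X w = \<infinity>}"] by (simp add: emeasure_eq_measure)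
    then show ?thesis by (subst AE_iff_measurable[OF _ refl]) auto
  qed
  have "distr ?U borel (\<lambda>w. real_of_ereal (X w)) = exponential_measure r"
  proof (rule exponential_measureI[OF prob_space_uniform_measure[OF nz] _ \<open>0 < r\<close>])
    fix x :: real assume "0 \<le> x"
    have "prob (?A \<inter> {w \<in> space M. x < real_of_ereal (X w)}) = prob {w \<in> space M. ereal x < X w}"
    proof (rule finite_measure_eq_AE)
      show "AE w in M. (w \<in> ?A \<inter> {w \<in> space M. x < real_of_ereal (X w)}) =
          (w \<in> {w \<in> space M. ereal x < X w})"
        using fin
      proof eventually_elim
        case (elim w)
        then show ?case using \<open>0 \<le> x\<close> by (cases "X w") auto
      qed
    qed auto
    then show "measure ?U {w \<in> space ?U. x < real_of_ereal (X w)} = exp (- r * x)"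
      using nz pos \<open>p < 1\<close> tail[OF \<open>0 \<le> x\<close>] by simp
  qed simp
  moreover have "distr ?U borel X = distr (distr ?U borel (\<lambda>w. real_of_ereal (X w))) borel ereal"
  proof -
    have "AE w in ?U. X w = ereal (real_of_ereal (X w))"
    proof (rule AE_uniform_measureI)
      show "AE w in M. w \<in> ?A \<longrightarrow> X w = ereal (real_of_ereal (X w))"
        using fin by eventually_elim (auto simp: ereal_real)
    qed simp
    then have "distr ?U borel X = distr ?U borel (\<lambda>w. ereal (real_of_ereal (X w)))"
      by (intro distr_cong_AE) auto
    also have "\<dots> = distr (distr ?U borel (\<lambda>w. real_of_ereal (X w))) borel ereal"
      by (subst distr_distr) (auto simp: comp_def)
    finally show ?thesis .
  qed
  ultimately show ?thesis
    unfolding exponential_with_atom_def using pos zero by simp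
qed

section \<open>Optional stopping for a walk with discounted steps\<close>

text \<open>\<open>V n\<close> discounts the walk \<open>S\<close> at time \<open>n\<close>: it is the conditional probability of the event
  \<open>Q n\<close> that the observation is not yet stopped. \<open>\<mu>\<close> is the law of a step after discounting, and
  \<open>overshoot\<close> expresses that a step above a nonnegative level exceeds it by an exponential amount.\<close>

locale discounted_walk = prob_space M for M :: "'a measure" +
  fixes S :: "nat \<Rightarrow> 'a \<Rightarrow> real" and V :: "nat \<Rightarrow> 'a \<Rightarrow> ennreal" and Q :: "nat \<Rightarrow> 'a \<Rightarrow> bool"
    and \<mu> :: "real measure" and \<kappa> :: ennreal and r \<theta> D \<delta> :: real
  assumes measurable_S [measurable]: "\<And>n. S n \<in> borel_measurable M"
    and measurable_V [measurable]: "\<And>n. V n \<in> borel_measurable M"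
    and measurable_Q [measurable]: "\<And>n. Measurable.pred M (Q n)"
    and V_zero: "AE w in M. V 0 w = 1"
    and S_zero: "AE w in M. S 0 w = 0"
    and Q_zero: "AE w in M. Q 0 w"
    and Q_decreasing: "\<And>n w. w \<in> space M \<Longrightarrow> Q (Suc n) w \<Longrightarrow> Q n w"
    and prob_space_\<mu>: "prob_space \<mu>"
    and sets_\<mu> [measurable_cong]: "sets \<mu> = sets borel"
    and markov_step: "\<And>n x f. 0 \<le> x \<Longrightarrow> f \<in> borel_measurable (borel \<Otimes>\<^sub>M borel) \<Longrightarrow>
      (\<integral>\<^sup>+w. V (Suc n) w * (indicator {w \<in> space M. \<forall>k\<le>n. S k w \<le> x} w *
        f (S n w, S (Suc n) w - S n w)) \<partial>M) =
      \<kappa> * (\<integral>\<^sup>+w. V n w * (indicator {w \<in> space M. \<forall>k\<le>n. S k w \<le> x} w *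
        (\<integral>\<^sup>+z. f (S n w, z) \<partial>\<mu>)) \<partial>M)"
    and discount: "\<And>n x. 0 \<le> x \<Longrightarrow>
      emeasure M {w \<in> space M. (\<forall>k\<le>n. S k w \<le> x) \<and> x < S (Suc n) w \<and> Q (Suc n) w} =
      (\<integral>\<^sup>+w. V (Suc n) w * indicator {w \<in> space M. (\<forall>k\<le>n. S k w \<le> x) \<and> x < S (Suc n) w} w \<partial>M)"
    and overshoot: "\<And>y. 0 \<le> y \<Longrightarrow>
      (\<integral>\<^sup>+z. ennreal (exp (r * z)) * indicator {y<..} z \<partial>\<mu>) = ennreal (exp (r * y) * D) * emeasure \<mu> {y<..}"
    and unit: "\<kappa> * (\<integral>\<^sup>+z. ennreal (exp (r * z)) \<partial>\<mu>) = 1"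
    and contraction: "\<kappa> * (\<integral>\<^sup>+z. ennreal (exp (\<theta> * z)) \<partial>\<mu>) = ennreal \<delta>"
    and \<delta>: "0 \<le> \<delta>" "\<delta> < 1"
    and r: "0 \<le> \<theta>" "\<theta> \<le> r" "0 < r"
    and D: "0 < D"
begin

sublocale \<mu>: prob_space \<mu> by (rule prob_space_\<mu>)

text \<open>Optional stopping as a telescoping sum. By \<open>unit\<close> a step conserves the
  discounted mass of \<open>exp (r * S n)\<close>; the part leaving the region below
  \<open>x\<close> is \<open>K * p n\<close>, where \<open>K\<close> combines the value
  \<open>exp (r * x)\<close> at the level with the overshoot factor \<open>D\<close>. The part that
  stays tends to 0 by comparison with the exponent \<open>\<theta>\<close>.\<close>

lemma first_passage_sum:
  assumes "0 \<le> x"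
  shows "(\<Sum>n. \<integral>\<^sup>+w. V (Suc n) w * indicator {w \<in> space M. (\<forall>k\<le>n. S k w \<le> x) \<and> x < S (Suc n) w} w \<partial>M) =
    ennreal (exp (- r * x) / D)"
proof -
  define C where "C n = {w \<in> space M. \<forall>k\<le>n. S k w \<le> x}" for n
  have [measurable]: "C n \<in> sets M" for n unfolding C_def by measurable
  define p where "p n = (\<integral>\<^sup>+w. V (Suc n) w * (indicator (C n) w * indicator {x<..} (S (Suc n) w)) \<partial>M)" for n
  define a where "a n = (\<integral>\<^sup>+w. V n w * (indicator (C n) w * ennreal (exp (r * S n w))) \<partial>M)" for n
  define b where "b n = (\<integral>\<^sup>+w. V n w * (indicator (C n) w * ennreal (exp (\<theta> * S n w))) \<partial>M)" for n
  define K where "K = ennreal (exp (r * x) * D)"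
  note step = markov_step[OF assms, folded C_def]
  have C_Suc: "indicator (C (Suc n)) w = (indicator (C n) w * indicator {..x} (S (Suc n) w) :: ennreal)"
    if "w \<in> space M" for n w
    using that by (auto simp: C_def le_Suc_eq split: split_indicator)
  have exp_step: "(\<integral>\<^sup>+w. V (Suc n) w * (indicator (C n) w * ennreal (exp (c * S (Suc n) w))) \<partial>M) =
      \<kappa> * (\<integral>\<^sup>+z. ennreal (exp (c * z)) \<partial>\<mu>) * (\<integral>\<^sup>+w. V n w * (indicator (C n) w * ennreal (exp (c * S n w))) \<partial>M)" for c n
  proof -
    have "(\<integral>\<^sup>+w. V (Suc n) w * (indicator (C n) w * ennreal (exp (c * S (Suc n) w))) \<partial>M) =
        (\<integral>\<^sup>+w. V (Suc n) w * (indicator (C n) w * (\<lambda>(s, z). ennreal (exp (c * (s + z)))) (S n w, S (Suc n) w - S n w)) \<partial>M)"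
      by simp
    also have "\<dots> = \<kappa> * (\<integral>\<^sup>+w. V n w * (indicator (C n) w * (\<integral>\<^sup>+z. (\<lambda>(s, z). ennreal (exp (c * (s + z)))) (S n w, z) \<partial>\<mu>)) \<partial>M)"
      by (rule step) measurable
    also have "(\<lambda>w. \<integral>\<^sup>+z. (\<lambda>(s, z). ennreal (exp (c * (s + z)))) (S n w, z) \<partial>\<mu>) =
        (\<lambda>w. ennreal (exp (c * S n w)) * (\<integral>\<^sup>+z. ennreal (exp (c * z)) \<partial>\<mu>))"
      by (simp add: fun_eq_iff ring_distribs exp_add ennreal_mult nn_integral_cmult)
    also have "(\<integral>\<^sup>+w. V n w * (indicator (C n) w * (ennreal (exp (c * S n w)) * (\<integral>\<^sup>+z. ennreal (exp (c * z)) \<partial>\<mu>))) \<partial>M) =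
        (\<integral>\<^sup>+w. V n w * (indicator (C n) w * ennreal (exp (c * S n w))) \<partial>M) * (\<integral>\<^sup>+z. ennreal (exp (c * z)) \<partial>\<mu>)"
      by (subst nn_integral_multc[symmetric]) (auto simp: mult_ac)
    finally show ?thesis by (simp add: mult_ac)
  qed
  have p_eq: "p n = \<kappa> * (\<integral>\<^sup>+w. V n w * (indicator (C n) w * emeasure \<mu> {x - S n w<..}) \<partial>M)" for n
  proof -
    have "p n = (\<integral>\<^sup>+w. V (Suc n) w * (indicator (C n) w * (\<lambda>(s, z). indicator {x<..} (s + z)) (S n w, S (Suc n) w - S n w)) \<partial>M)"
      by (simp add: p_def)
    also have "\<dots> = \<kappa> * (\<integral>\<^sup>+w. V n w * (indicator (C n) w * (\<integral>\<^sup>+z. (\<lambda>(s, z). indicator {x<..} (s + z)) (S n w, z) \<partial>\<mu>)) \<partial>M)"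
      by (rule step) measurable
    also have "(\<lambda>w. \<integral>\<^sup>+z. (\<lambda>(s, z). indicator {x<..} (s + z)) (S n w, z) \<partial>\<mu>) = (\<lambda>w. emeasure \<mu> {x - S n w<..})"
    proof
      fix w
      have "(\<lambda>z. indicator {x<..} (S n w + z) :: ennreal) = indicator {x - S n w<..}"
        by (auto simp: fun_eq_iff split: split_indicator)
      then show "(\<integral>\<^sup>+z. (\<lambda>(s, z). indicator {x<..} (s + z)) (S n w, z) \<partial>\<mu>) = emeasure \<mu> {x - S n w<..}"
        by simp
    qed
    finally show ?thesis .
  qed
  have [measurable]: "(\<lambda>w. emeasure \<mu> {x - S n w<..}) \<in> borel_measurable M" for n
    using measurable_emeasure_greaterThan[OF prob_space_\<mu> sets_\<mu>] by measurable
  have over: "(\<integral>\<^sup>+w. V (Suc n) w * (indicator (C n) w * (indicator {x<..} (S (Suc n) w) * ennreal (exp (r * S (Suc n) w)))) \<partial>M) =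
      K * p n" for n
  proof -
    have "(\<integral>\<^sup>+w. V (Suc n) w * (indicator (C n) w * (indicator {x<..} (S (Suc n) w) * ennreal (exp (r * S (Suc n) w)))) \<partial>M) =
       (\<integral>\<^sup>+w. V (Suc n) w * (indicator (C n) w * (\<lambda>(s, z). indicator {x<..} (s + z) * ennreal (exp (r * (s + z)))) (S n w, S (Suc n) w - S n w)) \<partial>M)"
      by simp
    also have "\<dots> = \<kappa> * (\<integral>\<^sup>+w. V n w * (indicator (C n) w * (\<integral>\<^sup>+z. (\<lambda>(s, z). indicator {x<..} (s + z) * ennreal (exp (r * (s + z)))) (S n w, z) \<partial>\<mu>)) \<partial>M)"
      by (rule step) measurable
    also have "(\<integral>\<^sup>+w. V n w * (indicator (C n) w * (\<integral>\<^sup>+z. (\<lambda>(s, z). indicator {x<..} (s + z) * ennreal (exp (r * (s + z)))) (S n w, z) \<partial>\<mu>)) \<partial>M) =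
        (\<integral>\<^sup>+w. K * (V n w * (indicator (C n) w * emeasure \<mu> {x - S n w<..})) \<partial>M)"
    proof (rule nn_integral_cong)
      fix w assume w: "w \<in> space M"
      show "V n w * (indicator (C n) w * (\<integral>\<^sup>+z. (\<lambda>(s, z). indicator {x<..} (s + z) * ennreal (exp (r * (s + z)))) (S n w, z) \<partial>\<mu>)) =
          K * (V n w * (indicator (C n) w * emeasure \<mu> {x - S n w<..}))"
      proof (cases "w \<in> C n")
        case True
        \<comment> \<open>Before the crossing the distance to the level is nonnegative, as
          \<open>overshoot\<close> demands. The factors at \<open>S n w\<close> and at the distance
          multiply to a constant, so the overshoot factor is the same from every starting
          point.\<close>
        then have y: "0 \<le> x - S n w" by (simp add: C_def)
        have "(\<integral>\<^sup>+z. (\<lambda>(s, z). indicator {x<..} (s + z) * ennreal (exp (r * (s + z)))) (S n w, z) \<partial>\<mu>) =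
            (\<integral>\<^sup>+z. ennreal (exp (r * S n w)) * (ennreal (exp (r * z)) * indicator {x - S n w<..} z) \<partial>\<mu>)"
          by (intro nn_integral_cong)
            (auto simp: ring_distribs exp_add ennreal_mult split: split_indicator)
        also have "\<dots> = ennreal (exp (r * S n w)) * (ennreal (exp (r * (x - S n w)) * D) * emeasure \<mu> {x - S n w<..})"
          by (simp add: nn_integral_cmult overshoot[OF y])
        also have "\<dots> = K * emeasure \<mu> {x - S n w<..}"
        proof -
          have "exp (r * S n w) * (exp (r * (x - S n w)) * D) = exp (r * x) * D"
            by (simp add: mult_exp_exp mult.assoc[symmetric] algebra_simps)
          then have "ennreal (exp (r * S n w)) * ennreal (exp (r * (x - S n w)) * D) = K"
            using D by (simp add: K_def flip: ennreal_mult)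
          then show ?thesis by (metis mult.assoc)
        qed
        finally show ?thesis by (simp add: mult_ac)
      qed simp
    qed
    also have "\<dots> = K * (\<integral>\<^sup>+w. V n w * (indicator (C n) w * emeasure \<mu> {x - S n w<..}) \<partial>M)"
      by (rule nn_integral_cmult) measurable
    finally show ?thesis by (simp add: p_eq mult_ac)
  qed
  have a_step: "a n = a (Suc n) + K * p n" for n
  proof -
    have "a n = (\<integral>\<^sup>+w. V (Suc n) w * (indicator (C n) w * ennreal (exp (r * S (Suc n) w))) \<partial>M)"
      by (simp add: exp_step unit a_def)
    also have "\<dots> = (\<integral>\<^sup>+w. V (Suc n) w * (indicator (C (Suc n)) w * ennreal (exp (r * S (Suc n) w))) +
        V (Suc n) w * (indicator (C n) w * (indicator {x<..} (S (Suc n) w) * ennreal (exp (r * S (Suc n) w)))) \<partial>M)"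
      by (intro nn_integral_cong) (auto simp: C_Suc split: split_indicator)
    also have "\<dots> = a (Suc n) + K * p n"
      unfolding over[symmetric] a_def by (rule nn_integral_add) measurable
    finally show ?thesis .
  qed
  have start: "(\<integral>\<^sup>+w. V 0 w * (indicator (C 0) w * ennreal (exp (c * S 0 w))) \<partial>M) = 1" for c
  proof -
    have "(\<integral>\<^sup>+w. V 0 w * (indicator (C 0) w * ennreal (exp (c * S 0 w))) \<partial>M) = (\<integral>\<^sup>+w. 1 \<partial>M)"
    proof (rule nn_integral_cong_AE)
      show "AE w in M. V 0 w * (indicator (C 0) w * ennreal (exp (c * S 0 w))) = 1"
        using V_zero S_zero AE_space by eventually_elim (use assms in \<open>simp add: C_def\<close>)
    qed
    then show ?thesis by (simp add: emeasure_space_1)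
  qed
  have a_sum: "a n + (\<Sum>i<n. K * p i) = 1" for n
  proof (induction n)
    case 0
    then show ?case by (simp add: a_def start)
  next
    case (Suc n)
    then show ?case using a_step[of n] by (simp add: add_ac)
  qed
  have b_le: "b n \<le> ennreal (\<delta> ^ n)" for n
  proof (induction n)
    case 0
    then show ?case by (simp add: b_def start)
  next
    case (Suc n)
    have "b (Suc n) \<le> (\<integral>\<^sup>+w. V (Suc n) w * (indicator (C n) w * ennreal (exp (\<theta> * S (Suc n) w))) \<partial>M)"
      unfolding b_def by (intro nn_integral_mono) (auto simp: C_Suc split: split_indicator)
    also have "\<dots> = ennreal \<delta> * b n"
      by (simp add: exp_step contraction b_def)
    also have "\<dots> \<le> ennreal \<delta> * ennreal (\<delta> ^ n)" using Suc by (intro mult_left_mono) auto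
    finally show ?case using \<delta> by (simp flip: ennreal_mult)
  qed
  \<comment> \<open>Below the level, \<open>exp (r * S n)\<close> exceeds
    \<open>exp (\<theta> * S n)\<close> by at most the factor
    \<open>exp ((r - \<theta>) * x)\<close>, so the decay of \<open>b\<close> passes to
    \<open>a\<close>.\<close>
  have a_le: "a n \<le> ennreal (exp ((r - \<theta>) * x) * \<delta> ^ n)" for n
  proof -
    have "a n \<le> (\<integral>\<^sup>+w. ennreal (exp ((r - \<theta>) * x)) * (V n w * (indicator (C n) w * ennreal (exp (\<theta> * S n w)))) \<partial>M)"
      unfolding a_def
    proof (rule nn_integral_mono)
      fix w
      show "V n w * (indicator (C n) w * ennreal (exp (r * S n w))) \<le>
          ennreal (exp ((r - \<theta>) * x)) * (V n w * (indicator (C n) w * ennreal (exp (\<theta> * S n w))))"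
      proof (cases "w \<in> C n")
        case True
        then have "S n w \<le> x" by (simp add: C_def)
        then have "(r - \<theta>) * S n w \<le> (r - \<theta>) * x" using r by (intro mult_left_mono) auto
        then have "exp (r * S n w) \<le> exp ((r - \<theta>) * x) * exp (\<theta> * S n w)"
          by (simp add: mult_exp_exp algebra_simps)
        then have "ennreal (exp (r * S n w)) \<le> ennreal (exp ((r - \<theta>) * x)) * ennreal (exp (\<theta> * S n w))"
          by (simp add: ennreal_leI flip: ennreal_mult)
        then have "V n w * ennreal (exp (r * S n w)) \<le> V n w * (ennreal (exp ((r - \<theta>) * x)) * ennreal (exp (\<theta> * S n w)))"
          by (intro mult_left_mono) auto
        then show ?thesis using True by (simp add: mult_ac)
      qed simp
    qed
    also have "\<dots> = ennreal (exp ((r - \<theta>) * x)) * b n"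
      unfolding b_def by (rule nn_integral_cmult) measurable
    also have "\<dots> \<le> ennreal (exp ((r - \<theta>) * x)) * ennreal (\<delta> ^ n)"
      using b_le by (intro mult_left_mono) auto
    finally show ?thesis using \<delta> by (simp add: ennreal_mult)
  qed
  have "a \<longlonglongrightarrow> 0"
  proof (rule tendsto_sandwich[OF _ _ tendsto_const])
    have "(\<lambda>n. exp ((r - \<theta>) * x) * \<delta> ^ n) \<longlonglongrightarrow> exp ((r - \<theta>) * x) * 0"
      using \<delta> by (intro tendsto_mult tendsto_const LIMSEQ_realpow_zero)
    from tendsto_ennrealI[OF this] show "(\<lambda>n. ennreal (exp ((r - \<theta>) * x) * \<delta> ^ n)) \<longlonglongrightarrow> 0"
      by (simp only: mult_zero_right ennreal_0)
  qed (use a_le in auto)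
  then have "(\<lambda>n. a n + (\<Sum>i<n. K * p i)) \<longlonglongrightarrow> 0 + (\<Sum>i. K * p i)"
    by (intro tendsto_add summable_LIMSEQ) auto
  then have "K * (\<Sum>i. p i) = 1"
    by (simp add: a_sum LIMSEQ_const_iff)
  moreover have "K = ennreal (inverse (exp (- r * x) / D))" using D by (simp add: K_def exp_minus field_simps)
  ultimately have "ennreal (exp (- r * x) / D) * (ennreal (inverse (exp (- r * x) / D)) * (\<Sum>i. p i)) =
      ennreal (exp (- r * x) / D)" by simp
  moreover have "ennreal (exp (- r * x) / D) * ennreal (inverse (exp (- r * x) / D)) = 1"
    using D by (simp flip: ennreal_mult)
  ultimately have "(\<Sum>i. p i) = ennreal (exp (- r * x) / D)"
    by (metis mult.assoc mult_1)
  moreover have "p n = (\<integral>\<^sup>+w. V (Suc n) w * indicator {w \<in> space M. (\<forall>k\<le>n. S k w \<le> x) \<and> x < S (Suc n) w} w \<partial>M)" for n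
    unfolding p_def by (intro nn_integral_cong) (auto simp: C_def split: split_indicator)
  ultimately show ?thesis by simp
qed

definition maximum :: "'a \<Rightarrow> ereal" where
  "maximum w = (SUP n\<in>{n. Q n w}. ereal (S n w))"

lemma measurable_maximum [measurable]: "maximum \<in> borel_measurable M"
proof -
  have "maximum = (\<lambda>w. SUP n. if Q n w then ereal (S n w) else bot)"
  proof
    \<comment> \<open>Giving stopped indices the value \<open>bot\<close> replaces a supremum over a
      random index set by a countable supremum of measurable functions.\<close>
    fix w
    show "maximum w = (SUP n. if Q n w then ereal (S n w) else bot)"
      unfolding maximum_def
    proof (intro antisym SUP_least)
      show "ereal (S n w) \<le> (SUP n. if Q n w then ereal (S n w) else bot)" if "n \<in> {n. Q n w}" for n
        using that by (intro SUP_upper2[of n]) auto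
    qed (auto intro: SUP_upper)
  qed
  moreover have "(\<lambda>w. SUP n. if Q n w then ereal (S n w) else bot) \<in> borel_measurable M"
    by measurable
  ultimately show ?thesis by metis
qed

lemma Q_mono:
  assumes "w \<in> space M" "m \<le> n" "Q n w"
  shows "Q m w"
  using assms(2,3) by (induction rule: dec_induct) (use Q_decreasing[OF assms(1)] in auto)

text \<open>As \<open>Q\<close> is decreasing in \<open>n\<close>, exceeding \<open>x\<close> at
  some observed index means that the first passage index is itself observed. First passages at
  different indices are disjoint, and \<open>discount\<close> identifies their probabilities with
  the summands above.\<close>

lemma prob_maximum_greater:
  assumes "0 \<le> x"
  shows "prob {w \<in> space M. ereal x < maximum w} = exp (- r * x) / D"
proof -
  define B where "B n = {w \<in> space M. (\<forall>k\<le>n. S k w \<le> x) \<and> x < S (Suc n) w \<and> Q (Suc n) w}" for n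
  have [measurable]: "B n \<in> sets M" for n unfolding B_def by measurable
  have "emeasure M {w \<in> space M. ereal x < maximum w} = emeasure M (\<Union>n. B n)"
  proof (rule emeasure_eq_AE)
    show "AE w in M. w \<in> {w \<in> space M. ereal x < maximum w} \<longleftrightarrow> w \<in> (\<Union>n. B n)"
      using S_zero AE_space
    proof eventually_elim
      case (elim w)
      have "ereal x < maximum w \<longleftrightarrow> (\<exists>n. Q n w \<and> x < S n w)"
        by (auto simp: maximum_def less_SUP_iff)
      also have "\<dots> \<longleftrightarrow> (\<exists>n. w \<in> B n)"
      proof
        assume "\<exists>n. Q n w \<and> x < S n w"
        then obtain n where n: "Q n w" "x < S n w" by blast
        define m where "m = (LEAST n. x < S n w)"
        have m: "x < S m w" "m \<le> n" "\<And>k. k < m \<Longrightarrow> S k w \<le> x"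
          using LeastI[of "\<lambda>n. x < S n w", OF n(2)] Least_le[of "\<lambda>n. x < S n w", OF n(2)]
          unfolding m_def by (blast, blast, metis (no_types, lifting) not_less not_less_Least)
        \<comment> \<open>The walk starts at 0, which is not above \<open>x\<close>; so first
          passage happens after a step, matching the index \<open>Suc n\<close> in
          \<open>B n\<close>.\<close>
        have "m \<noteq> 0" using m(1) elim(1) assms by (cases m) auto
        then obtain j where "m = Suc j" by (cases m) auto
        then have "w \<in> B j"
          using m elim Q_mono[OF elim(2) m(2) n(1)] by (auto simp: B_def less_Suc_eq_le)
        then show "\<exists>n. w \<in> B n" by blast
      qed (auto simp: B_def)
      finally show ?case using elim by simp
    qed
  qed auto
  also have "\<dots> = (\<Sum>n. emeasure M (B n))"
  proof (rule suminf_emeasure[symmetric])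
    show "disjoint_family B"
    proof -
      have "B m \<inter> B n = {}" if "m < n" for m n
      proof -
        have "x < S (Suc m) w" "S (Suc m) w \<le> x" if "w \<in> B m" "w \<in> B n" for w
          using that \<open>m < n\<close> by (simp_all add: B_def)
        then show ?thesis by force
      qed
      then show ?thesis
        unfolding disjoint_family_on_def by (metis Int_commute linorder_neqE_nat)
    qed
  qed auto
  also have "\<dots> = ennreal (exp (- r * x) / D)"
    using first_passage_sum[OF assms] by (simp add: B_def discount[OF assms])
  finally show ?thesis using D by (simp add: emeasure_eq_measure)
qed

lemma maximum_exponential_with_atom: "exponential_with_atom M maximum (1 - 1 / D) r"
proof (rule exponential_with_atomI)
  show "AE w in M. 0 \<le> maximum w"
    using S_zero Q_zero
  proof eventually_elim
    case (elim w)
    then have "ereal (S 0 w) \<le> maximum w"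
      unfolding maximum_def by (intro SUP_upper) simp
    then show ?case using elim by (simp add: zero_ereal_def)
  qed
qed (use r D prob_maximum_greater in auto)

end

section \<open>The two models of inspection\<close>

text \<open>The constants come from \<open>E exp(\<alpha>Z) = q / (q - \<Phi>(\<alpha>))\<close>. At
  \<open>\<Phi>(r) = \<beta>\<close> it equals \<open>q / \<omega>\<close>, the inverse of the
  discount; at \<open>\<theta>\<close> the product is
  \<open>\<omega> / (q - \<Phi>(\<theta>))\<close>, which is below 1 because
  \<open>\<Phi>(\<theta>) < \<beta> = q - \<omega>\<close>. The overshoot rate makes
  \<open>1 - 1 / D\<close> equal to \<open>r / passage_rate q\<close>. Leaving \<open>V\<close> and
  \<open>Q\<close> open lets both models of inspection fit.\<close>

lemma (in spectrally_negative_levy_process) discounted_maximum: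
  fixes P :: "'c measure" and S :: "nat \<Rightarrow> 'c \<Rightarrow> real" and V :: "nat \<Rightarrow> 'c \<Rightarrow> ennreal"
    and Q :: "nat \<Rightarrow> 'c \<Rightarrow> bool"
  assumes \<omega>: "0 < \<omega>" and \<beta>: "0 \<le> \<beta>" and drift: "\<beta> = 0 \<Longrightarrow> ext_expectation M (Y 1) < 0"
    and "prob_space P"
    and "\<And>n. S n \<in> borel_measurable P" "\<And>n. V n \<in> borel_measurable P" "\<And>n. Measurable.pred P (Q n)"
    and "AE w in P. V 0 w = 1" "AE w in P. S 0 w = 0" "AE w in P. Q 0 w"
    and "\<And>n w. w \<in> space P \<Longrightarrow> Q (Suc n) w \<Longrightarrow> Q n w"
    and markov_step: "\<And>n x f. 0 \<le> x \<Longrightarrow> f \<in> borel_measurable (borel \<Otimes>\<^sub>M borel) \<Longrightarrow>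
      (\<integral>\<^sup>+w. V (Suc n) w * (indicator {w \<in> space P. \<forall>k\<le>n. S k w \<le> x} w *
        f (S n w, S (Suc n) w - S n w)) \<partial>P) =
      ennreal (\<omega> / (\<beta> + \<omega>)) * (\<integral>\<^sup>+w. V n w * (indicator {w \<in> space P. \<forall>k\<le>n. S k w \<le> x} w *
        (\<integral>\<^sup>+z. f (S n w, z) \<partial>step_distribution (\<beta> + \<omega>))) \<partial>P)"
    and "\<And>n x. 0 \<le> x \<Longrightarrow>
      emeasure P {w \<in> space P. (\<forall>k\<le>n. S k w \<le> x) \<and> x < S (Suc n) w \<and> Q (Suc n) w} =
      (\<integral>\<^sup>+w. V (Suc n) w * indicator {w \<in> space P. (\<forall>k\<le>n. S k w \<le> x) \<and> x < S (Suc n) w} w \<partial>P)"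
  shows "exponential_with_atom P (\<lambda>w. SUP n\<in>{n. Q n w}. ereal (S n w))
    (right_inverse M Y \<beta> / right_inverse M Y (\<beta> + \<omega>)) (right_inverse M Y \<beta>)"
proof -
  define q where "q = \<beta> + \<omega>"
  have q: "0 < q" "\<beta> < q" using \<omega> \<beta> by (auto simp: q_def)
  \<comment> \<open>For \<open>\<beta> > 0\<close> any positive number below the rate at
    \<open>\<beta>\<close> serves, here its half; for \<open>\<beta> = 0\<close> the negative mean
    provides one.\<close>
  obtain \<theta> where \<theta>: "0 < \<theta>" "\<Phi> \<theta> < \<beta>"
  proof (cases "\<beta> = 0")
    case True
    then obtain \<theta> where "0 < \<theta>" "\<Phi> \<theta> < 0"
      using laplace_exponent_negative[OF drift] by blast
    then show ?thesis using True by (intro that[of \<theta>]) simp_all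
  next
    case False
    then have "0 < \<beta>" using \<beta> by simp
    then have "0 < passage_rate \<beta> / 2" "passage_rate \<beta> / 2 < passage_rate \<beta>"
      using step_distribution_tail(1)[of \<beta>] by simp_all
    then show ?thesis
      using laplace_exponent_less_iff[OF \<open>0 < \<beta>\<close>, of "passage_rate \<beta> / 2"]
      by (intro that[of "passage_rate \<beta> / 2"]) simp_all
  qed
  define r where "r = right_inverse M Y \<beta>"
  have r: "\<theta> < r" "\<Phi> r = \<beta>"
    using right_inverse_root[OF _ \<theta>] \<beta> by (auto simp: r_def)
  have r\<rho>: "r < passage_rate q"
    using laplace_exponent_less_iff[of q r] q r \<theta> by simp
  define D where "D = passage_rate q / (passage_rate q - r)"
  have D: "0 < D" "1 - 1 / D = r / passage_rate q"
    using r r\<rho> \<theta> by (auto simp: D_def field_simps)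
  interpret DW: discounted_walk P S V Q "step_distribution q" "ennreal (\<omega> / q)" r \<theta> D "\<omega> / (q - \<Phi> \<theta>)"
  proof (intro discounted_walk.intro discounted_walk_axioms.intro)
    show "prob_space (step_distribution q)" by (rule prob_space_step_distribution[OF q(1)])
    show "(\<integral>\<^sup>+z. ennreal (exp (r * z)) * indicator {y<..} z \<partial>step_distribution q) =
        ennreal (exp (r * y) * D) * emeasure (step_distribution q) {y<..}" if "0 \<le> y" for y
      unfolding D_def using q(1) that r\<rho> by (rule step_distribution_overshoot)
    show "ennreal (\<omega> / q) * (\<integral>\<^sup>+z. ennreal (exp (r * z)) \<partial>step_distribution q) = 1"
      using q r \<theta> \<omega> \<beta> by (simp add: step_distribution_exp_moment q_def flip: ennreal_mult)
    show "ennreal (\<omega> / q) * (\<integral>\<^sup>+z. ennreal (exp (\<theta> * z)) \<partial>step_distribution q) = ennreal (\<omega> / (q - \<Phi> \<theta>))"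
      using q r \<theta> \<omega> \<beta> by (simp add: step_distribution_exp_moment flip: ennreal_mult)
    show "0 \<le> \<omega> / (q - \<Phi> \<theta>)" "\<omega> / (q - \<Phi> \<theta>) < 1"
      using q \<theta> \<omega> \<beta> by (auto simp: q_def)
  qed (fact assms[folded q_def] | use r \<theta> D in \<open>simp; fail\<close>)+
  show ?thesis
    using DW.maximum_exponential_with_atom
    unfolding DW.maximum_def[abs_def] D(2) r_def right_inverse_eq_passage_rate[OF q(1), symmetric]
    by (simp add: q_def)
qed

text \<open>Since \<open>N\<close> is independent of the steps, the discount is the deterministic
  number \<open>P(N \<ge> n) = \<kappa>^n\<close>.\<close>

lemma (in spectrally_negative_levy_process) walk_maximum_law:
  fixes P :: "'c measure"
  assumes walk: "killed_inspection_walk P M Y \<beta> \<omega> Z N"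
    and "0 < \<omega>" "0 \<le> \<beta>" and drift: "\<beta> = 0 \<Longrightarrow> ext_expectation M (Y 1) < 0"
  shows "exponential_with_atom P (walk_maximum Z N)
    (right_inverse M Y \<beta> / right_inverse M Y (\<beta> + \<omega>)) (right_inverse M Y \<beta>)"
proof -
  interpret W: killed_inspection_walk P M Y \<beta> \<omega> Z N by fact
  define q where "q = \<beta> + \<omega>"
  have q: "0 < q" using assms by (auto simp: q_def)
  define \<kappa> where "\<kappa> = \<omega> / q"
  have \<kappa>: "0 \<le> \<kappa>" "\<kappa> + \<beta> / q = 1"
    using \<open>0 < \<omega>\<close> q by (simp_all add: \<kappa>_def flip: add_divide_distrib) (simp add: q_def)
  define S where "S n w = (\<Sum>m=1..n. Z m w)" for n w
  have Z [measurable]: "Z m \<in> borel_measurable P" if "1 \<le> m" for m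
    using W.independent_steps that by (auto simp: W.indep_vars_def)
  have [measurable]: "S n \<in> borel_measurable P" for n
    unfolding S_def by (intro borel_measurable_sum Z) auto
  have S_alg: "S k \<in> borel_measurable (W.generated_algebra borel J Z)" if "{1..k} \<subseteq> J" for k J
    unfolding S_def using that by (intro borel_measurable_sum W.measurable_generated_algebra_real) auto
  have [measurable]: "N \<in> measurable P (count_space UNIV)" by (rule W.measurable_N)
  \<comment> \<open>Removing one atom at a time from total mass 1 accounts for
    \<open>N = \<infinity>\<close> without summing a tail: for \<open>\<beta> = 0\<close> there is
    \<open>\<kappa> = 1\<close> and no mass is ever lost.\<close>
  have prob_N: "W.prob {w \<in> space P. enat n \<le> N w} = \<kappa> ^ n" for n
  proof (induction n)
    case 0
    then show ?case by (simp add: W.prob_space zero_enat_def[symmetric])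
  next
    case (Suc n)
    have "{w \<in> space P. enat n \<le> N w} = {w \<in> space P. N w = enat n} \<union> {w \<in> space P. enat (Suc n) \<le> N w}"
    proof -
      have "enat n \<le> N w \<longleftrightarrow> N w = enat n \<or> enat (Suc n) \<le> N w" for w
        by (cases "N w") auto
      then show ?thesis by auto
    qed
    then have "W.prob {w \<in> space P. enat n \<le> N w} =
        W.prob {w \<in> space P. N w = enat n} + W.prob {w \<in> space P. enat (Suc n) \<le> N w}"
      by (simp only:) (subst W.finite_measure_Union, auto)
    then have "W.prob {w \<in> space P. enat (Suc n) \<le> N w} = \<kappa> ^ n * (1 - \<beta> / q)"
      using W.N_law[of n] Suc by (simp add: \<kappa>_def q_def algebra_simps)
    then show ?case using \<kappa>(2) by (simp add: eq_diff_eq[symmetric] mult.commute)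
  qed
  have "exponential_with_atom P (\<lambda>w. SUP n\<in>{n. enat n \<le> N w}. ereal (S n w))
    (right_inverse M Y \<beta> / right_inverse M Y (\<beta> + \<omega>)) (right_inverse M Y \<beta>)"
  proof (rule discounted_maximum[where V = "\<lambda>n w. ennreal (\<kappa> ^ n)"])
    show "prob_space P" by (rule W.prob_space_axioms)
    show "enat (Suc n) \<le> N w \<Longrightarrow> enat n \<le> N w" for n w
      by (meson enat_ord_simps(1) le_SucI order_refl order_trans)
    fix n :: nat and x :: real assume "0 \<le> x"
    define C where "C = {w \<in> space P. \<forall>k\<le>n. S k w \<le> x}"
    show "(\<integral>\<^sup>+w. ennreal (\<kappa> ^ Suc n) * (indicator {w \<in> space P. \<forall>k\<le>n. S k w \<le> x} w * f (S n w, S (Suc n) w - S n w)) \<partial>P) =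
        ennreal (\<omega> / (\<beta> + \<omega>)) * (\<integral>\<^sup>+w. ennreal (\<kappa> ^ n) * (indicator {w \<in> space P. \<forall>k\<le>n. S k w \<le> x} w *
          (\<integral>\<^sup>+z. f (S n w, z) \<partial>step_distribution (\<beta> + \<omega>))) \<partial>P)"
      if [measurable]: "f \<in> borel_measurable (borel \<Otimes>\<^sub>M borel)" for f
    proof -
      let ?A = "W.generated_algebra borel {1..n} Z" and ?B = "W.generated_algebra borel {Suc n} Z"
      have [measurable]: "Z (Suc n) \<in> borel_measurable ?B" "Z (Suc n) \<in> borel_measurable P"
        using Z by auto
      have [measurable]: "S k \<in> borel_measurable ?A" if "k \<le> n" for k
        using that by (intro S_alg) auto
      have C_eq: "C = {w \<in> space ?A. \<forall>k\<in>{..n}. S k w \<le> x}"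
        unfolding W.space_generated_algebra C_def by blast
      have [measurable]: "C \<in> sets ?A" unfolding C_eq by measurable
      have [measurable]: "C \<in> sets P" unfolding C_def by measurable
      interpret D: prob_space "step_distribution (\<beta> + \<omega>)"
        using q by (intro prob_space_step_distribution) (simp add: q_def)
      have "(\<integral>\<^sup>+w. ennreal (\<kappa> ^ Suc n) * (indicator C w * f (S n w, S (Suc n) w - S n w)) \<partial>P) =
          (\<integral>\<^sup>+w. ennreal (\<kappa> ^ Suc n) * (indicator C w * f (S n w, Z (Suc n) w)) \<partial>P)"
      proof -
        have "S (Suc n) w - S n w = Z (Suc n) w" for w by (simp add: S_def)
        then show ?thesis by simp
      qed
      also have "\<dots> = (\<integral>\<^sup>+w. (\<integral>\<^sup>+v. ennreal (\<kappa> ^ Suc n) * (indicator C w * f (S n w, Z (Suc n) v)) \<partial>P) \<partial>P)"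
      proof (rule W.decoupling[where A = ?A and B = ?B])
        show "W.indep_set (sets ?A) (sets ?B)"
          unfolding W.sets_generated_algebra
          by (rule W.indep_set_generated_events[OF W.independent_steps]) auto
        show "(\<lambda>(w, v). ennreal (\<kappa> ^ Suc n) * (indicator C w * f (S n w, Z (Suc n) v))) \<in>
            borel_measurable (?A \<Otimes>\<^sub>M ?B)"
          by measurable
      qed simp_all
      also have "\<dots> = (\<integral>\<^sup>+w. ennreal (\<kappa> ^ Suc n) * (indicator C w * (\<integral>\<^sup>+z. f (S n w, z) \<partial>step_distribution (\<beta> + \<omega>))) \<partial>P)"
      proof (rule nn_integral_cong)
        fix w assume [measurable]: "w \<in> space P"
        have "(\<integral>\<^sup>+v. f (S n w, Z (Suc n) v) \<partial>P) = (\<integral>\<^sup>+z. f (S n w, z) \<partial>distr P borel (Z (Suc n)))"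
          by (subst nn_integral_distr) auto
        also have "\<dots> = (\<integral>\<^sup>+z. f (S n w, z) \<partial>step_distribution (\<beta> + \<omega>))"
          using W.step_law[of "Suc n"] by (simp add: step_distribution_def)
        finally show "(\<integral>\<^sup>+v. ennreal (\<kappa> ^ Suc n) * (indicator C w * f (S n w, Z (Suc n) v)) \<partial>P) =
            ennreal (\<kappa> ^ Suc n) * (indicator C w * (\<integral>\<^sup>+z. f (S n w, z) \<partial>step_distribution (\<beta> + \<omega>)))"
          by (simp add: nn_integral_cmult)
      qed
      also have "\<dots> = (\<integral>\<^sup>+w. ennreal \<kappa> * (ennreal (\<kappa> ^ n) * (indicator C w * (\<integral>\<^sup>+z. f (S n w, z) \<partial>step_distribution (\<beta> + \<omega>)))) \<partial>P)"
        using \<kappa>(1) by (simp add: ennreal_mult mult.assoc)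
      also have "\<dots> = ennreal (\<omega> / (\<beta> + \<omega>)) * (\<integral>\<^sup>+w. ennreal (\<kappa> ^ n) * (indicator C w *
          (\<integral>\<^sup>+z. f (S n w, z) \<partial>step_distribution (\<beta> + \<omega>))) \<partial>P)"
        by (subst nn_integral_cmult) (auto simp: \<kappa>_def q_def)
      finally show ?thesis unfolding C_def .
    qed
    let ?B = "{w \<in> space P. (\<forall>k\<le>n. S k w \<le> x) \<and> x < S (Suc n) w}"
    let ?A = "W.generated_algebra borel {1..} Z"
    have "{w \<in> space P. (\<forall>k\<le>n. S k w \<le> x) \<and> x < S (Suc n) w \<and> enat (Suc n) \<le> N w} =
        ?B \<inter> {w \<in> space P. enat (Suc n) \<le> N w}" by auto
    moreover have "W.prob (?B \<inter> {w \<in> space P. enat (Suc n) \<le> N w}) = W.prob ?B * \<kappa> ^ Suc n"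
    proof -
      have [measurable]: "S k \<in> borel_measurable ?A" for k by (rule S_alg) auto
      have "{w \<in> space ?A. (\<forall>k\<le>n. S k w \<le> x) \<and> x < S (Suc n) w} \<in> sets ?A" by measurable
      then have 1: "?B \<in> W.generated_events borel {1..} Z"
        unfolding W.sets_generated_algebra W.space_generated_algebra .
      have "{w \<in> space P. enat (Suc n) \<le> N w} = N -` {k. enat (Suc n) \<le> k} \<inter> space P" by auto
      then have 2: "{w \<in> space P. enat (Suc n) \<le> N w} \<in> W.generated_events (count_space UNIV) {()} (\<lambda>_. N)"
        unfolding W.generated_events_def by (intro sigma_sets.Basic) (auto simp del: vimage_Collect_eq)
      show ?thesis
        using W.indep_setD[OF W.steps_independent_of_N 1 2] prob_N by simp
    qed
    moreover have "(\<integral>\<^sup>+w. ennreal (\<kappa> ^ Suc n) * indicator ?B w \<partial>P) = ennreal (W.prob ?B * \<kappa> ^ Suc n)"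
    proof -
      have [measurable]: "?B \<in> sets P" by measurable
      show ?thesis
        using \<kappa>(1) by (simp add: nn_integral_cmult W.emeasure_eq_measure mult.commute flip: ennreal_mult del: power_Suc)
    qed
    ultimately show "emeasure P {w \<in> space P. (\<forall>k\<le>n. S k w \<le> x) \<and> x < S (Suc n) w \<and> enat (Suc n) \<le> N w} =
        (\<integral>\<^sup>+w. ennreal (\<kappa> ^ Suc n) * indicator ?B w \<partial>P)"
      by (simp add: W.emeasure_eq_measure)
  qed (use assms in \<open>auto simp: S_def zero_enat_def[symmetric]\<close>)
  then show ?thesis unfolding walk_maximum_def[abs_def] S_def .
qed

text \<open>The discount \<open>exp (- \<beta> * I n w)\<close> is the conditional probability,
  given path and epochs, that killing has not occurred by epoch \<open>n\<close>. It is random, so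
  the Markov step cannot be read off a step law: path and epochs are separated, the path increment
  and the gap are averaged in turn, and the two are joined again.\<close>

lemma (in spectrally_negative_levy_process) inspected_maximum_law:
  assumes inspection: "poisson_inspection M Y \<beta> \<omega> I T"
    and \<omega>: "0 < \<omega>" and \<beta>: "0 \<le> \<beta>" and drift: "\<beta> = 0 \<Longrightarrow> ext_expectation M (Y 1) < 0"
  shows "exponential_with_atom M (inspected_maximum Y I T)
    (right_inverse M Y \<beta> / right_inverse M Y (\<beta> + \<omega>)) (right_inverse M Y \<beta>)"
proof -
  interpret PI: poisson_inspection M Y \<beta> \<omega> I T by fact
  let ?GY = "generated_events borel {0..} Y"
  let ?GI = "generated_events borel UNIV I"
  let ?GT = "generated_events borel {()} (\<lambda>_. T)"
  let ?\<E> = "\<lambda>i. [?GY, ?GI, ?GT] ! i"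
  define gap where "gap n w = I (Suc n) w - I n w" for n w
  have q: "0 < \<beta> + \<omega>" using \<omega> \<beta> by simp
  have I_nonneg: "0 \<le> I n w" if "w \<in> space M" for n w
  proof (induction n)
    case (Suc n)
    then show ?case using PI.epochs_increasing[OF that, of n] by simp
  qed (simp add: PI.epoch_zero[OF that])
  have I_mono: "I k w \<le> I n w" if "w \<in> space M" "k \<le> n" for k n w
    using that(2) by (induction rule: dec_induct) (use PI.epochs_increasing[OF that(1)] in \<open>auto intro: order_trans less_imp_le\<close>)
  have I_sum: "I n w = (\<Sum>k<n. gap k w)" if "w \<in> space M" for n w
    by (induction n) (simp_all add: PI.epoch_zero[OF that] gap_def)
  have gap_meas [measurable]: "gap n \<in> borel_measurable M" for n
    using PI.gap_law[of n] unfolding gap_def by (auto simp: distributed_def)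
  have I_meas [measurable]: "I n \<in> borel_measurable M" for n
    by (rule measurable_cong[THEN iffD2, OF I_sum]) measurable
  have [measurable]: "T \<in> borel_measurable M" by (rule PI.measurable_T)
  let ?AY = "path_algebra" and ?AI = "generated_algebra borel UNIV I"
    and ?AT = "generated_algebra borel {()} (\<lambda>_. T)"

  have gen_sub: "?GY \<subseteq> events" "?GI \<subseteq> events" "?GT \<subseteq> events"
    by (rule generated_events_subset, simp, use measurable_Y PI.measurable_T I_meas in force)+
  define AYI where "AYI = sigma (space M) (?GY \<union> ?GI)"
  have space_AYI [simp]: "space AYI = space M"
    unfolding AYI_def by (rule space_measure_of) (use gen_sub sets.sets_into_space in blast)
  have sets_AYI: "sets AYI = sigma_sets (space M) (?GY \<union> ?GI)"
    unfolding AYI_def by (rule sets_measure_of) (use gen_sub sets.sets_into_space in blast)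
  \<comment> \<open>The inspected values depend on path and epochs together, so independence of
    three families is regrouped as this pair against the killing time.\<close>
  have pair_indep: "indep_set (sigma_sets (space M) (?GY \<union> ?GI)) ?GT"
  proof -
    let ?J = "\<lambda>b. if b then {0::nat, 1} else {2}"
    have "indep_sets (\<lambda>b. sigma_sets (space M) (\<Union>i\<in>?J b. ?\<E> i)) UNIV"
    proof (rule indep_sets_collect_sigma)
      show "indep_sets ?\<E> (\<Union>b\<in>UNIV. ?J b)"
        by (rule indep_sets_mono_index[OF _ PI.independent_inspection]) (auto simp: UNIV_bool)
      show "Int_stable (?\<E> i)" if "i \<in> ?J b" for b i
        using that by (auto split: if_splits intro: Int_stable_generated_events)
      show "disjoint_family_on ?J UNIV" by (auto simp: disjoint_family_on_def)
    qed
    moreover have "sigma_sets (space M) ?GT = ?GT"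
      using sets.sigma_sets_eq[of ?AT] by (simp add: sets_generated_algebra)
    ultimately show ?thesis
      unfolding indep_set_def by (elim indep_sets_mono_sets) (auto split: bool.split)
  qed
  have indep_YI: "indep_set (sets ?AI) (sets ?AY)"
  proof -
    have "prob (a \<inter> b) = prob a * prob b" if "a \<in> ?GI" "b \<in> ?GY" for a b
      using indep_setsD[OF PI.independent_inspection, of "{0, 1}" "\<lambda>i. if i = 0 then b else a"] that
      by (simp add: Int_commute mult.commute)
    then show ?thesis
      using gen_sub unfolding indep_sets2_eq sets_generated_algebra by blast
  qed
  have id_AY: "(\<lambda>w. w) \<in> measurable AYI ?AY" "(\<lambda>w. w) \<in> measurable M ?AY"
    using gen_sub(1) by (auto simp: measurable_def sets_AYI sets_generated_algebra Int_absorb2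
      dest: sets.sets_into_space intro!: sigma_sets.Basic)
  have I_AYI [measurable]: "I n \<in> borel_measurable AYI" for n
  proof (rule measurableI)
    fix A :: "real set" assume "A \<in> sets borel"
    then have "I n -` A \<inter> space M \<in> ?GI"
      unfolding generated_events_def by (intro sigma_sets.Basic) blast
    then show "I n -` A \<inter> space AYI \<in> sets AYI"
      by (simp add: sets_AYI sigma_sets.Basic)
  qed simp
  define S where "S n w = Y (I n w) w" for n w
  have S_eq: "S n w = Y (max 0 (I n w)) w" if "w \<in> space M" for n w
    using I_nonneg[OF that] by (simp add: S_def max_absorb2)
  have S_AYI [measurable]: "S n \<in> borel_measurable AYI" for n
    by (rule measurable_cong[THEN iffD2, OF _ measurable_process'[OF id_AY(1) I_AYI]]) (simp add: S_eq)
  have S_meas [measurable]: "S n \<in> borel_measurable M" for n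
    by (rule measurable_cong[THEN iffD2, OF S_eq]) measurable
  have T_law: "emeasure M {v \<in> space M. ereal a \<le> T v} = ennreal (exp (- \<beta> * a))" if "0 \<le> a" for a
  proof -
    have "emeasure M {v \<in> space M. ereal a \<le> T v} = emeasure (distr M borel T) {ereal a..}"
      by (subst emeasure_distr) (auto intro!: arg_cong[where f = "emeasure M"])
    then show ?thesis
      using emeasure_killing_law_atLeast[OF \<beta> that] by (simp add: PI.killing_time_law)
  qed
  have "exponential_with_atom M (\<lambda>w. SUP n\<in>{n. ereal (I n w) \<le> T w}. ereal (S n w))
    (right_inverse M Y \<beta> / right_inverse M Y (\<beta> + \<omega>)) (right_inverse M Y \<beta>)"
  proof (rule discounted_maximum[OF \<omega> \<beta> drift prob_space_axioms, where V = "\<lambda>n w. ennreal (exp (- \<beta> * I n w))"])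
    show "AE w in M. ennreal (exp (- \<beta> * I 0 w)) = 1"
      using AE_space by eventually_elim (simp add: PI.epoch_zero)
    show "AE w in M. S 0 w = 0"
      using AE_space start_zero by eventually_elim (simp add: S_def PI.epoch_zero)
    have "prob {v \<in> space M. ereal 0 \<le> T v} = 1"
      using T_law[of 0] by (simp add: emeasure_eq_measure)
    then have "AE w in M. w \<in> {v \<in> space M. ereal 0 \<le> T v}"
      by (subst AE_in_set_eq_1) auto
    then show "AE w in M. ereal (I 0 w) \<le> T w"
      by eventually_elim (simp add: PI.epoch_zero)
    show "ereal (I n w) \<le> T w" if "w \<in> space M" "ereal (I (Suc n) w) \<le> T w" for n w
      using that I_mono[OF that(1), of n "Suc n"] by (meson ereal_less_eq(3) le_SucI order_refl order_trans)
    fix n :: nat and x :: real assume "0 \<le> x"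
    show "emeasure M {w \<in> space M. (\<forall>k\<le>n. S k w \<le> x) \<and> x < S (Suc n) w \<and> ereal (I (Suc n) w) \<le> T w} =
        (\<integral>\<^sup>+w. ennreal (exp (- \<beta> * I (Suc n) w)) *
          indicator {w \<in> space M. (\<forall>k\<le>n. S k w \<le> x) \<and> x < S (Suc n) w} w \<partial>M)"
    proof -
      define B where "B = {w \<in> space M. (\<forall>k\<le>n. S k w \<le> x) \<and> x < S (Suc n) w}"
      have "B = {w \<in> space AYI. (\<forall>k\<le>n. S k w \<le> x) \<and> x < S (Suc n) w}"
        unfolding space_AYI B_def ..
      moreover have "{w \<in> space AYI. (\<forall>k\<le>n. S k w \<le> x) \<and> x < S (Suc n) w} \<in> sets AYI"
        by measurable
      ultimately have [measurable]: "B \<in> sets AYI" by (simp only:)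
      have [measurable]: "B \<in> sets M" unfolding B_def by measurable
      have [measurable]: "T \<in> borel_measurable ?AT"
        by (rule measurable_generated_algebra_real[where X = "\<lambda>_. T"]) simp
      define F :: "'a \<Rightarrow> 'a \<Rightarrow> ennreal" where
        "F w v = indicator B w * (if ereal (I (Suc n) w) \<le> T v then 1 else 0)" for w v
      have "emeasure M {w \<in> space M. (\<forall>k\<le>n. S k w \<le> x) \<and> x < S (Suc n) w \<and> ereal (I (Suc n) w) \<le> T w} =
          emeasure M {w \<in> space M. w \<in> B \<and> ereal (I (Suc n) w) \<le> T w}"
        by (rule arg_cong[where f = "emeasure M"]) (auto simp: B_def)
      also have "\<dots> = (\<integral>\<^sup>+w. indicator {w \<in> space M. w \<in> B \<and> ereal (I (Suc n) w) \<le> T w} w \<partial>M)"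
        by (rule nn_integral_indicator[symmetric]) measurable
      also have "\<dots> = (\<integral>\<^sup>+w. F w w \<partial>M)"
        by (intro nn_integral_cong) (auto simp: F_def split: split_indicator)
      also have "\<dots> = (\<integral>\<^sup>+w. (\<integral>\<^sup>+v. F w v \<partial>M) \<partial>M)"
      proof (rule decoupling[where A = AYI and B = ?AT])
        show "indep_set (sets AYI) (sets ?AT)"
          using pair_indep by (simp add: sets_AYI sets_generated_algebra)
        show "(\<lambda>(w, v). F w v) \<in> borel_measurable (AYI \<Otimes>\<^sub>M ?AT)"
          unfolding F_def by measurable
      qed simp_all
      also have "\<dots> = (\<integral>\<^sup>+w. ennreal (exp (- \<beta> * I (Suc n) w)) * indicator B w \<partial>M)"
      proof (rule nn_integral_cong)
        fix w assume w: "w \<in> space M"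
        have "(\<integral>\<^sup>+v. F w v \<partial>M) = (\<integral>\<^sup>+v. indicator B w * indicator {v \<in> space M. ereal (I (Suc n) w) \<le> T v} v \<partial>M)"
          unfolding F_def by (intro nn_integral_cong) (auto split: split_indicator)
        also have "\<dots> = indicator B w * ennreal (exp (- \<beta> * I (Suc n) w))"
          using I_nonneg[OF w] by (subst nn_integral_cmult_indicator) (auto simp: T_law)
        finally show "(\<integral>\<^sup>+v. F w v \<partial>M) = ennreal (exp (- \<beta> * I (Suc n) w)) * indicator B w"
          by (simp add: mult.commute)
      qed
      finally show ?thesis unfolding B_def .
    qed
    show "(\<integral>\<^sup>+w. ennreal (exp (- \<beta> * I (Suc n) w)) * (indicator {w \<in> space M. \<forall>k\<le>n. S k w \<le> x} w *
          f (S n w, S (Suc n) w - S n w)) \<partial>M) =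
        ennreal (\<omega> / (\<beta> + \<omega>)) * (\<integral>\<^sup>+w. ennreal (exp (- \<beta> * I n w)) *
          (indicator {w \<in> space M. \<forall>k\<le>n. S k w \<le> x} w *
          (\<integral>\<^sup>+z. f (S n w, z) \<partial>step_distribution (\<beta> + \<omega>))) \<partial>M)"
      if f [measurable]: "f \<in> borel_measurable (borel \<Otimes>\<^sub>M borel)" for f
    proof -
      interpret MM: pair_prob_space M M ..
      interpret D: prob_space "step_distribution (\<beta> + \<omega>)"
        using q by (rule prob_space_step_distribution)
      \<comment> \<open>Here \<open>v\<close> carries the epochs and \<open>w\<close> the path; on
        the diagonal \<open>R\<close> is the inspected process. \<open>F\<close> is the integrand as
        given, \<open>G\<close> has the path increment averaged, and \<open>H\<close> has the gap
        averaged as well.\<close>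
      define R where "R k v w = Y (max 0 (I k v)) w" for k v w
      define C :: "'a \<Rightarrow> 'a \<Rightarrow> ennreal" where "C v w = (if \<forall>k\<in>{..n}. R k v w \<le> x then 1 else 0)" for v w
      define h where "h y = (\<integral>\<^sup>+z. f (y, z) \<partial>step_distribution (\<beta> + \<omega>))" for y
      define \<psi> where "\<psi> y e = (\<integral>\<^sup>+u. f (y, Y (max 0 e) u) \<partial>M)" for y e
      define F where "F v w = ennreal (exp (- \<beta> * I (Suc n) v)) * (C v w * f (R n v w, R (Suc n) v w - R n v w))" for v w
      define G where "G v w = ennreal (exp (- \<beta> * I n v)) *
        (C v w * (ennreal (exp (- \<beta> * gap n v)) * \<psi> (R n v w) (gap n v)))" for v w
      define H where "H v w = ennreal (exp (- \<beta> * I n v)) * (C v w * h (R n v w))" for v w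
      have [measurable]: "h \<in> borel_measurable borel"
        unfolding h_def by measurable
      have [measurable]: "(\<lambda>x. \<psi> (a x) (b x)) \<in> borel_measurable L"
        if [measurable]: "a \<in> borel_measurable L" "b \<in> borel_measurable L" for a b and L :: "'z measure"
        unfolding \<psi>_def by measurable
      have [measurable]: "I k \<in> borel_measurable ?AI" for k by auto
      have R_alg [measurable]: "(\<lambda>p. R k (fst p) (snd p)) \<in> borel_measurable (?AI \<Otimes>\<^sub>M ?AY)" for k
        unfolding R_def by (rule measurable_process') measurable
      have R_M [measurable]: "(\<lambda>p. R k (fst p) (snd p)) \<in> borel_measurable (M \<Otimes>\<^sub>M M)" for k
        unfolding R_def by measurable
      have diag: "R k w w = S k w" if "w \<in> space M" for k w
        using S_eq[OF that] by (simp add: R_def)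
      have C_diag: "C w w = indicator {w \<in> space M. \<forall>k\<le>n. S k w \<le> x} w" if "w \<in> space M" for w
        using that by (auto simp: C_def diag split: split_indicator)
      \<comment> \<open>With the epochs frozen, the increment runs between two deterministic times
        and the Markov property of the path applies.\<close>
      have path_step: "(\<integral>\<^sup>+w. F v w \<partial>M) = (\<integral>\<^sup>+w. G v w \<partial>M)" if v: "v \<in> space M" for v
      proof -
        let ?s = "I n v" and ?t = "gap n v"
        have st: "0 \<le> ?s" "0 \<le> ?t" "?s + ?t = I (Suc n) v"
          using I_nonneg[OF v] PI.epochs_increasing[OF v, of n] by (auto simp: gap_def)
        have Rv: "R k v = Y (I k v)" for k
          using I_nonneg[OF v] by (simp add: R_def fun_eq_iff max_absorb2)
        have [measurable]: "Y ?t \<in> borel_measurable M" by (rule measurable_Y[OF st(2)])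
        have [measurable]: "Y (I k v) \<in> borel_measurable (generated_algebra borel {0..?s} Y)" if "k \<le> n" for k
          using that I_nonneg[OF v] I_mono[OF v] by auto
        have [measurable]: "Y (I n v) \<in> borel_measurable (generated_algebra borel {0..?s} Y)"
          using I_nonneg[OF v] by auto
        have [measurable]: "C v \<in> borel_measurable (generated_algebra borel {0..?s} Y)"
          unfolding C_def Rv by measurable
        have "(\<integral>\<^sup>+w. F v w \<partial>M) = (\<integral>\<^sup>+w. (\<lambda>w d. ennreal (exp (- \<beta> * I (Suc n) v)) * (C v w * f (Y ?s w, d))) w
            (Y (?s + ?t) w - Y ?s w) \<partial>M)"
          by (simp add: F_def Rv st(3))
        also have "\<dots> = (\<integral>\<^sup>+w. (\<integral>\<^sup>+u. ennreal (exp (- \<beta> * I (Suc n) v)) * (C v w * f (Y ?s w, Y ?t u)) \<partial>M) \<partial>M)"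
          by (rule decouple_increment[OF st(1,2)]) measurable
        also have "\<dots> = (\<integral>\<^sup>+w. G v w \<partial>M)"
        proof (rule nn_integral_cong)
          fix w assume [measurable]: "w \<in> space M"
          have "ennreal (exp (- \<beta> * I (Suc n) v)) = ennreal (exp (- \<beta> * I n v)) * ennreal (exp (- \<beta> * gap n v))"
            by (simp add: gap_def mult_exp_exp algebra_simps flip: ennreal_mult)
          then show "(\<integral>\<^sup>+u. ennreal (exp (- \<beta> * I (Suc n) v)) * (C v w * f (Y ?s w, Y ?t u)) \<partial>M) = G v w"
            using st(2) by (simp add: G_def \<psi>_def Rv nn_integral_cmult max_absorb2 mult_ac)
        qed
        finally show ?thesis .
      qed
      \<comment> \<open>With the path frozen, everything except the last gap depends on earlier gaps
        only.\<close>
      have gap_step: "(\<integral>\<^sup>+v. G v w \<partial>M) = (\<integral>\<^sup>+v. ennreal (\<omega> / (\<beta> + \<omega>)) * H v w \<partial>M)" if w [measurable]: "w \<in> space M" for w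
      proof -
        let ?A = "generated_algebra borel {..<n} gap" and ?B = "generated_algebra borel {n} gap"
        have [measurable]: "gap n \<in> borel_measurable ?B" by auto
        have I_A [measurable]: "I k \<in> borel_measurable ?A" if "k \<le> n" for k
        proof (rule measurable_cong[THEN iffD2])
          show "(\<lambda>v. \<Sum>j<k. gap j v) \<in> borel_measurable ?A"
            using that by (intro borel_measurable_sum measurable_generated_algebra_real) auto
        qed (simp add: I_sum)
        have [measurable]: "I n \<in> borel_measurable ?A" by (rule I_A) simp
        have R_A [measurable]: "(\<lambda>v. R k v w) \<in> borel_measurable ?A" if "k \<le> n" for k
          unfolding R_def using I_A[OF that] w by measurable
        have [measurable]: "(\<lambda>v. R n v w) \<in> borel_measurable ?A" by (rule R_A) simp
        have [measurable]: "(\<lambda>v. C v w) \<in> borel_measurable ?A"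
          unfolding C_def by measurable
        have "(\<integral>\<^sup>+v. G v w \<partial>M) = (\<integral>\<^sup>+v. (\<integral>\<^sup>+v'. ennreal (exp (- \<beta> * I n v)) *
            (C v w * (ennreal (exp (- \<beta> * gap n v')) * \<psi> (R n v w) (gap n v'))) \<partial>M) \<partial>M)"
          unfolding G_def
        proof (rule decoupling[where A = ?A and B = ?B])
          show "indep_set (sets ?A) (sets ?B)"
            unfolding sets_generated_algebra
            by (rule indep_set_generated_events[OF PI.independent_gaps[folded gap_def]]) auto
          show "(\<lambda>(v, v'). ennreal (exp (- \<beta> * I n v)) *
            (C v w * (ennreal (exp (- \<beta> * gap n v')) * \<psi> (R n v w) (gap n v')))) \<in> borel_measurable (?A \<Otimes>\<^sub>M ?B)"
            by measurable
        qed simp_all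
        also have "\<dots> = (\<integral>\<^sup>+v. ennreal (\<omega> / (\<beta> + \<omega>)) * H v w \<partial>M)"
        proof (rule nn_integral_cong)
          fix v
          have "(\<integral>\<^sup>+v'. ennreal (exp (- \<beta> * gap n v')) * \<psi> (R n v w) (gap n v') \<partial>M) =
              (\<integral>\<^sup>+e. ennreal (exponential_density \<omega> e) * (ennreal (exp (- \<beta> * e)) * \<psi> (R n v w) e) \<partial>lborel)"
            using PI.gap_law[of n, folded gap_def]
            by (subst distributed_nn_integral[symmetric]) auto
          also have "\<dots> = (\<integral>\<^sup>+e. ennreal (exp (- \<beta> * e)) * \<psi> (R n v w) e \<partial>exponential_measure \<omega>)"
            by (simp add: nn_integral_exponential_measure)
          \<comment> \<open>Tilting by \<open>exp (- \<beta> * e)\<close> turns the gap of rate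
            \<open>\<omega>\<close> into one of rate \<open>\<beta> + \<omega>\<close> and releases
            the factor \<open>\<kappa>\<close>.\<close>
          also have "\<dots> = ennreal (\<omega> / (\<beta> + \<omega>)) * (\<integral>\<^sup>+e. \<psi> (R n v w) e \<partial>exponential_measure (\<beta> + \<omega>))"
            using exponential_tilt[of "\<psi> (R n v w)" "- \<beta>" \<omega>] \<omega> \<beta> by (simp add: add.commute)
          also have "(\<integral>\<^sup>+e. \<psi> (R n v w) e \<partial>exponential_measure (\<beta> + \<omega>)) = h (R n v w)"
            unfolding \<psi>_def h_def using q by (subst nn_integral_step_distribution(2)) auto
          finally show "(\<integral>\<^sup>+v'. ennreal (exp (- \<beta> * I n v)) *
              (C v w * (ennreal (exp (- \<beta> * gap n v')) * \<psi> (R n v w) (gap n v'))) \<partial>M) =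
              ennreal (\<omega> / (\<beta> + \<omega>)) * H v w"
            by (simp add: nn_integral_cmult H_def mult_ac)
        qed
        finally show ?thesis .
      qed
      have "(\<integral>\<^sup>+w. ennreal (exp (- \<beta> * I (Suc n) w)) * (indicator {w \<in> space M. \<forall>k\<le>n. S k w \<le> x} w *
          f (S n w, S (Suc n) w - S n w)) \<partial>M) = (\<integral>\<^sup>+w. F w w \<partial>M)"
        unfolding F_def by (intro nn_integral_cong) (simp only: diag C_diag)
      also have "\<dots> = (\<integral>\<^sup>+v. (\<integral>\<^sup>+w. F v w \<partial>M) \<partial>M)"
        by (rule decoupling[OF indep_YI]) (simp_all add: F_def C_def)
      also have "\<dots> = (\<integral>\<^sup>+v. (\<integral>\<^sup>+w. G v w \<partial>M) \<partial>M)"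
        by (intro nn_integral_cong path_step)
      also have "\<dots> = (\<integral>\<^sup>+w. (\<integral>\<^sup>+v. G v w \<partial>M) \<partial>M)"
        by (rule MM.Fubini'[symmetric]) (simp add: G_def C_def)
      also have "\<dots> = (\<integral>\<^sup>+w. (\<integral>\<^sup>+v. ennreal (\<omega> / (\<beta> + \<omega>)) * H v w \<partial>M) \<partial>M)"
        by (intro nn_integral_cong gap_step)
      also have "\<dots> = (\<integral>\<^sup>+v. (\<integral>\<^sup>+w. ennreal (\<omega> / (\<beta> + \<omega>)) * H v w \<partial>M) \<partial>M)"
        by (rule MM.Fubini') (simp add: H_def C_def)
      \<comment> \<open>Decoupling read backwards: after both averages the integrand is again
        evaluated on the diagonal, where it is the discounted walk at time \<open>n\<close>.\<close>
      also have "\<dots> = (\<integral>\<^sup>+w. ennreal (\<omega> / (\<beta> + \<omega>)) * H w w \<partial>M)"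
        by (rule decoupling[OF indep_YI, symmetric]) (simp_all add: H_def C_def)
      also have "\<dots> = (\<integral>\<^sup>+w. ennreal (\<omega> / (\<beta> + \<omega>)) * (ennreal (exp (- \<beta> * I n w)) *
          (indicator {w \<in> space M. \<forall>k\<le>n. S k w \<le> x} w * h (S n w))) \<partial>M)"
        unfolding H_def by (intro nn_integral_cong) (simp only: diag C_diag)
      also have "\<dots> = ennreal (\<omega> / (\<beta> + \<omega>)) * (\<integral>\<^sup>+w. ennreal (exp (- \<beta> * I n w)) *
          (indicator {w \<in> space M. \<forall>k\<le>n. S k w \<le> x} w * h (S n w)) \<partial>M)"
        by (rule nn_integral_cmult) measurable
      finally show ?thesis unfolding h_def .
    qed
  qed (auto intro: S_meas)
  then show ?thesis unfolding inspected_maximum_def[abs_def] S_def .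
qed

theorem mainTheorem5:
  fixes M :: "'a measure" and Y :: "real \<Rightarrow> 'a \<Rightarrow> real" and \<beta> \<omega> :: real
    and P :: "'b measure" and Z :: "nat \<Rightarrow> 'b \<Rightarrow> real" and N :: "'b \<Rightarrow> enat"
    and I :: "nat \<Rightarrow> 'a \<Rightarrow> real" and T :: "'a \<Rightarrow> ereal"
  assumes "spectrally_negative_levy_process M Y"
    and "0 < \<omega>" and "0 \<le> \<beta>"
    and "\<beta> = 0 \<Longrightarrow> ext_expectation M (Y 1) < 0"
  shows "(killed_inspection_walk P M Y \<beta> \<omega> Z N \<longrightarrow>
            exponential_with_atom P (walk_maximum Z N)
              (right_inverse M Y \<beta> / right_inverse M Y (\<beta> + \<omega>)) (right_inverse M Y \<beta>)) \<and>
         (poisson_inspection M Y \<beta> \<omega> I T \<longrightarrow>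
            exponential_with_atom M (inspected_maximum Y I T)
              (right_inverse M Y \<beta> / right_inverse M Y (\<beta> + \<omega>)) (right_inverse M Y \<beta>))"
proof -
  interpret spectrally_negative_levy_process M Y by fact
  show ?thesis
    using walk_maximum_law inspected_maximum_law assms by blast
qed

end
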